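(* Let $N\ge1$, $0<s<1$. Assume (V$_1$) and ($f_1$)–($f_4$), and assume moreover that $\lim_{|x|\to+\infty}V(x)=+\infty$. Then the equation $(-\Delta)^s u + V(x)u = f(x,u)$ in $\mathbb{R}^N$ has at least one non-trivial (weak) solution $u\in E^s$.
   Context: $\hat u$ denotes the Fourier transform and $(-\Delta)^s u=\mathcal{F}^{-1}(|\xi|^{2s}\hat u)$. Assumptions: (V$_1$) $V\in C^1(\mathbb{R}^N)$ and $\inf_{\mathbb{R}^N}V=V_0>0$. ($f_1$) $f\in C^1(\mathbb{R}^N\times\mathbb{R})$. ($f_2$) $f(x,0)=0=\frac{\partial f}{\partial s}(x,0)$ for all $x$. ($f_3$) there are constants $a_1,a_2>0$ and $1<p<\frac{N+2s}{N-2s}$ (in particular $N>2s$) with $|\frac{\partial f}{\partial s}(x,s)|\le a_1+a_2|s|^{p-1}$ for all $x,s$. ($f_4$) there is $\mu>2$ with $0<\mu F(x,s)\le s f(x,s)$ for all $x\in\mathbb{R}^N$, $s\neq0$, where $F(x,s)=\int_0^s f(x,t)\,dt$. The Hilbert space $E^s=\{u\in L^2(\mathbb{R}^N): \int|\xi|^{2s}|\hat u|^2\,d\xi+\int V|u|^2\,dx<\infty\}$ has norm $\|u\|^2=\int|\xi|^{2s}|\hat u(\xi)|^2d\xi+\int V(x)|u(x)|^2dx$. Weak solutions are critical points of $J(u)=\frac12\|u\|^2-\int F(x,u(x))\,dx$ on $E^s$. *)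

theory Defs
  imports "HOL-Analysis.Analysis"
begin

text \<open>Unitary Fourier transform of an integrable real function on R^N (N = DIM('a)):
  hat u(xi) = (2 pi)^(-N/2) * integral of exp(-i x.xi) u(x) dx.
  With this convention (-Delta)^s corresponds to the multiplier |xi|^(2s).\<close>
definition fourier1 :: "('a::euclidean_space \<Rightarrow> real) \<Rightarrow> 'a \<Rightarrow> complex" where
  "fourier1 u \<xi> = complex_of_real ((2 * pi) powr (- real DIM('a) / 2)) *
     (\<integral>x. cis (- (x \<bullet> \<xi>)) * complex_of_real (u x) \<partial>lborel)"

definition is_fourier_L2 :: "('a::euclidean_space \<Rightarrow> real) \<Rightarrow> ('a \<Rightarrow> complex) \<Rightarrow> bool" where
  "is_fourier_L2 u g \<longleftrightarrow> g \<in> borel_measurable lborel \<and>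
     ((\<lambda>R::real. \<integral>\<^sup>+ \<xi>. ennreal ((cmod (g \<xi> - fourier1 (\<lambda>x. indicator (ball 0 R) x * u x) \<xi>))\<^sup>2) \<partial>lborel)
        \<longlongrightarrow> 0) at_top"

definition in_Es :: "('a::euclidean_space \<Rightarrow> real) \<Rightarrow> real \<Rightarrow> ('a \<Rightarrow> real) \<Rightarrow> bool" where
  "in_Es V s u \<longleftrightarrow> u \<in> borel_measurable lborel \<and>
     (\<integral>\<^sup>+ x. ennreal ((u x)\<^sup>2) \<partial>lborel) < \<infinity> \<and>
     (\<exists>g. is_fourier_L2 u g \<and>
        (\<integral>\<^sup>+ \<xi>. ennreal (norm \<xi> powr (2 * s) * (cmod (g \<xi>))\<^sup>2) \<partial>lborel) < \<infinity>) \<and>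
     (\<integral>\<^sup>+ x. ennreal (V x * (u x)\<^sup>2) \<partial>lborel) < \<infinity>"

text \<open>Weak solution of (-Delta)^s u + V u = f(x,u) in R^N: u in E^s and for every test
  function phi in E^s, <u,phi> = integral of f(x,u) phi, where <.,.> is the inner product of E^s
  (i.e. u is a critical point of J).\<close>
definition weak_solution ::
  "real \<Rightarrow> ('a::euclidean_space \<Rightarrow> real) \<Rightarrow> ('a \<Rightarrow> real \<Rightarrow> real) \<Rightarrow> ('a \<Rightarrow> real) \<Rightarrow> bool" where
  "weak_solution s V f u \<longleftrightarrow> in_Es V s u \<and>
     (\<forall>\<phi>. in_Es V s \<phi> \<longrightarrow> (\<forall>g h. is_fourier_L2 u g \<longrightarrow> is_fourier_L2 \<phi> h \<longrightarrow>
        (\<integral>\<xi>. norm \<xi> powr (2 * s) * Re (g \<xi> * cnj (h \<xi>)) \<partial>lborel)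
          + (\<integral>x. V x * u x * \<phi> x \<partial>lborel)
        = (\<integral>x. f x (u x) * \<phi> x \<partial>lborel)))"

end

theory Submission
  imports Defs "HOL-Probability.Characteristic_Functions" "HOL-Library.Function_Algebras"
    "HOL-Library.Diagonal_Subsequence"
begin

text \<open>
  The solution is a mountain pass point of \<open>J\<close> on \<open>E\<^sup>s\<close>. The minimax level is approached by
  applying explicit Euler steps of the gradient flow to paths, which works because the gradient
  \<open>G = I - K\<close> of \<open>J\<close> is Lipschitz on bounded sets. Ambrosetti-Rabinowitz bounds Palais-Smale
  sequences, and they converge because \<open>K\<close> is compact.

  All analytic input about \<open>E\<^sup>s\<close> comes from the Nikolskii estimate
  \<open>\<parallel>u(\<cdot> + h) - u\<parallel> \<le> 2 |h|\<^sup>s [u]\<close> in \<open>L\<^sup>2\<close>, a consequence of Plancherel's theorem.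
  It controls the distance from \<open>u\<close> to its averages over dyadic cubes. These averages are locally
  finite dimensional, which together with the coercivity of \<open>V\<close> gives compactness in \<open>L\<^sup>2\<close>; and they
  grow in sup norm only like \<open>2\<close> to the power \<open>k (N/2 - s)\<close>, which gives the Sobolev inequality
  for all subcritical exponents.
\<close>

section \<open>Mountain passes in semi-Hilbert spaces\<close>

text \<open>Weak limits never occur: everything is arranged so that Cauchy sequences suffice. Since
  \<open>u = G u + K u\<close>, a Palais-Smale sequence is Cauchy in energy as soon as its image
  under \<open>K\<close> is. Differences of \<open>K\<close> are controlled by two numbers, the L^2
  norm and the L^q norm of the difference of the arguments, with \<open>q = p + 1\<close>. As q is
  subcritical, on energy-bounded sets the second number is small whenever the first is
  (\<open>Lq_small\<close>), so that compactness in L^2 is all that is left to prove. The same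
  two-number bound makes \<open>G\<close> Lipschitz on balls. This is what a discrete descent needs:
  a path is compact, hence bounded, and a descent of prescribed total length stays in a slightly
  larger ball, where one constant fixes the step size. Finitely many Euler steps then take the place
  of a deformation along a flow. Dyadic averages play the part of low-frequency projections. They
  are explicit integral operators on nested cubes, so that approximation, sup bounds and compactness
  all come from Jensen's inequality and Fubini's theorem, without convolution or
  interpolation.\<close>

text \<open>The form is only semidefinite, because functions that agree almost everywhere are not identified.\<close>

locale semi_inner =
  fixes E :: "'v::real_vector set" and B :: "'v \<Rightarrow> 'v \<Rightarrow> real"
  assumes subsp: "subspace E"
    and B_sym: "u \<in> E \<Longrightarrow> v \<in> E \<Longrightarrow> B u v = B v u"
    and B_add: "u \<in> E \<Longrightarrow> v \<in> E \<Longrightarrow> w \<in> E \<Longrightarrow> B (u + v) w = B u w + B v w"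
    and B_scale: "u \<in> E \<Longrightarrow> v \<in> E \<Longrightarrow> B (r *\<^sub>R u) v = r * B u v"
    and B_nonneg: "u \<in> E \<Longrightarrow> 0 \<le> B u u"
begin

section \<open>Calculus of the seminorm\<close>

definition N :: "'v \<Rightarrow> real" where "N u = sqrt (B u u)"

lemma E_add [simp]: "u \<in> E \<Longrightarrow> v \<in> E \<Longrightarrow> u + v \<in> E"
  and E_scale [simp]: "u \<in> E \<Longrightarrow> r *\<^sub>R u \<in> E"
  and E_diff [simp]: "u \<in> E \<Longrightarrow> v \<in> E \<Longrightarrow> u - v \<in> E"
  and E_zero [simp]: "0 \<in> E"
  and E_minus [simp]: "u \<in> E \<Longrightarrow> - u \<in> E"
  using subsp by (auto simp: subspace_add subspace_scale subspace_diff subspace_0 subspace_neg)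

lemma B_minus: "u \<in> E \<Longrightarrow> v \<in> E \<Longrightarrow> B (- u) v = - B u v"
  using B_scale[of u v "-1"] by simp

lemma B_diff: "u \<in> E \<Longrightarrow> v \<in> E \<Longrightarrow> w \<in> E \<Longrightarrow> B (u - v) w = B u w - B v w"
  using B_add[of u "- v" w] B_minus[of v w] by simp

lemma B_add2: "u \<in> E \<Longrightarrow> v \<in> E \<Longrightarrow> w \<in> E \<Longrightarrow> B w (u + v) = B w u + B w v"
  by (metis B_add B_sym E_add)

lemma B_scale2: "u \<in> E \<Longrightarrow> v \<in> E \<Longrightarrow> B v (r *\<^sub>R u) = r * B v u"
  by (metis B_scale B_sym E_scale)

lemma B_diff2: "u \<in> E \<Longrightarrow> v \<in> E \<Longrightarrow> w \<in> E \<Longrightarrow> B w (u - v) = B w u - B w v"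
  by (metis B_diff B_sym E_diff)

lemma B_zero: "u \<in> E \<Longrightarrow> B 0 u = 0" "u \<in> E \<Longrightarrow> B u 0 = 0"
  using B_scale[of u u 0] B_scale2[of u u 0] by simp_all

lemma N_nonneg [simp]: "u \<in> E \<Longrightarrow> 0 \<le> N u"
  by (simp add: N_def B_nonneg)

lemma N_sq: "u \<in> E \<Longrightarrow> (N u)\<^sup>2 = B u u"
  by (simp add: N_def B_nonneg)

lemma N_zero [simp]: "N 0 = 0"
  by (simp add: N_def B_zero)

lemma N_scale: "u \<in> E \<Longrightarrow> N (r *\<^sub>R u) = \<bar>r\<bar> * N u"
  by (simp add: N_def B_scale B_scale2 real_sqrt_mult flip: mult.assoc power2_eq_square)

lemma N_minus: "u \<in> E \<Longrightarrow> N (- u) = N u"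
  using N_scale[of u "-1"] by simp

lemma N_diff_commute: "u \<in> E \<Longrightarrow> v \<in> E \<Longrightarrow> N (u - v) = N (v - u)"
  using N_minus[of "u - v"] by simp

lemma quadratic_expand:
  "u \<in> E \<Longrightarrow> v \<in> E \<Longrightarrow> B (u + t *\<^sub>R v) (u + t *\<^sub>R v) = B u u + 2 * t * B u v + t\<^sup>2 * B v v"
  by (simp add: B_add B_add2 B_scale B_scale2 B_sym[of v u] power2_eq_square algebra_simps)

lemma cauchy_schwarz:
  assumes "u \<in> E" "v \<in> E" shows "\<bar>B u v\<bar> \<le> N u * N v"
proof -
  have "(B u v)\<^sup>2 \<le> B u u * B v v"
  proof (cases "B v v = 0")
    case False
    then have p: "B v v > 0" using B_nonneg[OF assms(2)] by simp
    have "0 \<le> B (u + (- B u v / B v v) *\<^sub>R v) (u + (- B u v / B v v) *\<^sub>R v)"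
      using assms by (intro B_nonneg) simp
    also have "\<dots> = B u u - (B u v)\<^sup>2 / B v v"
      using p by (subst quadratic_expand[OF assms]) (simp add: field_simps power2_eq_square)
    finally show ?thesis using p by (simp add: field_simps)
  next
    case True
    have "B u v = 0"
    proof (rule ccontr)
      assume nz: "B u v \<noteq> 0"
      \<comment> \<open>With \<open>B v v = 0\<close> the quadratic is affine in \<open>t\<close>,
        and this \<open>t\<close> gives it the value -1.\<close>
      define t where "t = - (B u u + 1) / (2 * B u v)"
      have "0 \<le> B (u + t *\<^sub>R v) (u + t *\<^sub>R v)"
        using assms by (intro B_nonneg) simp
      also have "\<dots> = -1"
        using assms nz True by (simp add: quadratic_expand t_def field_simps)
      finally show False by simp
    qed
    then show ?thesis using True by simp
  qed
  then have "\<bar>B u v\<bar> \<le> sqrt (B u u * B v v)"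
    by (metis real_sqrt_abs real_sqrt_le_mono)
  then show ?thesis by (simp add: N_def real_sqrt_mult)
qed

lemma N_triangle:
  assumes "u \<in> E" "v \<in> E" shows "N (u + v) \<le> N u + N v"
proof (rule power2_le_imp_le)
  have "(N (u + v))\<^sup>2 = (N u)\<^sup>2 + 2 * B u v + (N v)\<^sup>2"
    using assms quadratic_expand[of u v 1] by (simp add: N_sq)
  also have "\<dots> \<le> (N u + N v)\<^sup>2"
    using cauchy_schwarz[OF assms] by (simp add: power2_sum)
  finally show "(N (u + v))\<^sup>2 \<le> (N u + N v)\<^sup>2" .
qed (use assms in simp)

lemma N_triangle_diff:
  assumes "u \<in> E" "v \<in> E" shows "N (u - v) \<le> N u + N v"
  using N_triangle[of u "- v"] assms by (simp add: N_minus)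

lemma N_triangle_sub:
  assumes "u \<in> E" "v \<in> E" shows "\<bar>N u - N v\<bar> \<le> N (u - v)"
  using N_triangle[of "u - v" v] N_triangle[of "v - u" u] N_diff_commute[of u v] assms by simp

lemma N_triangle3:
  assumes "u \<in> E" "v \<in> E" "w \<in> E" shows "N (u - w) \<le> N (u - v) + N (v - w)"
  using N_triangle[of "u - v" "v - w"] assms by simp

lemma N_tendsto:
  assumes "\<And>n. X n \<in> E" "u \<in> E" "((\<lambda>n. N (X n - u)) \<longlongrightarrow> 0) F"
  shows "((\<lambda>n. N (X n)) \<longlongrightarrow> N u) F"
proof -
  have "((\<lambda>n. N (X n) - N u) \<longlongrightarrow> 0) F"
    by (rule Lim_null_comparison[OF _ assms(3)]) (simp add: N_triangle_sub assms)
  then show ?thesis by (simp add: LIM_zero_iff)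
qed

text \<open>The type \<open>'v\<close> carries no topology, so continuity means convergence in the
  seminorm, asked for on the unit interval only. Membership in \<open>E\<close> is asked for at
  every real parameter, which frees the limit lemmas from side conditions.\<close>

definition path_on :: "'v \<Rightarrow> 'v \<Rightarrow> (real \<Rightarrow> 'v) \<Rightarrow> bool" where
  "path_on a b \<gamma> \<longleftrightarrow> \<gamma> 0 = a \<and> \<gamma> 1 = b \<and> (\<forall>t. \<gamma> t \<in> E) \<and>
     (\<forall>t\<in>{0..1}. ((\<lambda>s. N (\<gamma> s - \<gamma> t)) \<longlongrightarrow> 0) (at t within {0..1}))"

lemma path_on_N_continuous:
  assumes "path_on a b \<gamma>" shows "continuous_on {0..1} (\<lambda>t. N (\<gamma> t))"
  using assms by (auto simp: continuous_on_def path_on_def intro!: N_tendsto)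

lemma path_on_bounded:
  assumes "path_on a b \<gamma>" obtains R where "R > 0" "\<And>t. t \<in> {0..1} \<Longrightarrow> N (\<gamma> t) \<le> R"
proof -
  have "bounded ((\<lambda>t. N (\<gamma> t)) ` {0..1})"
    by (intro compact_imp_bounded compact_continuous_image path_on_N_continuous[OF assms]) simp
  then show ?thesis
    unfolding bounded_pos using that by (force simp: abs_le_iff)
qed

lemma path_on_segment:
  assumes "a \<in> E" "b \<in> E" shows "path_on a b (\<lambda>t. a + t *\<^sub>R (b - a))"
proof -
  have "N (a + s *\<^sub>R (b - a) - (a + t *\<^sub>R (b - a))) = \<bar>s - t\<bar> * N (b - a)" for s t
    using N_scale[of "b - a" "s - t"] assms by (simp add: algebra_simps)
  moreover have "((\<lambda>s. \<bar>s - t\<bar> * N (b - a)) \<longlongrightarrow> 0) (at t within {0..1})" for t :: real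
  proof -
    have "((\<lambda>s. \<bar>s - t\<bar> * N (b - a)) \<longlongrightarrow> \<bar>t - t\<bar> * N (b - a)) (at t within {0..1})"
      by (intro tendsto_intros)
    then show ?thesis by simp
  qed
  ultimately show ?thesis unfolding path_on_def using assms by simp
qed

text \<open>\<open>G\<close> is the gradient of \<open>J\<close> with respect to \<open>B\<close>.
  The constant depends on the ball, because the nonlinearity grows superlinearly; its uniformity on
  the ball is what allows one step size for a whole path.\<close>

definition C1_lip :: "('v \<Rightarrow> real) \<Rightarrow> ('v \<Rightarrow> 'v) \<Rightarrow> bool" where
  "C1_lip J G \<longleftrightarrow> (\<forall>u\<in>E. G u \<in> E) \<and>
     (\<forall>R. \<exists>L\<ge>0. \<forall>u\<in>E. \<forall>v\<in>E. N u \<le> R \<longrightarrow> N v \<le> R \<longrightarrow>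
        \<bar>J v - J u - B (G u) (v - u)\<bar> \<le> L * (N (v - u))\<^sup>2 \<and> N (G u - G v) \<le> L * N (u - v))"

lemma C1_lip_tendsto:
  assumes C: "C1_lip J G" and X: "\<And>n. X n \<in> E" "u \<in> E" "((\<lambda>n. N (X n - u)) \<longlongrightarrow> 0) F"
  shows "((\<lambda>n. J (X n)) \<longlongrightarrow> J u) F" "((\<lambda>n. N (G (X n) - G u)) \<longlongrightarrow> 0) F"
proof -
  \<comment> \<open>The sequence eventually enters this ball, where a single constant
    \<open>L\<close> applies.\<close>
  define R where "R = N u + 1"
  from C obtain L where L: "L \<ge> 0" "\<And>u v. u \<in> E \<Longrightarrow> v \<in> E \<Longrightarrow> N u \<le> R \<Longrightarrow> N v \<le> R \<Longrightarrow>
      \<bar>J v - J u - B (G u) (v - u)\<bar> \<le> L * (N (v - u))\<^sup>2 \<and> N (G u - G v) \<le> L * N (u - v)"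
    unfolding C1_lip_def by metis
  have G: "G u \<in> E" "\<And>n. G (X n) \<in> E" using C X unfolding C1_lip_def by auto
  have ev: "\<forall>\<^sub>F n in F. N (X n) \<le> R"
  proof -
    have "\<forall>\<^sub>F n in F. N (X n - u) < 1"
      using order_tendstoD(2)[OF X(3), of 1] by simp
    then show ?thesis
    proof eventually_elim
      case (elim n)
      then show ?case using N_triangle_sub[of "X n" u] X by (simp add: R_def)
    qed
  qed
  have "((\<lambda>n. J (X n) - J u) \<longlongrightarrow> 0) F"
  proof (rule Lim_null_comparison)
    show "\<forall>\<^sub>F n in F. norm (J (X n) - J u) \<le> L * (N (X n - u))\<^sup>2 + N (G u) * N (X n - u)"
      using ev
    proof eventually_elim
      case (elim n)
      have "\<bar>J (X n) - J u - B (G u) (X n - u)\<bar> \<le> L * (N (X n - u))\<^sup>2"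
        using L(2)[of u "X n"] elim X by (simp add: R_def)
      moreover have "\<bar>B (G u) (X n - u)\<bar> \<le> N (G u) * N (X n - u)"
        using X G by (intro cauchy_schwarz) auto
      ultimately show ?case by simp
    qed
    have "((\<lambda>n. L * (N (X n - u))\<^sup>2 + N (G u) * N (X n - u)) \<longlongrightarrow> L * 0\<^sup>2 + N (G u) * 0) F"
      by (intro tendsto_intros X(3))
    then show "((\<lambda>n. L * (N (X n - u))\<^sup>2 + N (G u) * N (X n - u)) \<longlongrightarrow> 0) F" by simp
  qed
  then show "((\<lambda>n. J (X n)) \<longlongrightarrow> J u) F" by (simp add: LIM_zero_iff)
  show "((\<lambda>n. N (G (X n) - G u)) \<longlongrightarrow> 0) F"
  proof (rule Lim_null_comparison)
    show "\<forall>\<^sub>F n in F. norm (N (G (X n) - G u)) \<le> L * N (X n - u)"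
      using ev
    proof eventually_elim
      case (elim n)
      then show ?case using L(2)[of "X n" u] X G by (simp add: R_def)
    qed
    show "((\<lambda>n. L * N (X n - u)) \<longlongrightarrow> 0) F"
      by (rule tendsto_mult_right_zero[OF X(3)])
  qed
qed

lemma path_on_J_continuous:
  assumes "C1_lip J G" "path_on a b \<gamma>" shows "continuous_on {0..1} (\<lambda>t. J (\<gamma> t))"
  using assms by (auto simp: continuous_on_def path_on_def intro!: C1_lip_tendsto(1)[OF assms(1)])

text \<open>A truncated, normalised explicit Euler step of the negative gradient flow.\<close>

definition descent :: "('v \<Rightarrow> real) \<Rightarrow> ('v \<Rightarrow> 'v) \<Rightarrow> real \<Rightarrow> real \<Rightarrow> real \<Rightarrow> real \<Rightarrow> 'v \<Rightarrow> 'v" where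
  "descent J G c \<epsilon> \<delta> h u =
     u - (h * (max 0 (min 1 (2 * (J u - c + \<epsilon>) / \<epsilon>)) / max \<delta> (N (G u)))) *\<^sub>R G u"

text \<open>The cutoff in \<open>descent\<close> vanishes at levels up to
  \<open>c - \<epsilon>\<close>, so both endpoints stay fixed. Continuity survives because the
  denominator never drops below \<delta>; the step is split into a change of its coefficient and a
  change of the gradient.\<close>

lemma descent_path:
  assumes C: "C1_lip J G" and p: "path_on a b \<gamma>" and J: "J a \<le> c - \<epsilon>" "J b \<le> c - \<epsilon>"
    and pos: "\<epsilon> > 0" "\<delta> > 0"
  shows "path_on a b (\<lambda>t. descent J G c \<epsilon> \<delta> h (\<gamma> t))"
  unfolding path_on_def
proof (intro conjI allI ballI)
  have fix_low: "descent J G c \<epsilon> \<delta> h u = u" if "J u \<le> c - \<epsilon>" for u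
  proof -
    have "max 0 (min 1 (2 * (J u - c + \<epsilon>) / \<epsilon>)) = 0"
      using that pos by (intro max_absorb1) (simp add: min_le_iff_disj divide_le_0_iff)
    then show ?thesis by (simp add: descent_def)
  qed
  show "descent J G c \<epsilon> \<delta> h (\<gamma> 0) = a" "descent J G c \<epsilon> \<delta> h (\<gamma> 1) = b"
    using p J fix_low by (auto simp: path_on_def)
  have E: "\<gamma> t \<in> E" "G (\<gamma> t) \<in> E" for t using p C by (auto simp: path_on_def C1_lip_def)
  then show "descent J G c \<epsilon> \<delta> h (\<gamma> t) \<in> E" for t by (simp add: descent_def)
  fix t :: real assume t: "t \<in> {0..1}"
  define k where "k = (\<lambda>u. h * (max 0 (min 1 (2 * (J u - c + \<epsilon>) / \<epsilon>)) / max \<delta> (N (G u))))"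
  let ?F = "at t within {0..1}"
  have g: "((\<lambda>s. N (\<gamma> s - \<gamma> t)) \<longlongrightarrow> 0) ?F" using p t by (auto simp: path_on_def)
  note lim = C1_lip_tendsto[OF C E(1) E(1) g]
  have NG: "((\<lambda>s. N (G (\<gamma> s))) \<longlongrightarrow> N (G (\<gamma> t))) ?F"
    by (rule N_tendsto[OF E(2) E(2) lim(2)])
  have k: "((\<lambda>s. k (\<gamma> s)) \<longlongrightarrow> k (\<gamma> t)) ?F"
    unfolding k_def using pos by (intro tendsto_intros lim NG) auto
  show "((\<lambda>s. N (descent J G c \<epsilon> \<delta> h (\<gamma> s) - descent J G c \<epsilon> \<delta> h (\<gamma> t))) \<longlongrightarrow> 0) ?F"
  proof (rule Lim_null_comparison)
    show "\<forall>\<^sub>F s in ?F. norm (N (descent J G c \<epsilon> \<delta> h (\<gamma> s) - descent J G c \<epsilon> \<delta> h (\<gamma> t)))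
        \<le> N (\<gamma> s - \<gamma> t) + (\<bar>k (\<gamma> s)\<bar> * N (G (\<gamma> s) - G (\<gamma> t)) + \<bar>k (\<gamma> s) - k (\<gamma> t)\<bar> * N (G (\<gamma> t)))"
    proof (rule always_eventually, rule allI)
      fix s
      have eq: "descent J G c \<epsilon> \<delta> h (\<gamma> s) - descent J G c \<epsilon> \<delta> h (\<gamma> t)
        = (\<gamma> s - \<gamma> t) - (k (\<gamma> s) *\<^sub>R (G (\<gamma> s) - G (\<gamma> t)) + (k (\<gamma> s) - k (\<gamma> t)) *\<^sub>R G (\<gamma> t))"
      proof -
        have "descent J G c \<epsilon> \<delta> h u = u - k u *\<^sub>R G u" for u by (simp add: descent_def k_def)
        then show ?thesis by (simp add: algebra_simps)
      qed
      have "norm (N (descent J G c \<epsilon> \<delta> h (\<gamma> s) - descent J G c \<epsilon> \<delta> h (\<gamma> t)))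
          = N (descent J G c \<epsilon> \<delta> h (\<gamma> s) - descent J G c \<epsilon> \<delta> h (\<gamma> t))"
        unfolding real_norm_def eq using E by (intro abs_of_nonneg N_nonneg) auto
      also have "\<dots> \<le> N (\<gamma> s - \<gamma> t) +
         N (k (\<gamma> s) *\<^sub>R (G (\<gamma> s) - G (\<gamma> t)) + (k (\<gamma> s) - k (\<gamma> t)) *\<^sub>R G (\<gamma> t))"
        unfolding eq using E by (intro N_triangle_diff) auto
      also have "N (k (\<gamma> s) *\<^sub>R (G (\<gamma> s) - G (\<gamma> t)) + (k (\<gamma> s) - k (\<gamma> t)) *\<^sub>R G (\<gamma> t)) \<le>
         \<bar>k (\<gamma> s)\<bar> * N (G (\<gamma> s) - G (\<gamma> t)) + \<bar>k (\<gamma> s) - k (\<gamma> t)\<bar> * N (G (\<gamma> t))"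
        using N_triangle[of "k (\<gamma> s) *\<^sub>R (G (\<gamma> s) - G (\<gamma> t))" "(k (\<gamma> s) - k (\<gamma> t)) *\<^sub>R G (\<gamma> t)"] E
        by (simp add: N_scale)
      finally show "norm (N (descent J G c \<epsilon> \<delta> h (\<gamma> s) - descent J G c \<epsilon> \<delta> h (\<gamma> t)))
        \<le> N (\<gamma> s - \<gamma> t) + (\<bar>k (\<gamma> s)\<bar> * N (G (\<gamma> s) - G (\<gamma> t)) + \<bar>k (\<gamma> s) - k (\<gamma> t)\<bar> * N (G (\<gamma> t)))"
        by simp
    qed
    have "((\<lambda>s. N (\<gamma> s - \<gamma> t) + (\<bar>k (\<gamma> s)\<bar> * N (G (\<gamma> s) - G (\<gamma> t))
        + \<bar>k (\<gamma> s) - k (\<gamma> t)\<bar> * N (G (\<gamma> t)))) \<longlongrightarrow> 0 + (\<bar>k (\<gamma> t)\<bar> * 0 + \<bar>k (\<gamma> t) - k (\<gamma> t)\<bar> * N (G (\<gamma> t)))) ?F"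
      by (intro tendsto_intros g k lim(2))
    then show "((\<lambda>s. N (\<gamma> s - \<gamma> t) + (\<bar>k (\<gamma> s)\<bar> * N (G (\<gamma> s) - G (\<gamma> t))
        + \<bar>k (\<gamma> s) - k (\<gamma> t)\<bar> * N (G (\<gamma> t)))) \<longlongrightarrow> 0) ?F"
      by simp
  qed
qed

text \<open>The bound is stated for a level \<open>a\<close> above \<open>J u\<close>, since along a
  path only a common upper bound is known. Where \<open>J u\<close> is at least
  \<open>c - \<epsilon> / 2\<close> the cutoff is 1: the first order gain is at least
  \<open>h * \<delta>\<close>, and the Taylor error eats at most half of it. Lower points need not
  gain anything, because the last hypothesis already puts them below the target; they only must not
  rise.\<close>

lemma descent_decreases:
  assumes G: "G u \<in> E" and u: "u \<in> E"
    and taylor: "\<And>v. v \<in> E \<Longrightarrow> N (v - u) \<le> h \<Longrightarrow> \<bar>J v - J u - B (G u) (v - u)\<bar> \<le> L * (N (v - u))\<^sup>2"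
    and pos: "\<epsilon> > 0" "\<delta> > 0" "h > 0" "L \<ge> 0" "L * h \<le> \<delta> / 2"
    and grad: "c - \<epsilon> < J u \<Longrightarrow> J u < c + \<epsilon> \<Longrightarrow> \<delta> \<le> N (G u)"
    and a: "J u \<le> a" "a < c + \<epsilon>" "c - \<epsilon> / 2 \<le> a - h * \<delta> / 2"
  shows "N (descent J G c \<epsilon> \<delta> h u - u) \<le> h" "J (descent J G c \<epsilon> \<delta> h u) \<le> a - h * \<delta> / 2"
proof -
  define \<theta> where "\<theta> = max 0 (min 1 (2 * (J u - c + \<epsilon>) / \<epsilon>))"
  define k where "k = \<theta> / max \<delta> (N (G u))"
  have \<theta>: "0 \<le> \<theta>" "\<theta> \<le> 1" by (auto simp: \<theta>_def)
  have k0: "0 \<le> k" using \<theta> pos by (auto simp: k_def)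
  have "\<theta> * N (G u) \<le> 1 * max \<delta> (N (G u))"
    using \<theta> G by (intro mult_mono) auto
  then have kN: "k * N (G u) \<le> 1" using pos by (simp add: k_def divide_le_eq)
  have D: "descent J G c \<epsilon> \<delta> h u = u - (h * k) *\<^sub>R G u" by (simp add: descent_def k_def \<theta>_def)
  have diff: "descent J G c \<epsilon> \<delta> h u - u = (- h * k) *\<^sub>R G u" by (simp add: D)
  have Nd: "N (descent J G c \<epsilon> \<delta> h u - u) = h * (k * N (G u))"
    using G pos k0 by (simp add: diff N_minus N_scale abs_mult)
  then show Nh: "N (descent J G c \<epsilon> \<delta> h u - u) \<le> h"
    using kN pos by (simp add: mult_left_le)
  have DE: "descent J G c \<epsilon> \<delta> h u \<in> E" using G u by (simp add: D)
  have Bd: "B (G u) (descent J G c \<epsilon> \<delta> h u - u) = - h * k * (N (G u))\<^sup>2"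
    using G by (simp only: diff B_scale2 N_sq)
  show "J (descent J G c \<epsilon> \<delta> h u) \<le> a - h * \<delta> / 2"
  proof (cases "\<theta> = 0")
    case True
    then have "J u \<le> c - \<epsilon>"
      using pos by (auto simp: \<theta>_def max_def min_def divide_le_0_iff split: if_splits)
    moreover have "descent J G c \<epsilon> \<delta> h u = u" using True by (simp add: D k_def)
    ultimately show ?thesis using a pos by simp
  next
    case False
    then have "c - \<epsilon> < J u"
      using pos by (auto simp: \<theta>_def max_def min_def zero_le_divide_iff split: if_splits)
    then have "\<delta> \<le> N (G u)" using grad a by simp
    then have k\<theta>: "k * N (G u) = \<theta>" using pos by (simp add: k_def)
    have "J (descent J G c \<epsilon> \<delta> h u) \<le> J u - h * \<theta> * N (G u) + L * (h * \<theta>)\<^sup>2"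
      using taylor[OF DE Nh] unfolding Bd Nd k\<theta>
    proof -
      have "- h * k * (N (G u))\<^sup>2 = - (h * \<theta> * N (G u))"
        unfolding k\<theta>[symmetric] by (simp add: power2_eq_square)
      then show "\<bar>J (descent J G c \<epsilon> \<delta> h u) - J u - - h * k * (N (G u))\<^sup>2\<bar> \<le> L * (h * \<theta>)\<^sup>2 \<Longrightarrow> ?thesis"
        by linarith
    qed
    also have "\<dots> \<le> J u - h * \<theta> * \<delta> + h * \<theta> * (\<delta> / 2)"
    proof -
      have "h * \<theta> * \<delta> \<le> h * \<theta> * N (G u)"
        using \<open>\<delta> \<le> N (G u)\<close> pos \<theta> by (intro mult_left_mono) auto
      moreover have "L * (h * \<theta>)\<^sup>2 = (h * \<theta>) * ((L * h) * \<theta>)"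
        by (simp add: power2_eq_square)
      moreover have "(L * h) * \<theta> \<le> \<delta> / 2"
        using \<theta> pos mult_mono[of "L * h" "\<delta>/2" \<theta> 1] by simp
      then have "(h * \<theta>) * ((L * h) * \<theta>) \<le> (h * \<theta>) * (\<delta> / 2)"
        using pos \<theta> by (intro mult_left_mono) auto
      ultimately show ?thesis by linarith
    qed
    finally have le: "J (descent J G c \<epsilon> \<delta> h u) \<le> J u - h * \<theta> * \<delta> / 2" by (simp add: mult_ac)
    show ?thesis
    proof (cases "J u \<ge> c - \<epsilon> / 2")
      case True
      then have "1 \<le> 2 * (J u - c + \<epsilon>) / \<epsilon>" using pos by (simp add: field_simps)
      then have "\<theta> = 1" by (simp add: \<theta>_def)
      then show ?thesis using le a by simp
    next
      case False
      have "h * \<theta> * \<delta> / 2 \<ge> 0" using pos \<theta> by simp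
      then show ?thesis using le a False by linarith
    qed
  qed
qed

text \<open>Every path from 0 to \<open>e\<close> crosses the sphere of radius \<open>r\<close>, so
  the minimax level is at least \<alpha>. If almost critical points were missing near that level,
  finitely many descent steps would push a nearly optimal path below it.\<close>

theorem mountain_pass_sequence:
  assumes C: "C1_lip J G" and J0: "J 0 = 0" and e: "e \<in> E" "J e \<le> 0" "r < N e"
    and r: "0 < r" and \<alpha>: "0 < \<alpha>" and ring: "\<And>u. u \<in> E \<Longrightarrow> N u = r \<Longrightarrow> \<alpha> \<le> J u"
  shows "\<exists>c\<ge>\<alpha>. \<forall>\<epsilon>>0. \<exists>u\<in>E. \<bar>J u - c\<bar> < \<epsilon> \<and> N (G u) < \<epsilon>"
proof -
  \<comment> \<open>Paths are paired with upper bounds of \<open>J\<close> along them. The infimum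
    of the bounds is the minimax level, and no maximum along a path has to be named.\<close>
  define \<Gamma> where "\<Gamma> = {(\<gamma>, a). path_on 0 e \<gamma> \<and> (\<forall>t\<in>{0..1}. J (\<gamma> t) \<le> a)}"
  define S where "S = snd ` \<Gamma>"
  have low: "\<alpha> \<le> a" if "(\<gamma>, a) \<in> \<Gamma>" for \<gamma> a
  proof -
    have p: "path_on 0 e \<gamma>" using that by (simp add: \<Gamma>_def)
    have "\<exists>t\<ge>0. t \<le> 1 \<and> N (\<gamma> t) = r"
      using p e r by (intro IVT' path_on_N_continuous[OF p]) (auto simp: path_on_def)
    then obtain t where "t \<in> {0..1}" "N (\<gamma> t) = r" by auto
    then show ?thesis using ring[of "\<gamma> t"] that p by (force simp: \<Gamma>_def path_on_def)
  qed
  have "S \<noteq> {}"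
  proof -
    have p: "path_on 0 e (\<lambda>t. 0 + t *\<^sub>R (e - 0))" using path_on_segment[of 0 e] e by simp
    have "bounded ((\<lambda>t. J (0 + t *\<^sub>R (e - 0))) ` {0..1})"
      by (intro compact_imp_bounded compact_continuous_image path_on_J_continuous[OF C p]) simp
    then obtain a where "\<forall>t\<in>{0..1}. J (0 + t *\<^sub>R (e - 0)) \<le> a"
      unfolding bounded_real by (auto simp: abs_le_iff)
    then have "((\<lambda>t. 0 + t *\<^sub>R (e - 0)), a) \<in> \<Gamma>" using p by (simp add: \<Gamma>_def)
    then show ?thesis by (force simp: S_def)
  qed
  have bdd: "bdd_below S" using low by (force simp: S_def bdd_below_def)
  define c where "c = Inf S"
  have c\<alpha>: "\<alpha> \<le> c" unfolding c_def using \<open>S \<noteq> {}\<close> low by (intro cInf_greatest) (auto simp: S_def)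
  have cS: "c \<le> a" if "(\<gamma>, a) \<in> \<Gamma>" for \<gamma> a
    unfolding c_def using that bdd by (intro cInf_lower) (force simp: S_def)+
  show ?thesis
  proof (intro exI[of _ c] conjI c\<alpha> allI impI, rule ccontr)
    fix \<epsilon>0 :: real assume "\<epsilon>0 > 0" and neg: "\<not> (\<exists>u\<in>E. \<bar>J u - c\<bar> < \<epsilon>0 \<and> N (G u) < \<epsilon>0)"
    \<comment> \<open>The bound by \<alpha> gives \<open>0 \<le> c - \<epsilon>\<close>, so that
      both endpoints of the path lie in the region left fixed by \<open>descent\<close>.\<close>
    define \<epsilon> where "\<epsilon> = min \<epsilon>0 \<alpha>"
    define \<delta> where "\<delta> = \<epsilon>0"
    have \<epsilon>: "\<epsilon> > 0" "\<epsilon> \<le> \<epsilon>0" "\<epsilon> \<le> \<alpha>" "\<delta> > 0" using \<alpha> \<open>\<epsilon>0 > 0\<close> by (auto simp: \<epsilon>_def \<delta>_def)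
    have grad: "\<delta> \<le> N (G u)" if "u \<in> E" "c - \<epsilon> < J u" "J u < c + \<epsilon>" for u
    proof -
      have "\<bar>J u - c\<bar> < \<epsilon>0" using that \<epsilon> by (simp add: abs_less_iff)
      then show ?thesis using neg that by (auto simp: \<delta>_def)
    qed
    obtain a0 where "a0 \<in> S" "a0 < c + \<epsilon> / 2"
      using cInf_lessD[OF \<open>S \<noteq> {}\<close>, of "c + \<epsilon> / 2"] \<epsilon> by (auto simp: c_def)
    then obtain \<gamma>0 where \<gamma>0: "path_on 0 e \<gamma>0" "\<And>t. t \<in> {0..1} \<Longrightarrow> J (\<gamma>0 t) \<le> a0"
      by (auto simp: S_def \<Gamma>_def)
    obtain R where R: "R > 0" "\<And>t. t \<in> {0..1} \<Longrightarrow> N (\<gamma>0 t) \<le> R"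
      using path_on_bounded[OF \<gamma>0(1)] by blast
    \<comment> \<open>\<open>D\<close> is the total length of the descent. A step of length
      \<open>h\<close> lowers the bound by \<open>h * \<delta> / 2\<close>, hence all of them by
      \<open>D * \<delta> / 2 = 3 * \<epsilon> / 4\<close>: from \<open>c + \<epsilon> / 2\<close>
      down to \<open>c - \<epsilon> / 4\<close>. As \<open>D\<close> does not depend on the number
      of steps, \<open>L\<close> can be fixed on the ball of radius \<open>R + D\<close> before
      \<open>n\<close> is chosen.\<close>
    define D where "D = 3 * \<epsilon> / (2 * \<delta>)"
    have D: "D > 0" using \<epsilon> by (simp add: D_def)
    from C obtain L where L: "L \<ge> 0" "\<And>u v. u \<in> E \<Longrightarrow> v \<in> E \<Longrightarrow> N u \<le> R + D \<Longrightarrow> N v \<le> R + D \<Longrightarrow>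
        \<bar>J v - J u - B (G u) (v - u)\<bar> \<le> L * (N (v - u))\<^sup>2 \<and> N (G u - G v) \<le> L * N (u - v)"
      unfolding C1_lip_def by metis
    \<comment> \<open>With \<open>h = D / n\<close> this is the condition
      \<open>L * h \<le> \<delta> / 2\<close> of \<open>descent_decreases\<close>.\<close>
    obtain n :: nat where n: "n > 0" "L * D * 2 / \<delta> \<le> n"
    proof -
      obtain n :: nat where "L * D * 2 / \<delta> \<le> n" using real_arch_simple by blast
      then show thesis using that[of "Suc n"] by simp
    qed
    define h where "h = D / n"
    have h: "h > 0" "L * h \<le> \<delta> / 2" "n * h = D"
      using D n \<epsilon> by (auto simp: h_def field_simps)
    define T where "T = descent J G c \<epsilon> \<delta> h"
    have it: "path_on 0 e (\<lambda>t. (T ^^ k) (\<gamma>0 t)) \<and> (\<forall>t\<in>{0..1}. N ((T ^^ k) (\<gamma>0 t)) \<le> R + k * h \<and>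
        J ((T ^^ k) (\<gamma>0 t)) \<le> c + \<epsilon> / 2 - k * (h * \<delta> / 2))" if "k \<le> n" for k
      using that
    proof (induction k)
      case 0
      have "J (\<gamma>0 t) \<le> c + \<epsilon> / 2" if "t \<in> {0..1}" for t
        using \<gamma>0(2)[OF that] \<open>a0 < _\<close> by simp
      then show ?case using \<gamma>0(1) R by simp
    next
      case (Suc k)
      then have IH: "path_on 0 e (\<lambda>t. (T ^^ k) (\<gamma>0 t))" "\<And>t. t \<in> {0..1} \<Longrightarrow> N ((T ^^ k) (\<gamma>0 t)) \<le> R + k * h"
        "\<And>t. t \<in> {0..1} \<Longrightarrow> J ((T ^^ k) (\<gamma>0 t)) \<le> c + \<epsilon> / 2 - k * (h * \<delta> / 2)" by auto
      have kn: "real (Suc k) * h \<le> D" using Suc.prems h by (metis mult_right_mono of_nat_mono less_imp_le)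
      have kn': "real (Suc k) * (h * \<delta> / 2) \<le> 3 * \<epsilon> / 4"
      proof -
        have "real (Suc k) * (h * \<delta> / 2) = real (Suc k) * h * (\<delta> / 2)" by simp
        also have "\<dots> \<le> D * (\<delta> / 2)" using kn \<epsilon> by (intro mult_right_mono) auto
        also have "\<dots> = 3 * \<epsilon> / 4" using \<epsilon> by (simp add: D_def)
        finally show ?thesis .
      qed
      have "path_on 0 e (\<lambda>t. (T ^^ Suc k) (\<gamma>0 t))"
        unfolding T_def funpow.simps comp_apply
        using IH(1)[unfolded T_def] J0 e \<epsilon> c\<alpha> by (intro descent_path[OF C]) auto
      moreover have "N ((T ^^ Suc k) (\<gamma>0 t)) \<le> R + Suc k * h \<and>
        J ((T ^^ Suc k) (\<gamma>0 t)) \<le> c + \<epsilon> / 2 - Suc k * (h * \<delta> / 2)" if t: "t \<in> {0..1}" for t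
      proof -
        define u where "u = (T ^^ k) (\<gamma>0 t)"
        have u: "u \<in> E" "G u \<in> E" using IH(1) C by (auto simp: path_on_def u_def C1_lip_def)
        have Nu: "N u \<le> R + k * h" using IH(2) t by (simp add: u_def)
        have Tu: "T u \<in> E" using u by (simp add: T_def descent_def)
        have tay: "\<bar>J v - J u - B (G u) (v - u)\<bar> \<le> L * (N (v - u))\<^sup>2" if "v \<in> E" "N (v - u) \<le> h" for v
        proof -
          have "N v \<le> N u + h" using N_triangle_sub[of v u] that u by simp
          then have "N v \<le> R + D" "N u \<le> R + D" using Nu kn h by (auto simp: algebra_simps)
          then show ?thesis using L(2)[of u v] that u by simp
        qed
        have kh: "0 \<le> \<delta> * (h * real k)" "0 \<le> real k * (h * \<delta> / 2)" using h \<epsilon> by simp_all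
        have "N (T u - u) \<le> h \<and> J (T u) \<le> (c + \<epsilon> / 2 - k * (h * \<delta> / 2)) - h * \<delta> / 2"
          unfolding T_def
          using descent_decreases[where J=J and G=G and u=u and h=h and L=L and \<epsilon>=\<epsilon> and \<delta>=\<delta> and c=c
              and a="c + \<epsilon> / 2 - k * (h * \<delta> / 2)"]
            u tay h L(1) \<epsilon> kn' kh grad IH(3)[OF t, folded u_def] add_pos_nonneg[OF \<epsilon>(1) kh(1)]
          by (simp add: algebra_simps)
        moreover have "N (T u) \<le> N u + N (T u - u)" using N_triangle_sub[of "T u" u] u Tu by simp
        ultimately show ?thesis using Nu by (simp add: u_def algebra_simps add_divide_distrib)
      qed
      ultimately show ?case by blast
    qed
    have "n * (h * \<delta> / 2) = 3 * \<epsilon> / 4"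
    proof -
      have "n * (h * \<delta> / 2) = n * h * (\<delta> / 2)" by simp
      also have "\<dots> = 3 * \<epsilon> / 4" unfolding h(3) using \<epsilon> by (simp add: D_def)
      finally show ?thesis .
    qed
    then have lv: "c + \<epsilon> / 2 - n * (h * \<delta> / 2) = c - \<epsilon> / 4" by linarith
    have "((\<lambda>t. (T ^^ n) (\<gamma>0 t)), c - \<epsilon> / 4) \<in> \<Gamma>"
      using it[OF order_refl, unfolded lv] by (simp add: \<Gamma>_def)
    from cS[OF this] show False using \<epsilon> by simp
  qed
qed

end

locale semi_hilbert = semi_inner +
  assumes complete: "\<And>X. (\<And>n. X n \<in> E) \<Longrightarrow> (\<And>\<epsilon>. \<epsilon> > 0 \<Longrightarrow> \<exists>M. \<forall>m\<ge>M. \<forall>n\<ge>M. N (X m - X n) < \<epsilon>)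
     \<Longrightarrow> \<exists>l\<in>E. (\<lambda>n::nat. N (X n - l)) \<longlonglongrightarrow> 0"
begin

text \<open>The Palais-Smale hypothesis provides a Cauchy subsequence only; \<open>complete\<close>
  provides the limit, and continuity of \<open>J\<close> and \<open>G\<close> transfers level and
  gradient to it. In a seminormed space a vanishing gradient can only mean
  \<open>N (G u) = 0\<close>.\<close>

theorem mountain_pass:
  assumes C: "C1_lip J G" and J0: "J 0 = 0" and e: "e \<in> E" "J e \<le> 0" "r < N e"
    and r: "0 < r" and \<alpha>: "0 < \<alpha>" and ring: "\<And>u. u \<in> E \<Longrightarrow> N u = r \<Longrightarrow> \<alpha> \<le> J u"
    and PS: "\<And>X. (\<And>n::nat. X n \<in> E) \<Longrightarrow> bounded (range (\<lambda>n. J (X n))) \<Longrightarrow> (\<lambda>n. N (G (X n))) \<longlonglongrightarrow> 0 \<Longrightarrow>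
        \<exists>q::nat\<Rightarrow>nat. strict_mono q \<and> (\<forall>\<epsilon>>0. \<exists>M. \<forall>m\<ge>M. \<forall>n\<ge>M. N (X (q m) - X (q n)) < \<epsilon>)"
  shows "\<exists>u\<in>E. N (G u) = 0 \<and> \<alpha> \<le> J u"
proof -
  obtain c where c: "c \<ge> \<alpha>" "\<And>\<epsilon>. \<epsilon> > 0 \<Longrightarrow> \<exists>u\<in>E. \<bar>J u - c\<bar> < \<epsilon> \<and> N (G u) < \<epsilon>"
    using mountain_pass_sequence[OF C J0 e r \<alpha> ring] by blast
  have "\<forall>n::nat. \<exists>u\<in>E. \<bar>J u - c\<bar> < inverse (Suc n) \<and> N (G u) < inverse (Suc n)"
    using c(2) by simp
  then obtain X where X: "\<And>n::nat. X n \<in> E" "\<And>n. \<bar>J (X n) - c\<bar> < inverse (Suc n)" "\<And>n. N (G (X n)) < inverse (Suc n)"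
    by metis
  have GX: "G (X n) \<in> E" for n using C X by (auto simp: C1_lip_def)
  have JX: "(\<lambda>n. J (X n)) \<longlonglongrightarrow> c"
  proof -
    have "(\<lambda>n. J (X n) - c) \<longlonglongrightarrow> 0"
      by (rule Lim_null_comparison[OF always_eventually LIMSEQ_inverse_real_of_nat])
        (use X(2) in \<open>auto intro: less_imp_le\<close>)
    then show ?thesis by (simp add: LIM_zero_iff)
  qed
  have NG: "(\<lambda>n. N (G (X n))) \<longlonglongrightarrow> 0"
    by (rule Lim_null_comparison[OF always_eventually LIMSEQ_inverse_real_of_nat])
      (use X(3) GX in \<open>auto intro: less_imp_le\<close>)
  have "bounded (range (\<lambda>n. J (X n)))"
    by (rule convergent_imp_bounded[OF JX])
  from PS[of X, OF X(1) this NG] obtain q :: "nat \<Rightarrow> nat" where q: "strict_mono q"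
    "\<forall>\<epsilon>>0. \<exists>M. \<forall>m\<ge>M. \<forall>n\<ge>M. N (X (q m) - X (q n)) < \<epsilon>"
    by (elim exE conjE)
  obtain u where u: "u \<in> E" "(\<lambda>n. N (X (q n) - u)) \<longlonglongrightarrow> 0"
    using complete[of "\<lambda>n. X (q n)"] X(1) q(2) by auto
  have lim: "(\<lambda>n. J (X (q n))) \<longlonglongrightarrow> J u" "(\<lambda>n. N (G (X (q n)) - G u)) \<longlonglongrightarrow> 0"
    using C1_lip_tendsto[OF C, of "\<lambda>n. X (q n)" u] X u by auto
  have "G u \<in> E" using C u by (auto simp: C1_lip_def)
  then have "(\<lambda>n. N (G (X (q n)))) \<longlonglongrightarrow> N (G u)" using GX lim by (intro N_tendsto) auto
  then have "N (G u) = 0"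
    using LIMSEQ_unique LIMSEQ_subseq_LIMSEQ[OF NG q(1), unfolded o_def] by blast
  moreover have "J u = c"
    using LIMSEQ_unique[OF lim(1) LIMSEQ_subseq_LIMSEQ[OF JX q(1), unfolded o_def]] .
  ultimately show ?thesis using u c by auto
qed

text \<open>The representative minimises \<open>Q v = B v v - 2 * l v\<close>. Minimising sequences
  are Cauchy by the parallelogram law, and the first variation of \<open>Q\<close> at the minimum is
  the claim.\<close>

theorem riesz:
  assumes add: "\<And>u v. u \<in> E \<Longrightarrow> v \<in> E \<Longrightarrow> l (u + v) = l u + l v"
    and scale: "\<And>u r. u \<in> E \<Longrightarrow> l (r *\<^sub>R u) = r * l u"
    and bound: "\<And>u. u \<in> E \<Longrightarrow> \<bar>l u\<bar> \<le> C * N u"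
  shows "\<exists>k\<in>E. \<forall>v\<in>E. B k v = l v"
proof -
  define Q where "Q = (\<lambda>v. B v v - 2 * l v)"
  have Q_low: "- C\<^sup>2 \<le> Q v" if "v \<in> E" for v
  proof -
    have "2 * l v \<le> 2 * (C * N v)" using bound[OF that] by simp
    also have "\<dots> \<le> C\<^sup>2 + (N v)\<^sup>2" using sum_squares_bound[of C "N v"] by simp
    finally show ?thesis using N_sq[OF that] by (simp add: Q_def)
  qed
  define m where "m = Inf (Q ` E)"
  have bdd: "bdd_below (Q ` E)" using Q_low by (auto simp: bdd_below_def)
  have ne: "Q ` E \<noteq> {}" using E_zero by blast
  have m: "m \<le> Q v" if "v \<in> E" for v unfolding m_def using bdd that by (intro cInf_lower) auto
  have "\<forall>n::nat. \<exists>v\<in>E. Q v < m + inverse (Suc n)"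
    using cInf_lessD[OF ne] by (auto simp: m_def)
  then obtain X where X: "\<And>n::nat. X n \<in> E" "\<And>n. Q (X n) < m + inverse (Suc n)" by metis
  \<comment> \<open>The parallelogram law written with \<open>Q\<close>: the linear terms cancel
    because the midpoint enters with weight 4.\<close>
  have par: "(N (u - v))\<^sup>2 = 2 * Q u + 2 * Q v - 4 * Q ((1/2) *\<^sub>R (u + v))" if "u \<in> E" "v \<in> E" for u v
    using that by (simp add: N_sq Q_def B_diff B_diff2 B_add B_add2 B_scale B_scale2 add scale
        B_sym[of v u] algebra_simps)
  have cau: "(N (X i - X j))\<^sup>2 \<le> 2 * inverse (Suc i) + 2 * inverse (Suc j)" for i j
    using par[OF X(1)[of i] X(1)[of j]] X(2)[of i] X(2)[of j] m[of "(1/2) *\<^sub>R (X i + X j)"] X(1) by simp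
  have "\<exists>k\<in>E. (\<lambda>n. N (X n - k)) \<longlonglongrightarrow> 0"
  proof (rule complete)
    fix \<epsilon> :: real assume \<epsilon>: "\<epsilon> > 0"
    obtain M :: nat where M: "inverse (Suc M) < \<epsilon>\<^sup>2 / 4"
      using reals_Archimedean[of "\<epsilon>\<^sup>2/4"] \<epsilon> by auto
    have "N (X i - X j) < \<epsilon>" if "i \<ge> M" "j \<ge> M" for i j
    proof (rule power2_less_imp_less)
      have "inverse (real (Suc i)) \<le> inverse (Suc M)" "inverse (real (Suc j)) \<le> inverse (Suc M)"
        using that by (auto intro!: le_imp_inverse_le)
      then show "(N (X i - X j))\<^sup>2 < \<epsilon>\<^sup>2" using cau[of i j] M by linarith
    qed (use \<epsilon> in simp)
    then show "\<exists>M. \<forall>m\<ge>M. \<forall>n\<ge>M. N (X m - X n) < \<epsilon>" by blast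
  qed (rule X(1))
  then obtain k where k: "k \<in> E" "(\<lambda>n. N (X n - k)) \<longlonglongrightarrow> 0" by blast
  have "(\<lambda>n. Q (X n)) \<longlonglongrightarrow> Q k"
  proof -
    have "(\<lambda>n. (N (X n))\<^sup>2) \<longlonglongrightarrow> (N k)\<^sup>2" using k X by (intro tendsto_power N_tendsto) auto
    moreover have "(\<lambda>n. l (X n)) \<longlonglongrightarrow> l k"
    proof -
      have l_diff: "l (X n) - l k = l (X n - k)" for n
        using add[of "X n - k" k] X k by simp
      have "(\<lambda>n. l (X n) - l k) \<longlonglongrightarrow> 0"
      proof (rule Lim_null_comparison[OF always_eventually])
        show "\<forall>n. norm (l (X n) - l k) \<le> C * N (X n - k)" using bound X k by (simp add: l_diff)
        show "(\<lambda>n. C * N (X n - k)) \<longlonglongrightarrow> 0" using tendsto_mult_right_zero[OF k(2)] by simp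
      qed
      then show ?thesis by (simp add: LIM_zero_iff)
    qed
    ultimately show ?thesis
      unfolding Q_def using X k by (auto intro!: tendsto_intros simp: N_sq)
  qed
  moreover have "(\<lambda>n. m + inverse (Suc n)) \<longlonglongrightarrow> m"
    using tendsto_add[OF tendsto_const LIMSEQ_inverse_real_of_nat, of m] by simp
  ultimately have Qk: "Q k \<le> m"
    by (rule LIMSEQ_le) (use X(2) in \<open>auto intro: less_imp_le\<close>)
  have "B k v = l v" if v: "v \<in> E" for v
  proof (rule ccontr)
    define b where "b = B k v - l v"
    assume "B k v \<noteq> l v"
    then have b: "b \<noteq> 0" by (simp add: b_def)
    \<comment> \<open>The optimal \<open>t\<close> would be \<open>- b / B v v\<close>; adding 1
      keeps the denominator positive when \<open>v\<close> has seminorm zero, and the value still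
      drops below \<open>Q k\<close>.\<close>
    define t where "t = - b / (B v v + 1)"
    have p: "B v v + 1 > 0" using B_nonneg[OF v] by simp
    have "m \<le> Q (k + t *\<^sub>R v)" using k v by (intro m) simp
    also have "\<dots> = Q k + 2 * t * b + t\<^sup>2 * B v v"
      using k v by (simp add: Q_def quadratic_expand add scale b_def algebra_simps)
    finally have "0 \<le> 2 * t * b + t\<^sup>2 * B v v" using Qk by simp
    also have "\<dots> \<le> 2 * t * b + t\<^sup>2 * (B v v + 1)" by (simp add: mult_left_mono)
    also have "\<dots> = - b\<^sup>2 / (B v v + 1)"
      unfolding t_def power_divide power2_minus using p by (simp add: power2_eq_square)
    also have "\<dots> < 0" using b p by (simp add: divide_neg_pos)
    finally show False by simp
  qed
  then show ?thesis using k by blast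
qed

end

section \<open>Square-integrable functions\<close>

text \<open>With pointwise scaling, sets of functions become subspaces in the sense of
  \<open>semi_inner\<close>; pointwise addition comes from \<open>Function_Algebras\<close>.\<close>

instantiation "fun" :: (type, real_vector) real_vector
begin
definition scaleR_fun :: "real \<Rightarrow> ('a \<Rightarrow> 'b) \<Rightarrow> 'a \<Rightarrow> 'b" where "scaleR_fun r f = (\<lambda>x. r *\<^sub>R f x)"
instance
  by standard (auto simp: scaleR_fun_def fun_eq_iff algebra_simps)
end

lemma scaleR_apply [simp]: "(r *\<^sub>R f) x = r *\<^sub>R f x"
  by (simp add: scaleR_fun_def)

definition L2 :: "'a measure \<Rightarrow> ('a \<Rightarrow> 'b::euclidean_space) set" where
  "L2 M = {f \<in> borel_measurable M. integrable M (\<lambda>x. (norm (f x))\<^sup>2)}"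

text \<open>For complex values this is the real part of the Hermitian product, which is the quantity
  that \<open>weak_solution\<close> speaks of. Real and complex functions are thus treated
  together.\<close>

definition ip :: "'a measure \<Rightarrow> ('a \<Rightarrow> 'b::euclidean_space) \<Rightarrow> ('a \<Rightarrow> 'b) \<Rightarrow> real" where
  "ip M f g = (\<integral>x. f x \<bullet> g x \<partial>M)"

lemma L2_measurable [measurable_dest]: "f \<in> L2 M \<Longrightarrow> f \<in> borel_measurable M"
  by (simp add: L2_def)

lemma L2_integrable: "f \<in> L2 M \<Longrightarrow> integrable M (\<lambda>x. (norm (f x))\<^sup>2)"
  by (simp add: L2_def)

lemma L2_iff_nn: "f \<in> borel_measurable M \<Longrightarrow> f \<in> L2 M \<longleftrightarrow> (\<integral>\<^sup>+x. ennreal ((norm (f x))\<^sup>2) \<partial>M) < \<infinity>"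
  by (simp add: L2_def integrable_iff_bounded)

lemma L2_bound:
  assumes "f \<in> L2 M" "g \<in> borel_measurable M" "AE x in M. norm (g x) \<le> C * norm (f x)"
  shows "g \<in> L2 M"
proof -
  have "integrable M (\<lambda>x. (norm (g x))\<^sup>2)"
  proof (rule Bochner_Integration.integrable_bound)
    show "integrable M (\<lambda>x. C\<^sup>2 * (norm (f x))\<^sup>2)" using L2_integrable[OF assms(1)] by simp
    show "AE x in M. norm ((norm (g x))\<^sup>2) \<le> norm (C\<^sup>2 * (norm (f x))\<^sup>2)"
      using assms(3)
    proof eventually_elim
      case (elim x)
      then show ?case using power_mono[OF elim, of 2] by (simp add: power_mult_distrib)
    qed
  qed (use assms in measurable)
  then show ?thesis using assms(2) by (simp add: L2_def)
qed

lemma L2_inner_integrable: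
  assumes "f \<in> L2 M" "g \<in> L2 M" shows "integrable M (\<lambda>x. f x \<bullet> g x)"
proof (rule Bochner_Integration.integrable_bound)
  show "integrable M (\<lambda>x. (norm (f x))\<^sup>2 + (norm (g x))\<^sup>2)"
    using L2_integrable[OF assms(1)] L2_integrable[OF assms(2)] by simp
  have "\<bar>f x \<bullet> g x\<bar> \<le> (norm (f x))\<^sup>2 + (norm (g x))\<^sup>2" for x
  proof -
    have "\<bar>f x \<bullet> g x\<bar> \<le> norm (f x) * norm (g x)" by (rule Cauchy_Schwarz_ineq2)
    also have "\<dots> \<le> 2 * norm (f x) * norm (g x)" by simp
    also have "\<dots> \<le> (norm (f x))\<^sup>2 + (norm (g x))\<^sup>2" by (rule sum_squares_bound)
    finally show ?thesis .
  qed
  then show "AE x in M. norm (f x \<bullet> g x) \<le> norm ((norm (f x))\<^sup>2 + (norm (g x))\<^sup>2)" by simp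
  show "(\<lambda>x. f x \<bullet> g x) \<in> borel_measurable M" using assms by (auto simp: L2_def)
qed

lemma L2_subspace: "subspace (L2 M)"
proof (rule subspaceI)
  show "0 \<in> L2 M" by (simp add: L2_def zero_fun_def)
next
  fix f g :: "'a \<Rightarrow> 'b" assume fg: "f \<in> L2 M" "g \<in> L2 M"
  have m: "f + g \<in> borel_measurable M" unfolding plus_fun_def using fg by (auto simp: L2_def)
  have "integrable M (\<lambda>x. (norm (f x + g x))\<^sup>2)"
    using L2_integrable[OF fg(1)] L2_integrable[OF fg(2)] L2_inner_integrable[OF fg]
      L2_inner_integrable[OF fg(2,1)]
    by (simp add: power2_norm_eq_inner inner_add)
  then show "f + g \<in> L2 M" using m by (simp add: L2_def)
next
  fix c :: real and f :: "'a \<Rightarrow> 'b" assume f: "f \<in> L2 M"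
  then have "c *\<^sub>R f \<in> borel_measurable M" unfolding scaleR_fun_def by (intro borel_measurable_scaleR) (auto simp: L2_def)
  then show "c *\<^sub>R f \<in> L2 M" using f by (intro L2_bound[OF f, of _ "\<bar>c\<bar>"]) simp_all
qed

interpretation L2: semi_inner "L2 M" "ip M" for M
proof
  show "subspace (L2 M)" by (rule L2_subspace)
  show "ip M u v = ip M v u" for u v by (simp add: ip_def inner_commute)
qed (simp_all add: ip_def L2_inner_integrable inner_add_left)

lemma L2_N_sq: "f \<in> L2 M \<Longrightarrow> (L2.N M f)\<^sup>2 = (\<integral>x. (norm (f x))\<^sup>2 \<partial>M)"
  by (simp add: L2.N_sq) (simp add: ip_def power2_norm_eq_inner)

lemma L2_nn: "f \<in> L2 M \<Longrightarrow> (\<integral>\<^sup>+x. ennreal ((norm (f x))\<^sup>2) \<partial>M) = ennreal ((L2.N M f)\<^sup>2)"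
  by (simp add: L2_N_sq nn_integral_eq_integral L2_integrable)

lemma L2_nn_le:
  assumes "f \<in> borel_measurable M" "(\<integral>\<^sup>+x. ennreal ((norm (f x))\<^sup>2) \<partial>M) \<le> ennreal (c\<^sup>2)" "c \<ge> 0"
  shows "f \<in> L2 M" "L2.N M f \<le> c"
proof -
  show f: "f \<in> L2 M"
    unfolding L2_iff_nn[OF assms(1)] using assms(2) by (simp add: le_less_trans)
  have "(L2.N M f)\<^sup>2 \<le> c\<^sup>2" using assms(2) L2_nn[OF f] by simp
  then show "L2.N M f \<le> c" using assms(3) by (rule power2_le_imp_le)
qed

lemma L2_N_cong:
  assumes "AE x in M. norm (f x) = norm (g x)" "f \<in> borel_measurable M" "g \<in> borel_measurable M"
  shows "L2.N M f = L2.N M g"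
  unfolding L2.N_def ip_def using assms
  by (auto intro!: arg_cong[of _ _ sqrt] integral_cong_AE simp: power2_norm_eq_inner[symmetric])

lemma L2_N_mono:
  assumes "f \<in> L2 M" "g \<in> borel_measurable M" "AE x in M. norm (g x) \<le> C * norm (f x)" "C \<ge> 0"
  shows "L2.N M g \<le> C * L2.N M f"
proof (rule power2_le_imp_le)
  have g: "g \<in> L2 M" by (rule L2_bound[OF assms(1-3)])
  have "(L2.N M g)\<^sup>2 \<le> (\<integral>x. C\<^sup>2 * (norm (f x))\<^sup>2 \<partial>M)"
    unfolding L2_N_sq[OF g]
  proof (rule integral_mono_AE)
    show "AE x in M. (norm (g x))\<^sup>2 \<le> C\<^sup>2 * (norm (f x))\<^sup>2"
      using assms(3) by eventually_elim (metis norm_ge_zero power_mono power_mult_distrib)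
  qed (use L2_integrable assms(1) g in auto)
  also have "\<dots> = (C * L2.N M f)\<^sup>2" by (simp add: power_mult_distrib L2_N_sq[OF assms(1)])
  finally show "(L2.N M g)\<^sup>2 \<le> (C * L2.N M f)\<^sup>2" .
qed (use assms in simp)

text \<open>Riesz-Fischer: a fast subsequence converges almost everywhere, and Fatou's lemma turns
  the Cauchy property into convergence in norm.\<close>

lemma L2_complete:
  fixes X :: "nat \<Rightarrow> 'a \<Rightarrow> 'b::euclidean_space"
  assumes X: "\<And>n. X n \<in> L2 M"
    and cauchy: "\<And>\<epsilon>. \<epsilon> > 0 \<Longrightarrow> \<exists>K. \<forall>m\<ge>K. \<forall>n\<ge>K. L2.N M (X m - X n) < \<epsilon>"
  shows "\<exists>l\<in>L2 M. (\<lambda>n. L2.N M (X n - l)) \<longlonglongrightarrow> 0"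
proof -
  have [measurable]: "X n \<in> borel_measurable M" for n using X by (rule L2_measurable)
  have "\<forall>k. \<exists>K. \<forall>m\<ge>K. \<forall>n\<ge>K. L2.N M (X m - X n) < (1/4)^k" using cauchy by simp
  then obtain K where K: "\<And>k m n. m \<ge> K k \<Longrightarrow> n \<ge> K k \<Longrightarrow> L2.N M (X m - X n) < (1/4)^k" by metis
  have four: "(4::real) ^ k = 2 ^ k * 2 ^ k" for k by (simp flip: power_mult_distrib)
  \<comment> \<open>The sum dominates each of its terms, so \<open>\<phi> k\<close> is beyond
    \<open>K j\<close> for all \<open>j \<le> k\<close>.\<close>
  define \<phi> where "\<phi> k = (\<Sum>i\<le>k. K i)" for k :: nat
  have \<phi>: "K j \<le> \<phi> k" if "j \<le> k" for j k
    unfolding \<phi>_def using that by (intro member_le_sum) auto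
  \<comment> \<open>The integrals of \<open>(d k)^2\<close> are at most \<open>(1/16)^k\<close>.
    Even with weight \<open>4^k\<close> they are summable, so almost everywhere \<open>d k x\<close>
    is a constant times \<open>(1/2)^k\<close> at most, and the increments telescope
    absolutely.\<close>
  define d where "d k x = norm (X (\<phi> (Suc k)) x - X (\<phi> k) x)" for k x
  have [measurable]: "d k \<in> borel_measurable M" for k unfolding d_def by measurable
  have "(\<integral>\<^sup>+x. (\<Sum>k. ennreal (4^k * (d k x)\<^sup>2)) \<partial>M) = (\<Sum>k. \<integral>\<^sup>+x. ennreal (4^k * (d k x)\<^sup>2) \<partial>M)"
    by (rule nn_integral_suminf) measurable
  also have "\<dots> \<le> (\<Sum>k. ennreal ((1/4)^k))"
  proof (intro suminf_le)
    fix k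
    have L: "X (\<phi> (Suc k)) - X (\<phi> k) \<in> L2 M" using X by simp
    have "(\<integral>\<^sup>+x. ennreal (4^k * (d k x)\<^sup>2) \<partial>M) = ennreal (4^k) * ennreal ((L2.N M (X (\<phi> (Suc k)) - X (\<phi> k)))\<^sup>2)"
      unfolding L2_nn[OF L, symmetric]
      by (subst nn_integral_cmult[symmetric]) (auto simp: d_def ennreal_mult)
    also have "\<dots> \<le> ennreal (4^k) * ennreal (((1/4)^k)\<^sup>2)"
      using K[of k "\<phi> (Suc k)" "\<phi> k"] \<phi>[of k] X
      by (intro mult_left_mono ennreal_leI power_mono) (auto intro: less_imp_le)
    also have "\<dots> = ennreal ((1/4)^k)"
      by (simp add: ennreal_mult[symmetric] power2_eq_square power_divide)
    finally show "(\<integral>\<^sup>+x. ennreal (4^k * (d k x)\<^sup>2) \<partial>M) \<le> ennreal ((1/4)^k)" .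
  qed auto
  also have "\<dots> = ennreal (\<Sum>k. (1/4)^k)"
    by (intro suminf_ennreal2) (auto intro: summable_geometric)
  also have "\<dots> < \<infinity>" by simp
  finally have "AE x in M. (\<Sum>k. ennreal (4^k * (d k x)\<^sup>2)) \<noteq> \<infinity>"
    by (intro nn_integral_PInf_AE) auto
  then have conv: "AE x in M. convergent (\<lambda>k. X (\<phi> k) x)"
  proof eventually_elim
    case (elim x)
    have sm: "summable (\<lambda>k. 4^k * (d k x)\<^sup>2)"
      using elim by (intro summable_suminf_not_top) auto
    have "bounded (range (\<lambda>k. 4^k * (d k x)\<^sup>2))"
      using summable_LIMSEQ_zero[OF sm] by (rule convergent_imp_bounded)
    then obtain C where C: "\<And>k. 4^k * (d k x)\<^sup>2 \<le> C" by (auto simp: bounded_real abs_le_iff)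
    have dk: "d k x \<le> sqrt C * (1/2)^k" for k
    proof -
      have "(2^k * d k x)\<^sup>2 \<le> C"
        using C[of k] by (simp only: power_mult_distrib power2_eq_square mult.assoc four) (simp add: mult_ac)
      then have "2^k * d k x \<le> sqrt C" by (intro real_le_rsqrt)
      then show ?thesis by (simp add: field_simps)
    qed
    have "summable (\<lambda>k. X (\<phi> (Suc k)) x - X (\<phi> k) x)"
    proof (rule summable_comparison_test')
      show "summable (\<lambda>k. sqrt C * (1/2)^k)" by (intro summable_mult summable_geometric) simp
      show "norm (X (\<phi> (Suc k)) x - X (\<phi> k) x) \<le> sqrt C * (1/2)^k" for k
        using dk[of k] by (simp add: d_def)
    qed
    then have "convergent (\<lambda>m. \<Sum>k<m. X (\<phi> (Suc k)) x - X (\<phi> k) x)"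
      by (simp add: summable_iff_convergent)
    then have "convergent (\<lambda>m. X (\<phi> m) x - X (\<phi> 0) x)"
      by (simp only: sum_lessThan_telescope[of "\<lambda>k. X (\<phi> k) x"])
    then have "convergent (\<lambda>m. (X (\<phi> m) x - X (\<phi> 0) x) + X (\<phi> 0) x)"
      by (intro convergent_add convergent_const)
    then show ?case by simp
  qed
  define l where "l x = lim (\<lambda>k. X (\<phi> k) x)" for x
  have [measurable]: "l \<in> borel_measurable M" unfolding l_def by measurable
  \<comment> \<open>The estimate compares an arbitrary late \<open>X n\<close> with the limit of the
    subsequence, so the whole sequence converges at once.\<close>
  have fatou: "X n - l \<in> L2 M \<and> L2.N M (X n - l) \<le> (1/4)^j" if n: "n \<ge> K j" for n j
  proof -
    have "(\<integral>\<^sup>+x. ennreal ((norm ((X n - l) x))\<^sup>2) \<partial>M)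
        = (\<integral>\<^sup>+x. liminf (\<lambda>k. ennreal ((norm (X n x - X (\<phi> k) x))\<^sup>2)) \<partial>M)"
    proof (rule nn_integral_cong_AE, use conv in eventually_elim)
      fix x assume "convergent (\<lambda>k. X (\<phi> k) x)"
      then have "(\<lambda>k. X (\<phi> k) x) \<longlonglongrightarrow> l x" by (simp add: l_def convergent_LIMSEQ_iff)
      then have "(\<lambda>k. ennreal ((norm (X n x - X (\<phi> k) x))\<^sup>2)) \<longlonglongrightarrow> ennreal ((norm (X n x - l x))\<^sup>2)"
        by (intro tendsto_intros)
      then show "ennreal ((norm ((X n - l) x))\<^sup>2) = liminf (\<lambda>k. ennreal ((norm (X n x - X (\<phi> k) x))\<^sup>2))"
        by (simp add: lim_imp_Liminf[OF sequentially_bot] del: tendsto_ennreal_iff)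
    qed
    also have "\<dots> \<le> liminf (\<lambda>k. \<integral>\<^sup>+x. ennreal ((norm (X n x - X (\<phi> k) x))\<^sup>2) \<partial>M)"
      by (rule nn_integral_liminf) measurable
    also have "\<dots> \<le> limsup (\<lambda>k. \<integral>\<^sup>+x. ennreal ((norm (X n x - X (\<phi> k) x))\<^sup>2) \<partial>M)"
      by (rule Liminf_le_Limsup) simp
    also have "\<dots> \<le> ennreal (((1/4)^j)\<^sup>2)"
    proof (rule Limsup_bounded)
      show "\<forall>\<^sub>F k in sequentially. (\<integral>\<^sup>+x. ennreal ((norm (X n x - X (\<phi> k) x))\<^sup>2) \<partial>M) \<le> ennreal (((1/4)^j)\<^sup>2)"
        using eventually_ge_at_top[of j]
      proof eventually_elim
        case (elim k)
        have L: "X n - X (\<phi> k) \<in> L2 M" using X by simp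
        have "(\<integral>\<^sup>+x. ennreal ((norm (X n x - X (\<phi> k) x))\<^sup>2) \<partial>M) = ennreal ((L2.N M (X n - X (\<phi> k)))\<^sup>2)"
          using L2_nn[OF L] by simp
        also have "\<dots> \<le> ennreal (((1/4)^j)\<^sup>2)"
          using K[of j n "\<phi> k"] n \<phi>[OF elim] L
          by (intro ennreal_leI power_mono) (auto intro: less_imp_le)
        finally show ?case .
      qed
    qed
    finally have le: "(\<integral>\<^sup>+x. ennreal ((norm ((X n - l) x))\<^sup>2) \<partial>M) \<le> ennreal (((1/4)^j)\<^sup>2)" .
    have "X n - l \<in> borel_measurable M" unfolding fun_diff_def by measurable
    note le = L2_nn_le[of "X n - l" M "(1/4)^j", OF this le]
    show ?thesis by (rule conjI; rule le; simp)
  qed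
  have "X (K 0) - (X (K 0) - l) \<in> L2 M"
    by (rule L2.E_diff[OF X conjunct1[OF fatou[OF order_refl, of 0]]])
  then have l: "l \<in> L2 M" by simp
  have "(\<lambda>n. L2.N M (X n - l)) \<longlonglongrightarrow> 0"
  proof (rule LIMSEQ_I)
    fix r :: real assume "r > 0"
    then obtain j where j: "(1/4)^j < r" using real_arch_pow_inv[of r "1/4"] by auto
    have "norm (L2.N M (X n - l) - 0) < r" if "n \<ge> K j" for n
      using fatou[OF that] j L2.N_nonneg[of "X n - l" M] by auto
    then show "\<exists>no. \<forall>n\<ge>no. norm (L2.N M (X n - l) - 0) < r" by blast
  qed
  then show ?thesis using l by blast
qed

interpretation L2: semi_hilbert "L2 M" "ip M" for M
  by standard (rule L2_complete)

lemma L2_AE_subseq: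
  fixes X :: "nat \<Rightarrow> 'a \<Rightarrow> 'b::euclidean_space"
  assumes X: "\<And>n. X n \<in> L2 M" and l: "l \<in> L2 M" and lim: "(\<lambda>n. L2.N M (X n - l)) \<longlonglongrightarrow> 0"
  shows "\<exists>r::nat\<Rightarrow>nat. strict_mono r \<and> (AE x in M. (\<lambda>n. X (r n) x) \<longlonglongrightarrow> l x)"
proof -
  have L: "X n - l \<in> L2 M" for n using X l by simp
  have "\<exists>r::nat\<Rightarrow>nat. strict_mono r \<and> (AE x in M. (\<lambda>n. (norm ((X (r n) - l) x))\<^sup>2) \<longlonglongrightarrow> 0)"
  proof (rule tendsto_L1_AE_subseq[where M=M and u="\<lambda>n x. (norm ((X n - l) x))\<^sup>2"])
    show "integrable M (\<lambda>x. (norm ((X n - l) x))\<^sup>2)" for n by (rule L2_integrable[OF L])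
    show "(\<lambda>n. \<integral>x. norm ((norm ((X n - l) x))\<^sup>2) \<partial>M) \<longlonglongrightarrow> 0"
      using tendsto_power[OF lim, of 2] by (simp add: L2_N_sq[OF L])
  qed
  then obtain r :: "nat \<Rightarrow> nat" where r: "strict_mono r" "AE x in M. (\<lambda>n. (norm ((X (r n) - l) x))\<^sup>2) \<longlonglongrightarrow> 0"
    by blast
  have "AE x in M. (\<lambda>n. X (r n) x) \<longlonglongrightarrow> l x"
    using r(2)
  proof eventually_elim
    case (elim x)
    then have "(\<lambda>n. norm (X (r n) x - l x)) \<longlonglongrightarrow> 0" using tendsto_real_sqrt[OF elim] by simp
    then show ?case by (rule LIM_zero_cancel[OF tendsto_norm_zero_cancel])
  qed
  then show ?thesis using r(1) by blast
qed

text \<open>Multiplication by \<open>w\<close> is a closed operator: an almost everywhere convergent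
  subsequence identifies the limit of \<open>w *\<^sub>R X n\<close> with
  \<open>w *\<^sub>R l\<close>. It serves for the frequency weight and for the square root of the
  potential.\<close>

lemma L2_weighted_limit:
  fixes X :: "nat \<Rightarrow> 'a \<Rightarrow> 'b::euclidean_space" and w :: "'a \<Rightarrow> real"
  assumes X: "\<And>n. X n \<in> L2 M" and l: "l \<in> L2 M" and lim: "(\<lambda>n. L2.N M (X n - l)) \<longlonglongrightarrow> 0"
    and wX: "\<And>n. (\<lambda>x. w x *\<^sub>R X n x) \<in> L2 M" and w [measurable]: "w \<in> borel_measurable M"
    and cauchy: "\<And>\<epsilon>. \<epsilon> > 0 \<Longrightarrow> \<exists>K. \<forall>m\<ge>K. \<forall>n\<ge>K. L2.N M ((\<lambda>x. w x *\<^sub>R X m x) - (\<lambda>x. w x *\<^sub>R X n x)) < \<epsilon>"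
  shows "(\<lambda>x. w x *\<^sub>R l x) \<in> L2 M" "(\<lambda>n. L2.N M ((\<lambda>x. w x *\<^sub>R X n x) - (\<lambda>x. w x *\<^sub>R l x))) \<longlonglongrightarrow> 0"
proof -
  obtain z where z: "z \<in> L2 M" "(\<lambda>n. L2.N M ((\<lambda>x. w x *\<^sub>R X n x) - z)) \<longlonglongrightarrow> 0"
    using L2_complete[of "\<lambda>n x. w x *\<^sub>R X n x", OF wX cauchy] by (rule bexE) auto
  obtain r :: "nat \<Rightarrow> nat" where r: "strict_mono r" "AE x in M. (\<lambda>n. X (r n) x) \<longlonglongrightarrow> l x"
    using L2_AE_subseq[OF X l lim] by (elim exE conjE)
  have "(\<lambda>n. L2.N M ((\<lambda>x. w x *\<^sub>R X (r n) x) - z)) \<longlonglongrightarrow> 0"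
    using LIMSEQ_subseq_LIMSEQ[OF z(2) r(1)] by (simp add: o_def)
  from L2_AE_subseq[of "\<lambda>n x. w x *\<^sub>R X (r n) x", OF wX z(1) this] obtain q :: "nat \<Rightarrow> nat" where
    q: "strict_mono q" "AE x in M. (\<lambda>n. w x *\<^sub>R X (r (q n)) x) \<longlonglongrightarrow> z x"
    by (elim exE conjE)
  have eq: "AE x in M. z x = w x *\<^sub>R l x"
    using q(2) r(2)
  proof eventually_elim
    case (elim x)
    have "(\<lambda>n. w x *\<^sub>R X (r (q n)) x) \<longlonglongrightarrow> w x *\<^sub>R l x"
      by (intro tendsto_scaleR tendsto_const LIMSEQ_subseq_LIMSEQ[OF elim(2) q(1), unfolded o_def])
    then show ?case by (rule LIMSEQ_unique[OF elim(1)])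
  qed
  have [measurable]: "l \<in> borel_measurable M" "\<And>n. X n \<in> borel_measurable M" "z \<in> borel_measurable M"
    by (rule L2_measurable, fact)+
  show wl: "(\<lambda>x. w x *\<^sub>R l x) \<in> L2 M"
  proof (rule L2_bound[OF z(1), of _ 1])
    show "AE x in M. norm (w x *\<^sub>R l x) \<le> 1 * norm (z x)" using eq by eventually_elim simp
  qed simp
  have "L2.N M ((\<lambda>x. w x *\<^sub>R X n x) - z) = L2.N M ((\<lambda>x. w x *\<^sub>R X n x) - (\<lambda>x. w x *\<^sub>R l x))" for n
  proof (rule L2_N_cong)
    show "AE x in M. norm (((\<lambda>x. w x *\<^sub>R X n x) - z) x) = norm (((\<lambda>x. w x *\<^sub>R X n x) - (\<lambda>x. w x *\<^sub>R l x)) x)"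
      using eq by eventually_elim simp
  qed (simp_all add: fun_diff_def)
  then show "(\<lambda>n. L2.N M ((\<lambda>x. w x *\<^sub>R X n x) - (\<lambda>x. w x *\<^sub>R l x))) \<longlonglongrightarrow> 0"
    using z(2) by simp
qed

section \<open>Translations in \<open>L\<^sup>2\<close>\<close>

definition translate :: "'a::euclidean_space \<Rightarrow> ('a \<Rightarrow> 'b) \<Rightarrow> 'a \<Rightarrow> 'b" where
  "translate z u = (\<lambda>x. u (x + z))"

section \<open>Lebesgue integrals under translation and dilation\<close>

lemma lborel_translate: "distr lborel borel (\<lambda>x. x + z) = (lborel :: 'a::euclidean_space measure)"
  using lborel_distr_plus[of z] by (simp add: add.commute[of _ z])

lemma nn_integral_translate:
  fixes z :: "'a::euclidean_space"
  assumes [measurable]: "f \<in> borel_measurable borel"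
  shows "(\<integral>\<^sup>+x. f (x + z) \<partial>lborel) = (\<integral>\<^sup>+x. f x \<partial>lborel)"
proof -
  have "(\<integral>\<^sup>+x. f x \<partial>lborel) = (\<integral>\<^sup>+x. f x \<partial>distr lborel borel (\<lambda>x. x + z))" by (simp add: lborel_translate)
  also have "\<dots> = (\<integral>\<^sup>+x. f (x + z) \<partial>lborel)" by (rule nn_integral_distr) auto
  finally show ?thesis by simp
qed

lemma integral_translate:
  fixes z :: "'a::euclidean_space" and f :: "'a \<Rightarrow> 'b::{banach, second_countable_topology}"
  assumes [measurable]: "f \<in> borel_measurable borel"
  shows "(\<integral>x. f (x + z) \<partial>lborel) = (\<integral>x. f x \<partial>lborel)"
proof -
  have "(\<integral>x. f x \<partial>lborel) = (\<integral>x. f x \<partial>distr lborel borel (\<lambda>x. x + z))" by (simp add: lborel_translate)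
  also have "\<dots> = (\<integral>x. f (x + z) \<partial>lborel)" by (rule integral_distr) auto
  finally show ?thesis by simp
qed

lemma integrable_translate:
  fixes z :: "'a::euclidean_space" and f :: "'a \<Rightarrow> 'b::{banach, second_countable_topology}"
  assumes "integrable lborel f"
  shows "integrable lborel (\<lambda>x. f (x + z))"
  using assms integrable_distr[of "\<lambda>x. x + z" lborel borel f] by (simp add: lborel_translate)

lemma integral_scale:
  fixes f :: "'a::euclidean_space \<Rightarrow> 'b::{banach, second_countable_topology}"
  assumes [measurable]: "f \<in> borel_measurable borel" and c: "c > 0"
  shows "(\<integral>x. f x \<partial>lborel) = c ^ DIM('a) *\<^sub>R (\<integral>x. f (c *\<^sub>R x) \<partial>lborel)"
proof -
  have "(\<integral>x. f x \<partial>lborel) = (\<integral>x. f x \<partial>density (distr lborel borel (\<lambda>x. 0 + c *\<^sub>R x)) (\<lambda>_. ennreal (c ^ DIM('a))))"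
    using lborel_affine[of c "0::'a"] c by simp
  also have "\<dots> = (\<integral>x. (c ^ DIM('a)) *\<^sub>R f (c *\<^sub>R x) \<partial>lborel)"
    using c by (subst integral_density) (auto simp: integral_distr)
  finally show ?thesis by simp
qed

lemma translate_measurable [measurable]: "u \<in> borel_measurable borel \<Longrightarrow> translate z u \<in> borel_measurable borel"
  by (simp add: translate_def)

lemma L2_borel: "u \<in> L2 lborel \<Longrightarrow> u \<in> borel_measurable borel"
  by (simp add: L2_def)

lemma translate_L2:
  assumes "u \<in> L2 lborel" shows "translate z u \<in> L2 lborel" "L2.N lborel (translate z u) = L2.N lborel u"
proof -
  note [measurable] = L2_borel[OF assms]
  have "integrable lborel (\<lambda>x. (norm (u (x + z)))\<^sup>2)"
    using integrable_translate[OF L2_integrable[OF assms]] .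
  then show s: "translate z u \<in> L2 lborel" by (simp add: L2_def translate_def)
  have "(L2.N lborel (translate z u))\<^sup>2 = (L2.N lborel u)\<^sup>2"
    unfolding L2_N_sq[OF s] L2_N_sq[OF assms] unfolding translate_def
    by (rule integral_translate) simp
  then show "L2.N lborel (translate z u) = L2.N lborel u"
    using assms s by simp
qed

lemma translate_diff: "translate z (u - v) = translate z u - translate z v"
  and translate_add: "translate z (u + v) = translate z u + translate z v"
  and translate_scale: "translate z (r *\<^sub>R w) = r *\<^sub>R translate z w"
  by (auto simp: translate_def fun_eq_iff)

text \<open>Translations are isometries, so the functions on which they act continuously form a
  closed set: an argument with three thirds of \<open>r\<close>.\<close>

lemma translate_continuous_closed:
  fixes u :: "'a::euclidean_space \<Rightarrow> 'b::euclidean_space"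
  assumes u: "u \<in> L2 lborel"
    and appr: "\<And>\<epsilon>. \<epsilon> > 0 \<Longrightarrow> \<exists>v\<in>L2 lborel. L2.N lborel (u - v) < \<epsilon> \<and> (\<lambda>n. L2.N lborel (translate (z n) v - v)) \<longlonglongrightarrow> 0"
  shows "(\<lambda>n. L2.N lborel (translate (z n) u - u)) \<longlonglongrightarrow> 0"
proof (rule LIMSEQ_I)
  fix r :: real assume r: "r > 0"
  obtain v where v: "v \<in> L2 lborel" "L2.N lborel (u - v) < r / 3" "(\<lambda>n. L2.N lborel (translate (z n) v - v)) \<longlonglongrightarrow> 0"
    using appr[of "r / 3"] r by auto
  obtain n0 where n0: "\<And>n. n \<ge> n0 \<Longrightarrow> norm (L2.N lborel (translate (z n) v - v) - 0) < r / 3"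
    using LIMSEQ_D[OF v(3), of "r / 3"] r by auto
  have "norm (L2.N lborel (translate (z n) u - u) - 0) < r" if n: "n \<ge> n0" for n
  proof -
    note mem = u v(1) translate_L2(1)[OF u, of "z n"] translate_L2(1)[OF v(1), of "z n"]
    have "L2.N lborel (translate (z n) u - u) \<le> L2.N lborel (translate (z n) u - translate (z n) v) + L2.N lborel (translate (z n) v - u)"
      using mem by (intro L2.N_triangle3) auto
    moreover have "L2.N lborel (translate (z n) v - u) \<le> L2.N lborel (translate (z n) v - v) + L2.N lborel (v - u)"
      using mem by (intro L2.N_triangle3) auto
    moreover have "L2.N lborel (translate (z n) u - translate (z n) v) = L2.N lborel (u - v)"
      using translate_L2(2)[of "u - v" "z n"] mem by (simp add: translate_diff)
    moreover have "L2.N lborel (v - u) = L2.N lborel (u - v)" using mem by (intro L2.N_diff_commute)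
    ultimately show ?thesis using n0[OF n] v(2) mem by simp
  qed
  then show "\<exists>no. \<forall>n\<ge>no. norm (L2.N lborel (translate (z n) u - u) - 0) < r" by blast
qed

lemma indicator_L2:
  assumes "A \<in> sets M" "emeasure M A < \<infinity>"
  shows "(indicator A :: 'a \<Rightarrow> real) \<in> L2 M" "(L2.N M (indicator A :: 'a \<Rightarrow> real))\<^sup>2 = measure M A"
proof -
  have e: "(norm (indicator A x :: real))\<^sup>2 = indicator A x" for x by (simp add: indicator_def)
  have i: "integrable M (\<lambda>x. (norm (indicator A x :: real))\<^sup>2)"
    unfolding e using assms by (simp add: less_top[symmetric])
  show l: "(indicator A :: 'a \<Rightarrow> real) \<in> L2 M" using assms i by (simp add: L2_def)
  show "(L2.N M (indicator A :: 'a \<Rightarrow> real))\<^sup>2 = measure M A"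
    unfolding L2_N_sq[OF l] e using assms by simp
qed

text \<open>A point of an open set stays in it under small translations, so the inner product of the
  translated indicator with the original one converges by dominated convergence. As both have the
  same norm, this gives convergence in norm; points outside \<open>U\<close> do not enter the
  product.\<close>

lemma translate_continuous_open:
  fixes U :: "'a::euclidean_space set"
  assumes U: "open U" "emeasure lborel U < \<infinity>" and z: "z \<longlonglongrightarrow> 0"
  shows "(\<lambda>n. L2.N lborel (translate (z n) (indicator U :: 'a \<Rightarrow> real) - indicator U)) \<longlonglongrightarrow> 0"
proof -
  let ?I = "indicator U :: 'a \<Rightarrow> real"
  have [measurable]: "U \<in> sets borel" using U by simp
  have I: "?I \<in> L2 lborel" using U by (intro indicator_L2) auto
  have lim: "(\<lambda>n. ip lborel (translate (z n) ?I) ?I) \<longlonglongrightarrow> ip lborel ?I ?I"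
    unfolding ip_def
  proof (rule integral_dominated_convergence[where w="?I"])
    show "integrable lborel ?I" using U by (simp add: less_top[symmetric])
    show "AE x in lborel. (\<lambda>n. translate (z n) ?I x \<bullet> ?I x) \<longlonglongrightarrow> ?I x \<bullet> ?I x"
    proof (rule AE_I2)
      fix x
      show "(\<lambda>n. translate (z n) ?I x \<bullet> ?I x) \<longlonglongrightarrow> ?I x \<bullet> ?I x"
      proof (cases "x \<in> U")
        case True
        have "(\<lambda>n. x + z n) \<longlonglongrightarrow> x + 0" using z by (intro tendsto_intros)
        then have "\<forall>\<^sub>F n in sequentially. x + z n \<in> U"
          using topological_tendstoD[OF _ U(1)] True by simp
        then have "\<forall>\<^sub>F n in sequentially. translate (z n) ?I x \<bullet> ?I x = ?I x \<bullet> ?I x"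
          by eventually_elim (use True in \<open>simp add: translate_def\<close>)
        then show ?thesis by (rule tendsto_eventually)
      qed simp
    qed
  qed (auto simp: translate_def indicator_def)
  have sI: "translate (z n) ?I \<in> L2 lborel" for n by (rule translate_L2(1)[OF I])
  have "(L2.N lborel (translate (z n) ?I - ?I))\<^sup>2 = 2 * ip lborel ?I ?I - 2 * ip lborel (translate (z n) ?I) ?I" for n
  proof -
    have "(L2.N lborel (translate (z n) ?I - ?I))\<^sup>2
       = (L2.N lborel (translate (z n) ?I))\<^sup>2 - 2 * ip lborel (translate (z n) ?I) ?I + (L2.N lborel ?I)\<^sup>2"
      using I sI[of n] by (simp add: L2.N_sq L2.B_diff L2.B_diff2 L2.B_sym[of ?I _ "translate (z n) ?I"])
    then show ?thesis using I by (simp add: translate_L2(2) L2.N_sq)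
  qed
  moreover have "(\<lambda>n. 2 * ip lborel ?I ?I - 2 * ip lborel (translate (z n) ?I) ?I) \<longlonglongrightarrow> 2 * ip lborel ?I ?I - 2 * ip lborel ?I ?I"
    by (intro tendsto_intros lim)
  ultimately have "(\<lambda>n. (L2.N lborel (translate (z n) ?I - ?I))\<^sup>2) \<longlonglongrightarrow> 0" by simp
  from tendsto_real_sqrt[OF this] show ?thesis using I sI by simp
qed

lemma sum_fun_apply: "(\<Sum>i\<in>S. f i) x = (\<Sum>i\<in>S. f i x)"
  by (induction S rule: infinite_finite_induct) auto

text \<open>From open sets to Borel sets of finite measure by outer regularity, from these to simple
  functions by linearity, and to all of L^2 by density.\<close>

lemma translate_continuous:
  fixes u :: "'a::euclidean_space \<Rightarrow> real"
  assumes u: "u \<in> L2 lborel" and z: "z \<longlonglongrightarrow> 0"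
  shows "(\<lambda>n. L2.N lborel (translate (z n) u - u)) \<longlonglongrightarrow> 0"
proof -
  define P where "P = (\<lambda>v::'a\<Rightarrow>real. v \<in> L2 lborel \<and> (\<lambda>n. L2.N lborel (translate (z n) v - v)) \<longlonglongrightarrow> 0)"
  have P_add: "P (v + w)" if "P v" "P w" for v w
  proof -
    have v: "v \<in> L2 lborel" "\<And>n. translate (z n) v \<in> L2 lborel" and w: "w \<in> L2 lborel" "\<And>n. translate (z n) w \<in> L2 lborel"
      using that by (auto simp: P_def translate_L2)
    have eq: "translate (z n) (v + w) - (v + w) = (translate (z n) v - v) + (translate (z n) w - w)" for n
      by (simp add: translate_add)
    have "(\<lambda>n. L2.N lborel (translate (z n) (v + w) - (v + w))) \<longlonglongrightarrow> 0"
    proof (rule Lim_null_comparison[OF always_eventually])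
      show "\<forall>n. norm (L2.N lborel (translate (z n) (v + w) - (v + w)))
          \<le> L2.N lborel (translate (z n) v - v) + L2.N lborel (translate (z n) w - w)"
      proof
        fix n
        have "(translate (z n) v - v) + (translate (z n) w - w) \<in> L2 lborel" using v w by simp
        then show "norm (L2.N lborel (translate (z n) (v + w) - (v + w)))
          \<le> L2.N lborel (translate (z n) v - v) + L2.N lborel (translate (z n) w - w)"
          unfolding eq real_norm_def
          using v w by (subst abs_of_nonneg) (auto intro!: L2.N_nonneg L2.N_triangle)
      qed
      show "(\<lambda>n. L2.N lborel (translate (z n) v - v) + L2.N lborel (translate (z n) w - w)) \<longlonglongrightarrow> 0"
        using that by (auto simp: P_def intro!: tendsto_add_zero)
    qed
    then show ?thesis using v w by (simp add: P_def)
  qed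
  have P_scale: "P (c *\<^sub>R v)" if "P v" for c v
  proof -
    have v: "v \<in> L2 lborel" "\<And>n. translate (z n) v \<in> L2 lborel" using that by (auto simp: P_def translate_L2)
    have "translate (z n) (c *\<^sub>R v) - c *\<^sub>R v = c *\<^sub>R (translate (z n) v - v)" for n
      by (simp add: translate_scale scaleR_diff_right)
    then have "L2.N lborel (translate (z n) (c *\<^sub>R v) - c *\<^sub>R v) = \<bar>c\<bar> * L2.N lborel (translate (z n) v - v)" for n
      using v by (simp only: L2.N_scale L2.E_diff)
    then show ?thesis using that v tendsto_mult_right_zero[of _ sequentially "\<bar>c\<bar>"] by (simp add: P_def)
  qed
  have P_ind: "P (indicator A)" if A: "A \<in> sets borel" "emeasure lborel A < \<infinity>" for A
  proof -
    have I: "(indicator A :: 'a \<Rightarrow> real) \<in> L2 lborel" using A by (intro indicator_L2) auto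
    moreover have "(\<lambda>n. L2.N lborel (translate (z n) (indicator A :: 'a \<Rightarrow> real) - indicator A)) \<longlonglongrightarrow> 0"
    proof (rule translate_continuous_closed[OF I])
      fix \<epsilon> :: real assume \<epsilon>: "\<epsilon> > 0"
      then obtain U where U: "open U" "A \<subseteq> U" "emeasure lborel (U - A) < ennreal (\<epsilon>\<^sup>2)"
        using outer_regular_lborel[OF A(1), of "\<epsilon>\<^sup>2"] by auto
      have [measurable]: "U \<in> sets borel" "A \<in> sets borel" using U A by auto
      have "emeasure lborel U = emeasure lborel (U - A) + emeasure lborel A"
        using U(2) by (subst plus_emeasure) (auto intro!: arg_cong[where f="emeasure lborel"])
      also have "\<dots> < \<infinity>" using U A by (auto simp: less_top[symmetric] order.strict_trans)
      finally have fin: "emeasure lborel U < \<infinity>" .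
      have IU: "(indicator U :: 'a \<Rightarrow> real) \<in> L2 lborel" using fin by (intro indicator_L2) auto
      have finD: "emeasure lborel (U - A) < \<infinity>" using U(3) by (simp add: order.strict_trans)
      have "L2.N lborel (indicator A - indicator U :: 'a \<Rightarrow> real) = L2.N lborel (indicator (U - A) :: 'a \<Rightarrow> real)"
        by (rule L2_N_cong) (use U(2) in \<open>auto simp: indicator_def fun_diff_def\<close>)
      moreover have "(L2.N lborel (indicator (U - A) :: 'a \<Rightarrow> real))\<^sup>2 < \<epsilon>\<^sup>2"
        using indicator_L2(2)[of "U - A" lborel] finD U(3)
        by (simp add: emeasure_eq_ennreal_measure less_top[symmetric] ennreal_less_iff)
      ultimately have "L2.N lborel (indicator A - indicator U :: 'a \<Rightarrow> real) < \<epsilon>"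
        using \<epsilon> by (simp add: power2_less_imp_less)
      then show "\<exists>v\<in>L2 lborel. L2.N lborel (indicator A - v :: 'a \<Rightarrow> real) < \<epsilon> \<and> (\<lambda>n. L2.N lborel (translate (z n) v - v)) \<longlonglongrightarrow> 0"
        using IU translate_continuous_open[OF U(1) fin z] by blast
    qed
    ultimately show ?thesis by (simp add: P_def)
  qed
  have [measurable]: "u \<in> borel_measurable borel" by (rule L2_borel[OF u])
  obtain F where F: "\<And>i::nat. simple_function lborel (F i)" "\<And>x. (\<lambda>i. F i x) \<longlonglongrightarrow> u x"
    "\<And>i x. norm (F i x) \<le> 2 * norm (u x)"
    using borel_measurable_implies_sequence_metric[of u lborel 0] by auto
  have [measurable]: "F i \<in> borel_measurable borel" for i
    using borel_measurable_simple_function[OF F(1)] by simp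
  have FL: "F i \<in> L2 lborel" for i by (rule L2_bound[OF u, of _ 2]) (use F in auto)
  have PF: "P (F i)" for i
  proof -
    define c where "c y = (indicator (F i -` {y}) :: 'a \<Rightarrow> real)" for y
    have fin: "finite (range (F i))" using F(1)[of i] by (simp add: simple_function_def)
    \<comment> \<open>The value 0 is left out because its level set may have infinite measure. The
      other level sets have finite measure by Markov's inequality.\<close>
    have eq: "F i = (\<Sum>y\<in>range (F i) - {0}. y *\<^sub>R c y)"
    proof
      fix x
      have "(\<Sum>y\<in>range (F i) - {0}. y *\<^sub>R c y) x = (\<Sum>y\<in>range (F i) - {0}. if y = F i x then y else 0)"
        by (subst sum_fun_apply, rule sum.cong) (auto simp: c_def indicator_def)
      also have "\<dots> = F i x" using fin by (subst sum.delta) auto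
      finally show "F i x = (\<Sum>y\<in>range (F i) - {0}. y *\<^sub>R c y) x" by simp
    qed
    have "P (\<Sum>y\<in>S. y *\<^sub>R c y)" if "finite S" "S \<subseteq> range (F i) - {0}" for S
      using that
    proof (induction S rule: finite_induct)
      case empty
      have "translate (z n) 0 = (0 :: 'a \<Rightarrow> real)" for n by (auto simp: translate_def)
      then have "P 0" by (simp add: P_def)
      then show ?case by (simp only: sum.empty)
    next
      case (insert y S)
      then have y: "y \<noteq> 0" by auto
      have [measurable]: "F i -` {y} \<in> sets borel" using measurable_sets[of "F i" borel borel "{y}"] by simp
      have "emeasure lborel (F i -` {y}) \<le> emeasure lborel {x \<in> space lborel. y\<^sup>2 \<le> (norm (F i x))\<^sup>2}"
        by (intro emeasure_mono) auto
      also have "\<dots> < \<infinity>"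
        using integral_Markov_inequality[OF L2_integrable[OF FL[of i]], of "y\<^sup>2"] y
        by (simp add: le_less_trans)
      finally have "P (c y)" unfolding c_def by (intro P_ind) auto
      then have "P (y *\<^sub>R c y + (\<Sum>y\<in>S. y *\<^sub>R c y))"
        by (intro P_add P_scale insert.IH) (use insert.prems in auto)
      then show ?case unfolding sum.insert[OF insert(1,2)] .
    qed
    from this[OF _ order_refl] fin show ?thesis by (simp flip: eq)
  qed
  show ?thesis
  proof (rule translate_continuous_closed[OF u])
    fix \<epsilon> :: real assume \<epsilon>: "\<epsilon> > 0"
    have "(\<lambda>i. \<integral>x. (norm ((u - F i) x))\<^sup>2 \<partial>lborel) \<longlonglongrightarrow> (\<integral>x. 0 \<partial>(lborel :: 'a measure))"
    proof (rule integral_dominated_convergence[where w="\<lambda>x. 9 * (norm (u x))\<^sup>2"])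
      show "integrable lborel (\<lambda>x. 9 * (norm (u x))\<^sup>2)" using L2_integrable[OF u] by simp
      show "AE x in lborel. (\<lambda>i. (norm ((u - F i) x))\<^sup>2) \<longlonglongrightarrow> 0"
      proof (rule AE_I2)
        fix x
        have "(\<lambda>i. (norm (u x - F i x))\<^sup>2) \<longlonglongrightarrow> (norm (u x - u x))\<^sup>2" by (intro tendsto_intros F)
        then show "(\<lambda>i. (norm ((u - F i) x))\<^sup>2) \<longlonglongrightarrow> 0" by simp
      qed
      show "AE x in lborel. norm ((norm ((u - F i) x))\<^sup>2) \<le> 9 * (norm (u x))\<^sup>2" for i
      proof (rule AE_I2)
        fix x
        have "norm (u x - F i x) \<le> 3 * norm (u x)" using norm_triangle_ineq4[of "u x" "F i x"] F(3)[of i x] by simp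
        from power_mono[OF this, of 2] show "norm ((norm ((u - F i) x))\<^sup>2) \<le> 9 * (norm (u x))\<^sup>2"
          by (simp add: power_mult_distrib)
      qed
    qed (auto simp: fun_diff_def)
    then have "(\<lambda>i. (L2.N lborel (u - F i))\<^sup>2) \<longlonglongrightarrow> 0" using u FL by (simp add: L2_N_sq)
    from LIMSEQ_D[OF this, of "\<epsilon>\<^sup>2"] \<epsilon> obtain i where "norm ((L2.N lborel (u - F i))\<^sup>2 - 0) < \<epsilon>\<^sup>2"
      by auto
    then have "(L2.N lborel (u - F i))\<^sup>2 < \<epsilon>\<^sup>2" by simp
    then have "L2.N lborel (u - F i) < \<epsilon>" using \<epsilon> power2_less_imp_less by force
    then show "\<exists>v\<in>L2 lborel. L2.N lborel (u - v) < \<epsilon> \<and> (\<lambda>n. L2.N lborel (translate (z n) v - v)) \<longlonglongrightarrow> 0"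
      using PF[of i] by (auto simp: P_def)
  qed
qed

section \<open>Plancherel's theorem\<close>

lemma gauss_integrable_real: "integrable lborel (\<lambda>x::real. exp (- x\<^sup>2 / 2))"
proof -
  have "integrable lborel (\<lambda>x. sqrt (2 * pi) * std_normal_density x)"
    by (intro integrable_mult_right integrable_normal_density) simp
  then show ?thesis by (simp add: std_normal_density_def)
qed

text \<open>This is the characteristic function of the standard normal distribution, freed of its
  normalising factor.\<close>

lemma gauss_fourier_real:
  "(\<integral>x. complex_of_real (exp (- x\<^sup>2 / 2)) * cis (t * x) \<partial>lborel) = complex_of_real (sqrt (2 * pi) * exp (- t\<^sup>2 / 2))"
proof -
  have "complex_of_real (exp (- t\<^sup>2 / 2)) = char std_normal_distribution t"
    by (simp add: char_std_normal_distribution)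
  also have "\<dots> = (\<integral>x. std_normal_density x *\<^sub>R iexp (t * x) \<partial>lborel)"
    unfolding char_def by (subst integral_density) (auto simp: normal_density_nonneg)
  also have "\<dots> = (\<integral>x. (1 / sqrt (2 * pi)) *\<^sub>R (complex_of_real (exp (- x\<^sup>2 / 2)) * cis (t * x)) \<partial>lborel)"
    by (intro Bochner_Integration.integral_cong refl)
      (simp add: std_normal_density_def scaleR_conv_of_real cis_conv_exp)
  also have "\<dots> = (1 / sqrt (2 * pi)) *\<^sub>R (\<integral>x. complex_of_real (exp (- x\<^sup>2 / 2)) * cis (t * x) \<partial>lborel)"
    by (rule integral_scaleR_right)
  finally show ?thesis by (simp add: scaleR_conv_of_real field_simps)
qed

text \<open>\<open>lborel\<close> is the image of a product of one-dimensional measures under the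
  coordinate map, so this is Fubini's theorem for products of functions of one coordinate
  each.\<close>

lemma
  fixes f :: "'a::euclidean_space \<Rightarrow> real \<Rightarrow> 'b::{real_normed_field, banach, second_countable_topology}"
  assumes f: "\<And>b. b \<in> Basis \<Longrightarrow> integrable lborel (f b)"
  shows integral_lborel_prod: "(\<integral>x. (\<Prod>b\<in>Basis. f b (x \<bullet> b)) \<partial>lborel) = (\<Prod>b\<in>Basis. \<integral>t. f b t \<partial>lborel)"
    and integrable_lborel_prod: "integrable lborel (\<lambda>x. \<Prod>b\<in>Basis. f b (x \<bullet> b))"
proof -
  interpret product_sigma_finite "\<lambda>_::'a. lborel :: real measure" ..
  have [measurable]: "f b \<in> borel_measurable borel" if "b \<in> Basis" for b
    using borel_measurable_integrable[OF f[OF that]] by simp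
  have m [measurable]: "(\<lambda>x. \<Prod>b\<in>Basis. f b (x \<bullet> b)) \<in> borel_measurable borel"
  proof (rule borel_measurable_prod)
    fix b :: 'a assume "b \<in> Basis"
    then have [measurable]: "f b \<in> borel_measurable borel" by fact
    show "(\<lambda>x. f b (x \<bullet> b)) \<in> borel_measurable borel" by measurable
  qed
  have T [measurable]: "(\<lambda>g. \<Sum>b\<in>Basis. g b *\<^sub>R b) \<in> measurable (\<Pi>\<^sub>M b\<in>(Basis::'a set). lborel) borel"
    by measurable
  have eq: "(\<Prod>b\<in>Basis. f b ((\<Sum>b\<in>Basis. g b *\<^sub>R b) \<bullet> b)) = (\<Prod>b\<in>Basis. f b (g b))" for g
    by (intro prod.cong refl) (simp add: inner_sum_left inner_Basis if_distrib sum.delta cong: if_cong)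
  show "(\<integral>x. (\<Prod>b\<in>Basis. f b (x \<bullet> b)) \<partial>lborel) = (\<Prod>b\<in>Basis. \<integral>t. f b t \<partial>lborel)"
    unfolding lborel_eq[where 'a='a] by (subst integral_distr[OF T m]) (simp add: eq product_integral_prod f)
  show "integrable lborel (\<lambda>x. \<Prod>b\<in>Basis. f b (x \<bullet> b))"
    unfolding lborel_eq[where 'a='a] by (subst integrable_distr_eq[OF T m]) (simp add: eq product_integrable_prod f)
qed

lemma exp_norm_prod: "exp (- (norm x)\<^sup>2 / 2) = (\<Prod>b\<in>Basis. exp (- (x \<bullet> b)\<^sup>2 / 2))"
  for x :: "'a::euclidean_space"
proof -
  have "(norm x)\<^sup>2 = (\<Sum>b\<in>Basis. (x \<bullet> b)\<^sup>2)"
    unfolding power2_norm_eq_inner by (subst euclidean_inner) (simp add: power2_eq_square)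
  then have "- (norm x)\<^sup>2 / 2 = (\<Sum>b\<in>Basis. - (x \<bullet> b)\<^sup>2 / 2)"
    by (simp add: sum_negf sum_divide_distrib)
  then show ?thesis by (simp add: exp_sum)
qed

lemma cis_sum: "finite S \<Longrightarrow> cis (sum f S) = (\<Prod>i\<in>S. cis (f i))"
  by (induction S rule: finite_induct) (auto simp: cis_mult[symmetric])

lemma cis_measurable [measurable]: "cis \<in> borel_measurable borel"
  by (intro borel_measurable_continuous_onI continuous_intros)

lemma gauss_integrable: "integrable lborel (\<lambda>x::'a::euclidean_space. exp (- (norm x)\<^sup>2 / 2))"
  unfolding exp_norm_prod by (rule integrable_lborel_prod) (rule gauss_integrable_real)

lemma gauss_fourier:
  fixes z :: "'a::euclidean_space"
  shows "(\<integral>x. exp (- (norm x)\<^sup>2 / 2) * cos (z \<bullet> x) \<partial>lborel) = sqrt (2 * pi) ^ DIM('a) * exp (- (norm z)\<^sup>2 / 2)"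
proof -
  define f where "f b t = complex_of_real (exp (- t\<^sup>2 / 2)) * cis ((z \<bullet> b) * t)" for b t
  have int: "integrable lborel (f b)" for b
    unfolding f_def by (rule Bochner_Integration.integrable_bound[OF gauss_integrable_real]) (auto simp: norm_mult)
  have eq: "complex_of_real (exp (- (norm x)\<^sup>2 / 2)) * cis (z \<bullet> x) = (\<Prod>b\<in>Basis. f b (x \<bullet> b))" for x
    unfolding f_def prod.distrib exp_norm_prod of_real_prod
    by (subst euclidean_inner) (simp add: cis_sum)
  have "(\<integral>x. exp (- (norm x)\<^sup>2 / 2) * cos (z \<bullet> x) \<partial>lborel)
      = (\<integral>x. Re (complex_of_real (exp (- (norm x)\<^sup>2 / 2)) * cis (z \<bullet> x)) \<partial>lborel)" by simp
  also have "\<dots> = Re (\<integral>x. complex_of_real (exp (- (norm x)\<^sup>2 / 2)) * cis (z \<bullet> x) \<partial>lborel)"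
    unfolding eq by (rule integral_Re) (rule integrable_lborel_prod[OF int])
  also have "\<dots> = Re (\<Prod>b\<in>Basis. complex_of_real (sqrt (2 * pi) * exp (- (z \<bullet> b)\<^sup>2 / 2)))"
    unfolding eq integral_lborel_prod[OF int] unfolding f_def by (simp only: gauss_fourier_real)
  also have "\<dots> = (\<Prod>b\<in>Basis. sqrt (2 * pi) * exp (- (z \<bullet> b)\<^sup>2 / 2))"
    by (simp only: of_real_prod[symmetric] Re_complex_of_real)
  also have "\<dots> = sqrt (2 * pi) ^ DIM('a) * exp (- (norm z)\<^sup>2 / 2)"
    by (simp only: prod.distrib exp_norm_prod prod_constant)
  finally show ?thesis .
qed

lemma gauss_fourier_scaled:
  fixes z :: "'a::euclidean_space"
  assumes e: "e > 0"
  shows "(\<integral>x. exp (- (norm (e *\<^sub>R x))\<^sup>2 / 2) * cos (z \<bullet> x) \<partial>lborel)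
     = (sqrt (2 * pi) / e) ^ DIM('a) * exp (- (norm (z /\<^sub>R e))\<^sup>2 / 2)"
proof -
  have "(\<integral>y. exp (- (norm y)\<^sup>2 / 2) * cos ((z /\<^sub>R e) \<bullet> y) \<partial>lborel)
      = e ^ DIM('a) *\<^sub>R (\<integral>x. exp (- (norm (e *\<^sub>R x))\<^sup>2 / 2) * cos ((z /\<^sub>R e) \<bullet> (e *\<^sub>R x)) \<partial>lborel)"
    by (rule integral_scale[OF _ e]) simp
  then have "e ^ DIM('a) * (\<integral>x. exp (- (norm (e *\<^sub>R x))\<^sup>2 / 2) * cos (z \<bullet> x) \<partial>lborel)
     = sqrt (2 * pi) ^ DIM('a) * exp (- (norm (z /\<^sub>R e))\<^sup>2 / 2)"
    unfolding gauss_fourier using e by (simp add: field_simps)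
  then show ?thesis using e by (simp add: power_divide field_simps)
qed

lemma gauss_scaled_integrable:
  "e > 0 \<Longrightarrow> integrable lborel (\<lambda>x::'a::euclidean_space. exp (- (norm (e *\<^sub>R x))\<^sup>2 / 2))"
proof -
  assume e: "e > 0"
  have d: "integrable (density (distr lborel borel (\<lambda>x::'a. 0 + e *\<^sub>R x)) (\<lambda>_. ennreal (e ^ DIM('a)))) (\<lambda>x::'a. exp (- (norm x)\<^sup>2 / 2))"
    using gauss_integrable lborel_affine[of e "0::'a"] e by simp
  then have "integrable (distr lborel borel (\<lambda>x::'a. 0 + e *\<^sub>R x)) (\<lambda>x. e ^ DIM('a) *\<^sub>R exp (- (norm x)\<^sup>2 / 2))"
    using e by (subst (asm) integrable_density) auto
  then have "integrable (distr lborel borel (\<lambda>x::'a. 0 + e *\<^sub>R x)) (\<lambda>x. exp (- (norm x)\<^sup>2 / 2))"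
    using e by simp
  then show ?thesis by (subst (asm) integrable_distr_eq) auto
qed

text \<open>The power spectrum of \<open>u\<close> is the Fourier transform of this function; testing it against
  Gaussians of shrinking width yields Plancherel's theorem.\<close>

definition autocorr :: "('a::euclidean_space \<Rightarrow> real) \<Rightarrow> 'a \<Rightarrow> real" where
  "autocorr u z = (\<integral>x. u x * u (x + z) \<partial>lborel)"

lemma autocorr_measurable [measurable]:
  "u \<in> borel_measurable borel \<Longrightarrow> autocorr u \<in> borel_measurable borel"
proof -
  assume [measurable]: "u \<in> borel_measurable borel"
  have [measurable]: "(\<lambda>(z, x). u x * u (x + z)) \<in> borel_measurable (borel \<Otimes>\<^sub>M lborel)"
    by measurable
  show "autocorr u \<in> borel_measurable borel" unfolding autocorr_def[abs_def] by measurable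
qed

lemma autocorr_pair_integrable:
  fixes u :: "'a::euclidean_space \<Rightarrow> real"
  assumes u: "integrable lborel u"
  shows "integrable (lborel \<Otimes>\<^sub>M lborel) (\<lambda>(x, z). u x * u (x + z))"
proof (rule lborel_pair.Fubini_integrable)
  have [measurable]: "u \<in> borel_measurable borel" using borel_measurable_integrable[OF u] by simp
  show "(\<lambda>(x, z). u x * u (x + z)) \<in> borel_measurable (lborel \<Otimes>\<^sub>M lborel)" by measurable
  have "(\<integral>z. norm (case (x, z) of (x, z) \<Rightarrow> u x * u (x + z)) \<partial>lborel) = \<bar>u x\<bar> * (\<integral>z. \<bar>u z\<bar> \<partial>lborel)" for x
    using integral_translate[of "\<lambda>z. \<bar>u z\<bar>" x] by (simp add: abs_mult add.commute[of x])
  then show "integrable lborel (\<lambda>x. \<integral>z. norm (case (x, z) of (x, z) \<Rightarrow> u x * u (x + z)) \<partial>lborel)"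
    using u by simp
  show "AE x in lborel. integrable lborel (\<lambda>z. case (x, z) of (x, z) \<Rightarrow> u x * u (x + z))"
    using integrable_translate[OF u] by (simp add: add.commute)
qed

lemma autocorr_integrable:
  assumes u: "integrable lborel u" shows "integrable lborel (autocorr u)"
  using lborel_pair.integrable_snd[OF autocorr_pair_integrable[OF u]] by (simp add: autocorr_def[abs_def])

lemma fourier1_measurable [measurable]:
  assumes [measurable]: "u \<in> borel_measurable borel"
  shows "fourier1 u \<in> borel_measurable borel"
  unfolding fourier1_def by measurable

lemma fourier1_kernel_integrable:
  assumes u: "integrable lborel u"
  shows "integrable lborel (\<lambda>x. cis (- (x \<bullet> \<xi>)) * complex_of_real (u x))"
proof (rule Bochner_Integration.integrable_bound[OF u])
  have [measurable]: "u \<in> borel_measurable borel" using borel_measurable_integrable[OF u] by simp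
  show "(\<lambda>x. cis (- (x \<bullet> \<xi>)) * complex_of_real (u x)) \<in> borel_measurable lborel" by measurable
qed (simp add: norm_mult)

text \<open>For real \<open>u\<close> the squared modulus is the square of the cosine integral plus
  that of the sine integral. The addition theorem for the cosine and the substitution
  \<open>z = y - x\<close> turn it into a double integral, and Fubini's theorem produces
  \<open>autocorr\<close>.\<close>

lemma fourier1_power_spectrum:
  fixes u :: "'a::euclidean_space \<Rightarrow> real"
  assumes u: "integrable lborel u"
  shows "(cmod (fourier1 u \<xi>))\<^sup>2 = (2 * pi) powr (- real DIM('a)) * (\<integral>z. cos (z \<bullet> \<xi>) * autocorr u z \<partial>lborel)"
proof -
  have um [measurable]: "u \<in> borel_measurable borel" using borel_measurable_integrable[OF u] by simp
  define C where "C = (\<integral>x. cos (x \<bullet> \<xi>) * u x \<partial>lborel)"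
  define S where "S = (\<integral>x. sin (x \<bullet> \<xi>) * u x \<partial>lborel)"
  have ci: "integrable lborel (\<lambda>x. cos (x \<bullet> \<xi>) * u x)" and si: "integrable lborel (\<lambda>x. sin (x \<bullet> \<xi>) * u x)"
    by (rule Bochner_Integration.integrable_bound[OF u]; simp add: abs_mult mult_left_le_one_le)+
  let ?I = "\<integral>x. cis (- (x \<bullet> \<xi>)) * complex_of_real (u x) \<partial>lborel"
  have "Re ?I = C" "Im ?I = - S"
    unfolding C_def S_def
    by (subst integral_Re[OF fourier1_kernel_integrable[OF u], symmetric]
        integral_Im[OF fourier1_kernel_integrable[OF u], symmetric]; simp)+
  then have "(cmod ?I)\<^sup>2 = C\<^sup>2 + S\<^sup>2" by (simp add: cmod_power2)
  also have "C\<^sup>2 + S\<^sup>2 = (\<integral>x. cos (x \<bullet> \<xi>) * u x * C + sin (x \<bullet> \<xi>) * u x * S \<partial>lborel)"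
    using ci si by (simp add: power2_eq_square C_def S_def)
  also have "\<dots> = (\<integral>x. (\<integral>z. cos (z \<bullet> \<xi>) * (u x * u (x + z)) \<partial>lborel) \<partial>lborel)"
  proof (rule Bochner_Integration.integral_cong[OF refl])
    fix x
    have "cos (x \<bullet> \<xi>) * u x * C + sin (x \<bullet> \<xi>) * u x * S
       = (\<integral>y. cos (x \<bullet> \<xi>) * u x * (cos (y \<bullet> \<xi>) * u y) + sin (x \<bullet> \<xi>) * u x * (sin (y \<bullet> \<xi>) * u y) \<partial>lborel)"
      using ci si by (simp add: C_def S_def)
    also have "\<dots> = (\<integral>y. cos ((y - x) \<bullet> \<xi>) * (u x * u y) \<partial>lborel)"
      by (rule Bochner_Integration.integral_cong[OF refl]) (simp add: inner_diff_left cos_diff algebra_simps)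
    also have "\<dots> = (\<integral>z. cos ((z + x - x) \<bullet> \<xi>) * (u x * u (z + x)) \<partial>lborel)"
      by (rule integral_translate[symmetric]) measurable
    finally show "cos (x \<bullet> \<xi>) * u x * C + sin (x \<bullet> \<xi>) * u x * S = (\<integral>z. cos (z \<bullet> \<xi>) * (u x * u (x + z)) \<partial>lborel)"
      by (simp add: add.commute)
  qed
  also have "\<dots> = (\<integral>z. (\<integral>x. cos (z \<bullet> \<xi>) * (u x * u (x + z)) \<partial>lborel) \<partial>lborel)"
  proof (rule lborel_pair.Fubini_integral[symmetric])
    show "integrable (lborel \<Otimes>\<^sub>M lborel) (\<lambda>(x, z). cos (z \<bullet> \<xi>) * (u x * u (x + z)))"
      by (rule Bochner_Integration.integrable_bound[OF autocorr_pair_integrable[OF u]])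
        (auto simp: abs_mult mult_left_le_one_le)
  qed
  also have "\<dots> = (\<integral>z. cos (z \<bullet> \<xi>) * autocorr u z \<partial>lborel)"
    by (simp add: autocorr_def)
  finally have "(cmod ?I)\<^sup>2 = (\<integral>z. cos (z \<bullet> \<xi>) * autocorr u z \<partial>lborel)" .
  moreover have "((2 * pi) powr (- real DIM('a) / 2))\<^sup>2 = (2 * pi) powr (- real DIM('a))"
    by (simp add: power2_eq_square powr_add[symmetric])
  ultimately show ?thesis
    unfolding fourier1_def norm_mult power_mult_distrib by (simp only: norm_of_real power2_abs)
qed

text \<open>Integrating the spectrum against a Gaussian of width \<open>1 / e\<close> gives
  \<open>autocorr\<close> against a Gaussian of width \<open>e\<close>. Rescaling by
  \<open>e\<close> freezes the Gaussian and moves \<open>e\<close> into the argument of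
  \<open>autocorr\<close>, ready for the limit \<open>e\<close> to 0.\<close>

lemma gauss_power_spectrum:
  fixes u :: "'a::euclidean_space \<Rightarrow> real"
  assumes u: "integrable lborel u" and e: "e > 0"
  shows "integrable lborel (\<lambda>\<xi>. exp (- (norm (e *\<^sub>R \<xi>))\<^sup>2 / 2) * (cmod (fourier1 u \<xi>))\<^sup>2)"
    and "(\<integral>\<xi>. exp (- (norm (e *\<^sub>R \<xi>))\<^sup>2 / 2) * (cmod (fourier1 u \<xi>))\<^sup>2 \<partial>lborel)
       = (2 * pi) powr (- real DIM('a) / 2) * (\<integral>w. exp (- (norm (w::'a))\<^sup>2 / 2) * autocorr u (e *\<^sub>R w) \<partial>lborel)"
proof -
  have um [measurable]: "u \<in> borel_measurable borel" using borel_measurable_integrable[OF u] by simp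
  let ?g = "\<lambda>\<xi>::'a. exp (- (norm (e *\<^sub>R \<xi>))\<^sup>2 / 2)"
  let ?c = "(2 * pi) powr (- real DIM('a))"
  have g: "integrable lborel ?g" by (rule gauss_scaled_integrable[OF e])
  have pair: "integrable (lborel \<Otimes>\<^sub>M lborel) (\<lambda>(z, \<xi>). ?g \<xi> * cos (z \<bullet> \<xi>) * autocorr u z)"
  proof (rule Bochner_Integration.integrable_bound)
    show "integrable (lborel \<Otimes>\<^sub>M lborel) (\<lambda>(z, \<xi>). autocorr u z * ?g \<xi>)"
    proof (rule lborel_pair.Fubini_integrable)
      show "integrable lborel (\<lambda>z. \<integral>\<xi>. norm (case (z, \<xi>) of (z, \<xi>) \<Rightarrow> autocorr u z * ?g \<xi>) \<partial>lborel)"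
        using autocorr_integrable[OF u] by (simp add: abs_mult)
      show "AE z in lborel. integrable lborel (\<lambda>\<xi>. case (z, \<xi>) of (z, \<xi>) \<Rightarrow> autocorr u z * ?g \<xi>)"
        using g by simp
    qed measurable
    show "AE x in lborel \<Otimes>\<^sub>M lborel. norm (case x of (z, \<xi>) \<Rightarrow> ?g \<xi> * cos (z \<bullet> \<xi>) * autocorr u z)
        \<le> norm (case x of (z, \<xi>) \<Rightarrow> autocorr u z * ?g \<xi>)"
    proof (rule AE_I2, clarify)
      fix z \<xi> :: 'a
      have "?g \<xi> * \<bar>cos (z \<bullet> \<xi>)\<bar> * \<bar>autocorr u z\<bar> \<le> ?g \<xi> * 1 * \<bar>autocorr u z\<bar>"
        by (intro mult_right_mono mult_left_mono) auto
      then show "norm (?g \<xi> * cos (z \<bullet> \<xi>) * autocorr u z) \<le> norm (autocorr u z * ?g \<xi>)"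
        by (simp add: abs_mult mult_ac)
    qed
  qed measurable
  have sp: "?g \<xi> * (cmod (fourier1 u \<xi>))\<^sup>2 = ?c * (\<integral>z. ?g \<xi> * cos (z \<bullet> \<xi>) * autocorr u z \<partial>lborel)" for \<xi>
    unfolding fourier1_power_spectrum[OF u] by (simp add: mult.assoc)
  show "integrable lborel (\<lambda>\<xi>. ?g \<xi> * (cmod (fourier1 u \<xi>))\<^sup>2)"
    unfolding sp using lborel_pair.integrable_snd[OF pair] by simp
  have "(\<integral>\<xi>. ?g \<xi> * (cmod (fourier1 u \<xi>))\<^sup>2 \<partial>lborel) = ?c * (\<integral>\<xi>. (\<integral>z. ?g \<xi> * cos (z \<bullet> \<xi>) * autocorr u z \<partial>lborel) \<partial>lborel)"
    unfolding sp by simp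
  also have "(\<integral>\<xi>. (\<integral>z. ?g \<xi> * cos (z \<bullet> \<xi>) * autocorr u z \<partial>lborel) \<partial>lborel)
     = (\<integral>z. (\<integral>\<xi>. ?g \<xi> * cos (z \<bullet> \<xi>) * autocorr u z \<partial>lborel) \<partial>lborel)"
    by (rule lborel_pair.Fubini_integral[OF pair])
  also have "\<dots> = (\<integral>z. (sqrt (2 * pi) / e) ^ DIM('a) * exp (- (norm (z /\<^sub>R e))\<^sup>2 / 2) * autocorr u z \<partial>lborel)"
    by (simp only: integral_mult_left_zero gauss_fourier_scaled[OF e])
  also have "\<dots> = e ^ DIM('a) *\<^sub>R (\<integral>w. (sqrt (2 * pi) / e) ^ DIM('a) * exp (- (norm ((e *\<^sub>R w) /\<^sub>R e))\<^sup>2 / 2) * autocorr u (e *\<^sub>R w) \<partial>lborel)"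
    by (rule integral_scale[OF _ e]) measurable
  also have "\<dots> = sqrt (2 * pi) ^ DIM('a) * (\<integral>w. exp (- (norm (w::'a))\<^sup>2 / 2) * autocorr u (e *\<^sub>R w) \<partial>lborel)"
    using e by (simp add: power_divide mult.assoc)
  also have "?c * (sqrt (2 * pi) ^ DIM('a) * (\<integral>w. exp (- (norm (w::'a))\<^sup>2 / 2) * autocorr u (e *\<^sub>R w) \<partial>lborel))
     = (2 * pi) powr (- real DIM('a) / 2) * (\<integral>w. exp (- (norm (w::'a))\<^sup>2 / 2) * autocorr u (e *\<^sub>R w) \<partial>lborel)"
  proof -
    have "sqrt (2 * pi) ^ DIM('a) = (2 * pi) powr (real DIM('a) / 2)"
      by (simp add: powr_half_sqrt[symmetric] powr_realpow[symmetric] powr_powr)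
    then have "?c * sqrt (2 * pi) ^ DIM('a) = (2 * pi) powr (- real DIM('a) / 2)"
      by (simp add: powr_add[symmetric])
    then show ?thesis by (simp only: mult.assoc[symmetric])
  qed
  finally show "(\<integral>\<xi>. ?g \<xi> * (cmod (fourier1 u \<xi>))\<^sup>2 \<partial>lborel)
       = (2 * pi) powr (- real DIM('a) / 2) * (\<integral>w. exp (- (norm (w::'a))\<^sup>2 / 2) * autocorr u (e *\<^sub>R w) \<partial>lborel)" .
qed

text \<open>In \<open>gauss_power_spectrum\<close> let \<open>e\<close> tend to 0. On the frequency
  side the Gaussians increase to 1 and monotone convergence applies. On the other side
  \<open>autocorr\<close> is bounded by Cauchy-Schwarz and tends to its value at 0, the squared
  norm, because translations are continuous in L^2; the mass of the Gaussian cancels the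
  prefactor.\<close>

theorem plancherel:
  fixes u :: "'a::euclidean_space \<Rightarrow> real"
  assumes u: "integrable lborel u" "u \<in> L2 lborel"
  shows "fourier1 u \<in> L2 lborel" "L2.N lborel (fourier1 u) = L2.N lborel u"
proof -
  have um [measurable]: "u \<in> borel_measurable borel" by (rule L2_borel[OF u(2)])
  define e where "e n = inverse (real (Suc n))" for n
  have e: "e n > 0" for n by (simp add: e_def)
  have e0: "e \<longlonglongrightarrow> 0" unfolding e_def by (rule LIMSEQ_inverse_real_of_nat)
  let ?G = "\<lambda>n \<xi>. exp (- (norm (e n *\<^sub>R \<xi>))\<^sup>2 / 2) * (cmod (fourier1 u \<xi>))\<^sup>2"
  have ac: "autocorr u z = ip lborel u (translate z u)" for z
    by (simp add: autocorr_def ip_def translate_def)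
  have acb: "\<bar>autocorr u z\<bar> \<le> (L2.N lborel u)\<^sup>2" for z
    using L2.cauchy_schwarz[OF u(2) translate_L2(1)[OF u(2)], of z] translate_L2(2)[OF u(2), of z]
    by (simp add: ac power2_eq_square)
  have acl: "(\<lambda>n. autocorr u (e n *\<^sub>R w)) \<longlonglongrightarrow> (L2.N lborel u)\<^sup>2" for w
  proof -
    have "(\<lambda>n. e n *\<^sub>R w) \<longlonglongrightarrow> 0" using tendsto_scaleR[OF e0 tendsto_const, of w] by simp
    note lim = translate_continuous[OF u(2) this]
    have "(\<lambda>n. autocorr u (e n *\<^sub>R w) - (L2.N lborel u)\<^sup>2) \<longlonglongrightarrow> 0"
    proof (rule Lim_null_comparison[OF always_eventually])
      show "(\<lambda>n. L2.N lborel u * L2.N lborel (translate (e n *\<^sub>R w) u - u)) \<longlonglongrightarrow> 0"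
        by (rule tendsto_mult_right_zero[OF lim])
      show "\<forall>n. norm (autocorr u (e n *\<^sub>R w) - (L2.N lborel u)\<^sup>2) \<le> L2.N lborel u * L2.N lborel (translate (e n *\<^sub>R w) u - u)"
      proof
        fix n
        note s = translate_L2(1)[OF u(2), of "e n *\<^sub>R w"]
        have "autocorr u (e n *\<^sub>R w) - (L2.N lborel u)\<^sup>2 = ip lborel u (translate (e n *\<^sub>R w) u - u)"
          using u(2) s by (simp add: ac L2.N_sq L2.B_diff2)
        then show "norm (autocorr u (e n *\<^sub>R w) - (L2.N lborel u)\<^sup>2) \<le> L2.N lborel u * L2.N lborel (translate (e n *\<^sub>R w) u - u)"
          using L2.cauchy_schwarz[OF u(2) L2.E_diff[OF s u(2)]] by simp
      qed
    qed
    then show ?thesis by (simp add: LIM_zero_iff)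
  qed
  have "(\<lambda>n. \<integral>w. exp (- (norm (w::'a))\<^sup>2 / 2) * autocorr u (e n *\<^sub>R w) \<partial>lborel)
      \<longlonglongrightarrow> (\<integral>w. exp (- (norm (w::'a))\<^sup>2 / 2) * (L2.N lborel u)\<^sup>2 \<partial>lborel)"
  proof (rule integral_dominated_convergence[where w="\<lambda>w. exp (- (norm (w::'a))\<^sup>2 / 2) * (L2.N lborel u)\<^sup>2"])
    show "integrable lborel (\<lambda>w. exp (- (norm (w::'a))\<^sup>2 / 2) * (L2.N lborel u)\<^sup>2)"
      using gauss_integrable[where 'a='a] by (intro integrable_mult_left) simp
    show "AE x in lborel. (\<lambda>n. exp (- (norm x)\<^sup>2 / 2) * autocorr u (e n *\<^sub>R x)) \<longlonglongrightarrow> exp (- (norm x)\<^sup>2 / 2) * (L2.N lborel u)\<^sup>2"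
      by (intro AE_I2 tendsto_intros acl)
    show "AE x in lborel. norm (exp (- (norm x)\<^sup>2 / 2) * autocorr u (e n *\<^sub>R x)) \<le> exp (- (norm x)\<^sup>2 / 2) * (L2.N lborel u)\<^sup>2" for n
      using acb by (auto simp: abs_mult)
  qed measurable
  moreover have "(\<integral>w. exp (- (norm (w::'a))\<^sup>2 / 2) * (L2.N lborel u)\<^sup>2 \<partial>lborel) = (2 * pi) powr (real DIM('a) / 2) * (L2.N lborel u)\<^sup>2"
  proof -
    have "(\<integral>w. exp (- (norm (w::'a))\<^sup>2 / 2) \<partial>lborel) = sqrt (2 * pi) ^ DIM('a)"
      using gauss_fourier[of "0::'a"] by simp
    also have "\<dots> = (2 * pi) powr (real DIM('a) / 2)"
      by (simp add: powr_half_sqrt[symmetric] powr_realpow[symmetric] powr_powr)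
    finally show ?thesis by simp
  qed
  ultimately have "(\<lambda>n. (2 * pi) powr (- real DIM('a) / 2) * (\<integral>w. exp (- (norm (w::'a))\<^sup>2 / 2) * autocorr u (e n *\<^sub>R w) \<partial>lborel))
      \<longlonglongrightarrow> (2 * pi) powr (- real DIM('a) / 2) * ((2 * pi) powr (real DIM('a) / 2) * (L2.N lborel u)\<^sup>2)"
    by (intro tendsto_mult_left) (simp only:)
  then have lim: "(\<lambda>n. \<integral>\<xi>. ?G n \<xi> \<partial>lborel) \<longlonglongrightarrow> (L2.N lborel u)\<^sup>2"
    unfolding gauss_power_spectrum(2)[OF u(1) e] by (simp add: mult.assoc[symmetric] powr_add[symmetric])
  have "(\<lambda>n. \<integral>\<^sup>+\<xi>. ennreal (?G n \<xi>) \<partial>lborel) \<longlonglongrightarrow> (\<integral>\<^sup>+\<xi>. ennreal ((cmod (fourier1 u \<xi>))\<^sup>2) \<partial>lborel)"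
  proof (rule nn_integral_LIMSEQ)
    show "incseq (\<lambda>n \<xi>. ennreal (?G n \<xi>))"
    proof (rule incseq_SucI, rule le_funI, rule ennreal_leI, rule mult_right_mono)
      fix n and \<xi> :: 'a
      have "norm (e (Suc n) *\<^sub>R \<xi>) \<le> norm (e n *\<^sub>R \<xi>)"
        by (auto simp: e_def intro!: mult_right_mono)
      from power_mono[OF this, of 2] show "exp (- (norm (e n *\<^sub>R \<xi>))\<^sup>2 / 2) \<le> exp (- (norm (e (Suc n) *\<^sub>R \<xi>))\<^sup>2 / 2)"
        by simp
    qed simp
    show "(\<lambda>n. ennreal (?G n \<xi>)) \<longlonglongrightarrow> ennreal ((cmod (fourier1 u \<xi>))\<^sup>2)" for \<xi>
    proof -
      have "(\<lambda>n. ?G n \<xi>) \<longlonglongrightarrow> exp (- (norm (0 *\<^sub>R \<xi>))\<^sup>2 / 2) * (cmod (fourier1 u \<xi>))\<^sup>2"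
        by (intro tendsto_intros e0) simp
      then show ?thesis by simp
    qed
  qed measurable
  moreover have "(\<integral>\<^sup>+\<xi>. ennreal (?G n \<xi>) \<partial>lborel) = ennreal (\<integral>\<xi>. ?G n \<xi> \<partial>lborel)" for n
    by (rule nn_integral_eq_integral[OF gauss_power_spectrum(1)[OF u(1) e]]) simp
  ultimately have "(\<integral>\<^sup>+\<xi>. ennreal ((cmod (fourier1 u \<xi>))\<^sup>2) \<partial>lborel) = ennreal ((L2.N lborel u)\<^sup>2)"
    using LIMSEQ_unique[OF _ tendsto_ennrealI[OF lim]] by (simp only:)
  then have nn: "(\<integral>\<^sup>+\<xi>. ennreal ((norm (fourier1 u \<xi>))\<^sup>2) \<partial>lborel) = ennreal ((L2.N lborel u)\<^sup>2)" by simp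
  then show F: "fourier1 u \<in> L2 lborel" by (subst L2_iff_nn) simp_all
  have "(L2.N lborel (fourier1 u))\<^sup>2 = (L2.N lborel u)\<^sup>2" using nn L2_nn[OF F] by simp
  then show "L2.N lborel (fourier1 u) = L2.N lborel u" using F u by simp
qed

section \<open>The Fourier transform on \<open>L\<^sup>2\<close>\<close>

text \<open>These are the integrable cutoffs through which \<open>is_fourier_L2\<close> defines the
  transform.\<close>

definition trunc :: "real \<Rightarrow> ('a::euclidean_space \<Rightarrow> real) \<Rightarrow> 'a \<Rightarrow> real" where
  "trunc R u = (\<lambda>x. indicator (ball 0 R) x * u x)"

lemma trunc_measurable [measurable]: "u \<in> borel_measurable borel \<Longrightarrow> trunc R u \<in> borel_measurable borel"
  by (auto simp: trunc_def intro!: borel_measurable_times borel_measurable_indicator)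

lemma trunc_L2: "u \<in> L2 lborel \<Longrightarrow> trunc R u \<in> L2 lborel"
  by (rule L2_bound[of u _ _ 1]) (auto simp: trunc_def indicator_def dest: L2_borel)

lemma trunc_integrable:
  assumes u: "u \<in> L2 lborel" shows "integrable lborel (trunc R u)"
proof (rule Bochner_Integration.integrable_bound)
  have [measurable]: "u \<in> borel_measurable borel" by (rule L2_borel[OF u])
  have "emeasure lborel (ball (0::'a) R) < \<infinity>" by (rule emeasure_bounded_finite) simp
  then show "integrable lborel (\<lambda>x. indicator (ball 0 R) x + (norm (u x))\<^sup>2)"
    using L2_integrable[OF u] by (simp add: less_top[symmetric])
  have "\<bar>u x\<bar> \<le> 1 + (u x)\<^sup>2" for x
    using sum_squares_bound[of 1 "\<bar>u x\<bar>"] by (simp add: power2_eq_square)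
  then show "AE x in lborel. norm (trunc R u x) \<le> norm (indicator (ball 0 R) x + (norm (u x))\<^sup>2)"
    by (auto simp: trunc_def indicator_def)
qed (use u in \<open>auto dest: L2_borel\<close>)

lemma trunc_tendsto:
  fixes u :: "'a::euclidean_space \<Rightarrow> real"
  assumes u: "u \<in> L2 lborel"
  shows "((\<lambda>R. L2.N lborel (u - trunc R u)) \<longlongrightarrow> 0) at_top"
proof -
  have [measurable]: "u \<in> borel_measurable borel" by (rule L2_borel[OF u])
  have "((\<lambda>R. \<integral>x. (norm ((u - trunc R u) x))\<^sup>2 \<partial>lborel) \<longlongrightarrow> (\<integral>x. 0 \<partial>(lborel::'a measure))) at_top"
  proof (rule integral_dominated_convergence_at_top[where w="\<lambda>x. (norm (u x))\<^sup>2"])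
    show "integrable lborel (\<lambda>x. (norm (u x))\<^sup>2)" by (rule L2_integrable[OF u])
    show "\<forall>\<^sub>F R in at_top. AE x in lborel. norm ((norm ((u - trunc R u) x))\<^sup>2) \<le> (norm (u x))\<^sup>2"
      by (auto simp: trunc_def indicator_def)
    show "AE x in lborel. ((\<lambda>R. (norm ((u - trunc R u) x))\<^sup>2) \<longlongrightarrow> 0) at_top"
    proof (rule AE_I2)
      fix x
      have "\<forall>\<^sub>F R in at_top. (norm ((u - trunc R u) x))\<^sup>2 = 0"
        using eventually_gt_at_top[of "norm x"] by eventually_elim (simp add: trunc_def)
      then show "((\<lambda>R. (norm ((u - trunc R u) x))\<^sup>2) \<longlongrightarrow> 0) at_top" by (rule tendsto_eventually)
    qed
  qed (auto simp: fun_diff_def)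
  then have "((\<lambda>R. (L2.N lborel (u - trunc R u))\<^sup>2) \<longlongrightarrow> 0) at_top"
    using u by (simp add: L2_N_sq trunc_L2)
  from tendsto_real_sqrt[OF this] show ?thesis using u by (simp add: trunc_L2)
qed

lemma fourier1_diff:
  assumes "integrable lborel u" "integrable lborel v"
  shows "fourier1 (u - v) = fourier1 u - fourier1 v"
  using fourier1_kernel_integrable[OF assms(1)] fourier1_kernel_integrable[OF assms(2)]
  by (auto simp: fourier1_def fun_eq_iff algebra_simps)

lemma fourier1_translate:
  assumes u: "integrable lborel u"
  shows "fourier1 (translate h u) \<xi> = cis (h \<bullet> \<xi>) * fourier1 u \<xi>"
proof -
  have [measurable]: "u \<in> borel_measurable borel" using borel_measurable_integrable[OF u] by simp
  have "(\<integral>x. cis (- (x \<bullet> \<xi>)) * complex_of_real (u (x + h)) \<partial>lborel)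
      = (\<integral>x. cis (h \<bullet> \<xi>) * (cis (- ((x + h) \<bullet> \<xi>)) * complex_of_real (u (x + h))) \<partial>lborel)"
    by (simp add: mult.assoc[symmetric] cis_mult inner_add_left)
  also have "\<dots> = (\<integral>x. cis (h \<bullet> \<xi>) * (cis (- (x \<bullet> \<xi>)) * complex_of_real (u x)) \<partial>lborel)"
    by (rule integral_translate) measurable
  finally show ?thesis by (simp add: fourier1_def translate_def)
qed

lemma fourier1_trunc_L2:
  assumes "u \<in> L2 lborel"
  shows "fourier1 (trunc R u) \<in> L2 lborel" "L2.N lborel (fourier1 (trunc R u)) = L2.N lborel (trunc R u)"
  by (intro plancherel trunc_integrable trunc_L2 assms)+

text \<open>The definition asks of \<open>g\<close> only measurability and a limit of extended
  integrals. Membership in L^2 follows, since \<open>g\<close> is at finite distance from some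
  transformed truncation, which lies in L^2 by Plancherel's theorem.\<close>

lemma is_fourier_L2_iff:
  assumes u: "u \<in> L2 lborel"
  shows "is_fourier_L2 u g \<longleftrightarrow> g \<in> L2 lborel \<and> ((\<lambda>R. L2.N lborel (g - fourier1 (trunc R u))) \<longlongrightarrow> 0) at_top"
    (is "?l \<longleftrightarrow> ?r")
proof -
  let ?F = "\<lambda>R. fourier1 (trunc R u)"
  have nn: "(\<integral>\<^sup>+\<xi>. ennreal ((cmod (g \<xi> - ?F R \<xi>))\<^sup>2) \<partial>lborel) = ennreal ((L2.N lborel (g - ?F R))\<^sup>2)"
    if "g \<in> L2 lborel" for R
    using L2_nn[of "g - ?F R" lborel] that fourier1_trunc_L2[OF u] by simp
  have um [measurable]: "u \<in> borel_measurable borel" by (rule L2_borel[OF u])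
  show ?thesis
  proof
    assume l: ?l
    then have gm [measurable]: "g \<in> borel_measurable borel" and
      lim: "((\<lambda>R. \<integral>\<^sup>+\<xi>. ennreal ((cmod (g \<xi> - ?F R \<xi>))\<^sup>2) \<partial>lborel) \<longlongrightarrow> 0) at_top"
      by (simp_all add: is_fourier_L2_def trunc_def)
    have "\<forall>\<^sub>F R in at_top. (\<integral>\<^sup>+\<xi>. ennreal ((cmod (g \<xi> - ?F R \<xi>))\<^sup>2) \<partial>lborel) < 1"
      by (rule order_tendstoD(2)[OF lim]) simp
    from eventually_happens'[OF trivial_limit_at_top_linorder this]
    obtain R where R: "(\<integral>\<^sup>+\<xi>. ennreal ((cmod (g \<xi> - ?F R \<xi>))\<^sup>2) \<partial>lborel) < 1"
      by (elim exE)
    have m: "g - ?F R \<in> borel_measurable lborel" by (simp add: fun_diff_def)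
    have "(\<integral>\<^sup>+\<xi>. ennreal ((cmod (g \<xi> - ?F R \<xi>))\<^sup>2) \<partial>lborel) < \<infinity>"
      using R by (rule order.strict_trans) simp
    then have "g - ?F R \<in> L2 lborel"
      using L2_iff_nn[OF m] by simp
    then have "(g - ?F R) + ?F R \<in> L2 lborel" using fourier1_trunc_L2(1)[OF u] by (rule L2.E_add)
    then have g: "g \<in> L2 lborel" by simp
    have "((\<lambda>R. ennreal ((L2.N lborel (g - ?F R))\<^sup>2)) \<longlongrightarrow> ennreal 0) at_top"
      using lim unfolding nn[OF g] by simp
    then have "((\<lambda>R. (L2.N lborel (g - ?F R))\<^sup>2) \<longlongrightarrow> 0) at_top"
      by (subst (asm) tendsto_ennreal_iff) auto
    from tendsto_real_sqrt[OF this] show ?r using g fourier1_trunc_L2(1)[OF u] by simp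
  next
    assume r: ?r
    then have "((\<lambda>R. (L2.N lborel (g - ?F R))\<^sup>2) \<longlongrightarrow> 0\<^sup>2) at_top" by (intro tendsto_power) auto
    then have "((\<lambda>R. ennreal ((L2.N lborel (g - ?F R))\<^sup>2)) \<longlongrightarrow> 0) at_top"
      using tendsto_ennrealI by fastforce
    then show ?l using r unfolding nn[OF conjunct1[OF r], symmetric]
      by (simp add: is_fourier_L2_def trunc_def L2_borel)
  qed
qed

text \<open>By Plancherel's theorem the transforms of the truncations are Cauchy. The limit is taken
  along integer radii, and the same isometry extends it to all real radii.\<close>

lemma is_fourier_L2_exists:
  assumes u: "u \<in> L2 lborel" shows "\<exists>g. is_fourier_L2 u g"
proof -
  let ?F = "\<lambda>R. fourier1 (trunc R u)"
  have F: "?F R \<in> L2 lborel" for R by (rule fourier1_trunc_L2[OF u])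
  have iso: "L2.N lborel (?F R - ?F S) \<le> L2.N lborel (u - trunc R u) + L2.N lborel (u - trunc S u)" for R S
  proof -
    note tr = trunc_L2[OF u, of R] trunc_L2[OF u, of S]
    have "L2.N lborel (?F R - ?F S) = L2.N lborel (trunc R u - trunc S u)"
      unfolding fourier1_diff[OF trunc_integrable[OF u] trunc_integrable[OF u], symmetric]
    proof (rule plancherel(2))
      show "integrable lborel (trunc R u - trunc S u)"
        using trunc_integrable[OF u] by (simp add: fun_diff_def)
    qed (use tr in simp)
    also have "\<dots> \<le> L2.N lborel (trunc R u - u) + L2.N lborel (u - trunc S u)"
      using tr u by (intro L2.N_triangle3)
    also have "L2.N lborel (trunc R u - u) = L2.N lborel (u - trunc R u)" using tr u by (intro L2.N_diff_commute)
    finally show ?thesis .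
  qed
  have small: "\<exists>R0. \<forall>R\<ge>R0. L2.N lborel (u - trunc R u) < \<epsilon>" if "\<epsilon> > 0" for \<epsilon>
    using order_tendstoD(2)[OF trunc_tendsto[OF u] that] by (simp add: eventually_at_top_linorder)
  obtain g where g: "g \<in> L2 lborel" "(\<lambda>n. L2.N lborel (?F (real n) - g)) \<longlonglongrightarrow> 0"
  proof -
    have "\<exists>l\<in>L2 lborel. (\<lambda>n. L2.N lborel (?F (real n) - l)) \<longlonglongrightarrow> 0"
    proof (rule L2_complete)
      fix \<epsilon> :: real assume "\<epsilon> > 0"
      then obtain R0 where R0: "\<And>R. R \<ge> R0 \<Longrightarrow> L2.N lborel (u - trunc R u) < \<epsilon> / 2" using small[of "\<epsilon>/2"] by auto
      have "L2.N lborel (?F (real m) - ?F (real n)) < \<epsilon>" if "m \<ge> nat \<lceil>R0\<rceil>" "n \<ge> nat \<lceil>R0\<rceil>" for m n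
      proof -
        have "real m \<ge> R0" "real n \<ge> R0" using that by linarith+
        from R0[OF this(1)] R0[OF this(2)] iso[of "real m" "real n"] show ?thesis by linarith
      qed
      then show "\<exists>K. \<forall>m\<ge>K. \<forall>n\<ge>K. L2.N lborel (?F (real m) - ?F (real n)) < \<epsilon>" by blast
    qed (rule F)
    then show ?thesis using that by blast
  qed
  have "((\<lambda>R. L2.N lborel (g - ?F R)) \<longlongrightarrow> 0) at_top"
  proof (rule tendstoI)
    fix \<epsilon> :: real assume "\<epsilon> > 0"
    then obtain R0 where R0: "\<And>R. R \<ge> R0 \<Longrightarrow> L2.N lborel (u - trunc R u) < \<epsilon> / 3" using small[of "\<epsilon>/3"] by auto
    obtain n0 where n0: "\<And>n. n \<ge> n0 \<Longrightarrow> norm (L2.N lborel (?F (real n) - g) - 0) < \<epsilon> / 3"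
      using LIMSEQ_D[OF g(2), of "\<epsilon>/3"] \<open>\<epsilon> > 0\<close> by auto
    define n where "n = max n0 (nat \<lceil>R0\<rceil>)"
    have n: "real n \<ge> R0" "n \<ge> n0" by (auto simp: n_def) linarith
    have "dist (L2.N lborel (g - ?F R)) 0 < \<epsilon>" if "R \<ge> R0" for R
    proof -
      have "L2.N lborel (g - ?F R) \<le> L2.N lborel (g - ?F (real n)) + L2.N lborel (?F (real n) - ?F R)"
        using g F by (intro L2.N_triangle3)
      moreover have "L2.N lborel (g - ?F (real n)) = L2.N lborel (?F (real n) - g)" using g F by (intro L2.N_diff_commute)
      ultimately show ?thesis
        using iso[of "real n" R] R0[OF that] R0[OF n(1)] n0[OF n(2)] g F[of R] F[of "real n"] by (simp add: dist_real_def)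
    qed
    then show "\<forall>\<^sub>F R in at_top. dist (L2.N lborel (g - ?F R)) 0 < \<epsilon>"
      unfolding eventually_at_top_linorder by blast
  qed
  then show ?thesis using g is_fourier_L2_iff[OF u] by blast
qed

text \<open>One fixed representative. Transforms are unique only almost everywhere
  (\<open>fhat_unique\<close>), so linearity of \<open>fhat\<close> holds only almost everywhere as
  well.\<close>

definition fhat :: "('a::euclidean_space \<Rightarrow> real) \<Rightarrow> 'a \<Rightarrow> complex" where
  "fhat u = (SOME g. is_fourier_L2 u g)"

lemma fhat_fourier: "u \<in> L2 lborel \<Longrightarrow> is_fourier_L2 u (fhat u)"
  unfolding fhat_def by (rule someI_ex[OF is_fourier_L2_exists])

lemma fhat_L2: "u \<in> L2 lborel \<Longrightarrow> fhat u \<in> L2 lborel"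
  and fhat_lim: "u \<in> L2 lborel \<Longrightarrow> ((\<lambda>R. L2.N lborel (fhat u - fourier1 (trunc R u))) \<longlongrightarrow> 0) at_top"
  using fhat_fourier is_fourier_L2_iff by blast+

lemma L2_N_zero_AE:
  assumes "f \<in> L2 M" "L2.N M f = 0" shows "AE x in M. f x = 0"
proof -
  have "(\<integral>x. (norm (f x))\<^sup>2 \<partial>M) = 0" using L2_N_sq[OF assms(1)] assms(2) by simp
  then have "AE x in M. (norm (f x))\<^sup>2 = 0"
    using integral_nonneg_eq_0_iff_AE[OF L2_integrable[OF assms(1)]] by simp
  then show ?thesis by simp
qed

lemma fhat_unique:
  assumes u: "u \<in> L2 lborel" and g: "is_fourier_L2 u g" shows "AE \<xi> in lborel. g \<xi> = fhat u \<xi>"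
proof -
  have gL: "g \<in> L2 lborel" "((\<lambda>R. L2.N lborel (g - fourier1 (trunc R u))) \<longlongrightarrow> 0) at_top"
    using g is_fourier_L2_iff[OF u] by auto
  have "((\<lambda>R::real. L2.N lborel (g - fhat u)) \<longlongrightarrow> 0) at_top"
  proof (rule Lim_null_comparison[OF always_eventually])
    show "((\<lambda>R. L2.N lborel (g - fourier1 (trunc R u)) + L2.N lborel (fhat u - fourier1 (trunc R u))) \<longlongrightarrow> 0) at_top"
      by (rule tendsto_add_zero[OF gL(2) fhat_lim[OF u]])
    show "\<forall>R. norm (L2.N lborel (g - fhat u)) \<le> L2.N lborel (g - fourier1 (trunc R u)) + L2.N lborel (fhat u - fourier1 (trunc R u))"
    proof
      fix R
      note mem = gL(1) fhat_L2[OF u] fourier1_trunc_L2(1)[OF u, of R]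
      show "norm (L2.N lborel (g - fhat u)) \<le> L2.N lborel (g - fourier1 (trunc R u)) + L2.N lborel (fhat u - fourier1 (trunc R u))"
        using L2.N_triangle3[OF mem(1) mem(3) mem(2)] L2.N_diff_commute[OF mem(2,3)] mem by simp
    qed
  qed
  then have "L2.N lborel (g - fhat u) = 0" by (simp add: tendsto_const_iff)
  then have "AE \<xi> in lborel. (g - fhat u) \<xi> = 0"
    using gL fhat_L2[OF u] by (intro L2_N_zero_AE[of "g - fhat u" lborel]) auto
  then show ?thesis by simp
qed

lemma fhat_N:
  assumes u: "u \<in> L2 lborel" shows "L2.N lborel (fhat u) = L2.N lborel u"
proof (rule tendsto_unique)
  have F: "fourier1 (trunc R u) \<in> L2 lborel" for R by (rule fourier1_trunc_L2[OF u])
  have "((\<lambda>R. L2.N lborel (fourier1 (trunc R u) - fhat u)) \<longlongrightarrow> 0) at_top"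
    using fhat_lim[OF u] L2.N_diff_commute[OF F fhat_L2[OF u]] by simp
  then show "((\<lambda>R. L2.N lborel (fourier1 (trunc R u))) \<longlongrightarrow> L2.N lborel (fhat u)) at_top"
    by (rule L2.N_tendsto[OF F fhat_L2[OF u]])
  have "((\<lambda>R. L2.N lborel (trunc R u - u)) \<longlongrightarrow> 0) at_top"
    using trunc_tendsto[OF u] L2.N_diff_commute[OF trunc_L2[OF u] u] by simp
  then show "((\<lambda>R. L2.N lborel (fourier1 (trunc R u))) \<longlongrightarrow> L2.N lborel u) at_top"
    unfolding fourier1_trunc_L2(2)[OF u] by (rule L2.N_tendsto[OF trunc_L2[OF u] u])
qed simp

lemma trunc_linear: "trunc R (u + c *\<^sub>R v) = trunc R u + c *\<^sub>R trunc R v"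
  by (auto simp: trunc_def fun_eq_iff algebra_simps)

lemma fourier1_linear:
  assumes "integrable lborel u" "integrable lborel v"
  shows "fourier1 (u + c *\<^sub>R v) = fourier1 u + c *\<^sub>R fourier1 v"
proof
  fix \<xi>
  note i = fourier1_kernel_integrable[OF assms(1), of \<xi>] fourier1_kernel_integrable[OF assms(2), of \<xi>]
  have "cis (- (x \<bullet> \<xi>)) * complex_of_real ((u + c *\<^sub>R v) x) = cis (- (x \<bullet> \<xi>)) * complex_of_real (u x)
      + complex_of_real c * (cis (- (x \<bullet> \<xi>)) * complex_of_real (v x))" for x
    by (simp add: algebra_simps)
  then show "fourier1 (u + c *\<^sub>R v) \<xi> = (fourier1 u + c *\<^sub>R fourier1 v) \<xi>"
    using i by (simp add: fourier1_def scaleR_conv_of_real algebra_simps)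
qed

lemma fhat_linear:
  assumes u: "u \<in> L2 lborel" and v: "v \<in> L2 lborel"
  shows "AE \<xi> in lborel. fhat (u + c *\<^sub>R v) \<xi> = fhat u \<xi> + c *\<^sub>R fhat v \<xi>"
proof -
  have uv: "u + c *\<^sub>R v \<in> L2 lborel" using u v by simp
  note mem = fhat_L2[OF u] fhat_L2[OF v] fourier1_trunc_L2(1)[OF u] fourier1_trunc_L2(1)[OF v]
  have "is_fourier_L2 (u + c *\<^sub>R v) (fhat u + c *\<^sub>R fhat v)"
    unfolding is_fourier_L2_iff[OF uv]
  proof
    show "fhat u + c *\<^sub>R fhat v \<in> L2 lborel" using mem by simp
    show "((\<lambda>R. L2.N lborel (fhat u + c *\<^sub>R fhat v - fourier1 (trunc R (u + c *\<^sub>R v)))) \<longlongrightarrow> 0) at_top"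
    proof (rule Lim_null_comparison[OF always_eventually])
      show "((\<lambda>R. L2.N lborel (fhat u - fourier1 (trunc R u)) + \<bar>c\<bar> * L2.N lborel (fhat v - fourier1 (trunc R v))) \<longlongrightarrow> 0) at_top"
        by (intro tendsto_add_zero tendsto_mult_right_zero fhat_lim u v)
      show "\<forall>R. norm (L2.N lborel (fhat u + c *\<^sub>R fhat v - fourier1 (trunc R (u + c *\<^sub>R v))))
         \<le> L2.N lborel (fhat u - fourier1 (trunc R u)) + \<bar>c\<bar> * L2.N lborel (fhat v - fourier1 (trunc R v))"
      proof
        fix R
        have eq: "fhat u + c *\<^sub>R fhat v - fourier1 (trunc R (u + c *\<^sub>R v))
           = (fhat u - fourier1 (trunc R u)) + c *\<^sub>R (fhat v - fourier1 (trunc R v))"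
          unfolding trunc_linear fourier1_linear[OF trunc_integrable[OF u] trunc_integrable[OF v]]
          by (simp only: scaleR_diff_right) simp
        have a: "fhat u - fourier1 (trunc R u) \<in> L2 lborel" and b: "fhat v - fourier1 (trunc R v) \<in> L2 lborel"
          using mem by auto
        show "norm (L2.N lborel (fhat u + c *\<^sub>R fhat v - fourier1 (trunc R (u + c *\<^sub>R v))))
         \<le> L2.N lborel (fhat u - fourier1 (trunc R u)) + \<bar>c\<bar> * L2.N lborel (fhat v - fourier1 (trunc R v))"
          unfolding eq real_norm_def abs_of_nonneg[OF L2.N_nonneg[OF L2.E_add[OF a L2.E_scale[OF b]]]]
          using L2.N_triangle[OF a L2.E_scale[OF b, of c]] unfolding L2.N_scale[OF b] .
      qed
    qed
  qed
  from fhat_unique[OF uv this] show ?thesis by eventually_elim simp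
qed

section \<open>From Plancherel's theorem to the Nikolskii estimate\<close>

lemma cmod_cis_minus_one: "cmod (cis t - 1) = 2 * \<bar>sin (t / 2)\<bar>"
  using dist_exp_i_1[of t] by (simp add: cis_conv_exp)

text \<open>The left side is at most \<bar>t\<bar> and at most 2; for small and for large
  \<open>t\<close> respectively, the power with exponent between 0 and 1 dominates.\<close>

lemma cis_minus_one_le:
  assumes "0 < s" "s < 1" shows "cmod (cis t - 1) \<le> 2 * \<bar>t\<bar> powr s"
proof (cases "\<bar>t\<bar> \<le> 1")
  case True
  have "cmod (cis t - 1) \<le> \<bar>t\<bar>"
    using abs_sin_x_le_abs_x[of "t / 2"] by (simp add: cmod_cis_minus_one)
  also have "\<dots> \<le> \<bar>t\<bar> powr s"
    using True assms powr_mono'[of s 1 "\<bar>t\<bar>"] by (cases "t = 0") auto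
  finally show ?thesis by (smt (verit) powr_ge_zero)
next
  case False
  have "cmod (cis t - 1) \<le> 2" using norm_triangle_ineq4[of "cis t" 1] by simp
  moreover have "1 \<le> \<bar>t\<bar> powr s" using False assms by (intro ge_one_powr_ge_zero) auto
  ultimately show ?thesis by simp
qed

text \<open>Plancherel's theorem needs integrability, so the identity is first read off for
  truncations. Both sides then pass to the limit, since translation is an isometry and the
  multiplier is bounded by 2.\<close>

lemma translate_fhat:
  fixes u :: "'a::euclidean_space \<Rightarrow> real"
  assumes u: "u \<in> L2 lborel"
  shows "L2.N lborel (translate h u - u) = L2.N lborel (\<lambda>\<xi>. (cis (h \<bullet> \<xi>) - 1) * fhat u \<xi>)"
proof (rule tendsto_unique)
  let ?m = "\<lambda>g \<xi>. (cis (h \<bullet> \<xi>) - 1) * (g \<xi> :: complex)"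
  have m2: "cmod (cis (h \<bullet> \<xi>) - 1) \<le> 2" for \<xi> using norm_triangle_ineq4[of "cis (h \<bullet> \<xi>)" 1] by simp
  have mb: "norm (?m g \<xi>) \<le> 2 * norm (g \<xi>)" for g \<xi>
    unfolding norm_mult by (intro mult_right_mono m2) simp
  have mm: "?m g \<in> borel_measurable lborel" if "g \<in> L2 lborel" for g
    using L2_borel[OF that] by measurable
  have mL: "?m g \<in> L2 lborel" if "g \<in> L2 lborel" for g
    by (rule L2_bound[OF that mm[OF that], of 2]) (simp add: mb)
  have mN: "L2.N lborel (?m g) \<le> 2 * L2.N lborel g" if "g \<in> L2 lborel" for g
    by (rule L2_N_mono[OF that mm[OF that]]) (simp_all add: mb)
  let ?F = "\<lambda>R. fourier1 (trunc R u)"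
  have F: "?F R \<in> L2 lborel" for R by (rule fourier1_trunc_L2[OF u])
  have tr: "trunc R u \<in> L2 lborel" "integrable lborel (trunc R u)" for R
    by (simp_all add: trunc_L2[OF u] trunc_integrable[OF u])
  note sh = translate_L2[OF tr(1)] translate_L2[OF u]
  have key: "L2.N lborel (translate h (trunc R u) - trunc R u) = L2.N lborel (?m (?F R))" for R
  proof -
    have si: "integrable lborel (translate h (trunc R u))" using integrable_translate[OF tr(2)] by (simp add: translate_def)
    have "fourier1 (translate h (trunc R u) - trunc R u) = ?m (?F R)"
      unfolding fourier1_diff[OF si tr(2)] by (simp add: fun_eq_iff fourier1_translate[OF tr(2)] algebra_simps)
    moreover have "integrable lborel (translate h (trunc R u) - trunc R u)"
      using si tr(2) by (simp add: fun_diff_def)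
    ultimately show ?thesis using plancherel(2)[of "translate h (trunc R u) - trunc R u"] sh tr by simp
  qed
  show "((\<lambda>R. L2.N lborel (translate h (trunc R u) - trunc R u)) \<longlongrightarrow> L2.N lborel (?m (fhat u))) at_top"
    unfolding key
  proof (rule L2.N_tendsto[OF mL[OF F] mL[OF fhat_L2[OF u]]], rule Lim_null_comparison[OF always_eventually])
    show "((\<lambda>R. 2 * L2.N lborel (fhat u - ?F R)) \<longlongrightarrow> 0) at_top"
      by (intro tendsto_mult_right_zero fhat_lim u)
    show "\<forall>R. norm (L2.N lborel (?m (?F R) - ?m (fhat u))) \<le> 2 * L2.N lborel (fhat u - ?F R)"
    proof
      fix R
      have eq: "?m (?F R) - ?m (fhat u) = ?m (?F R - fhat u)" by (simp add: fun_eq_iff algebra_simps)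
      have d: "?F R - fhat u \<in> L2 lborel" using F fhat_L2[OF u] by simp
      show "norm (L2.N lborel (?m (?F R) - ?m (fhat u))) \<le> 2 * L2.N lborel (fhat u - ?F R)"
        unfolding eq using mN[OF d] mL[OF d] L2.N_diff_commute[OF F fhat_L2[OF u]] by simp
    qed
  qed
  show "((\<lambda>R. L2.N lborel (translate h (trunc R u) - trunc R u)) \<longlongrightarrow> L2.N lborel (translate h u - u)) at_top"
  proof (rule L2.N_tendsto)
    show "translate h (trunc R u) - trunc R u \<in> L2 lborel" for R using sh tr by simp
    show "translate h u - u \<in> L2 lborel" using sh u by simp
    show "((\<lambda>R. L2.N lborel (translate h (trunc R u) - trunc R u - (translate h u - u))) \<longlongrightarrow> 0) at_top"
    proof (rule Lim_null_comparison[OF always_eventually])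
      show "((\<lambda>R. L2.N lborel (u - trunc R u) + L2.N lborel (u - trunc R u)) \<longlongrightarrow> 0) at_top"
        by (intro tendsto_add_zero trunc_tendsto u)
      show "\<forall>R. norm (L2.N lborel (translate h (trunc R u) - trunc R u - (translate h u - u)))
          \<le> L2.N lborel (u - trunc R u) + L2.N lborel (u - trunc R u)"
      proof
        fix R
        have d: "u - trunc R u \<in> L2 lborel" using u tr by simp
        have eq: "translate h (trunc R u) - trunc R u - (translate h u - u) = (u - trunc R u) - translate h (u - trunc R u)"
          by (simp add: translate_diff)
        show "norm (L2.N lborel (translate h (trunc R u) - trunc R u - (translate h u - u)))
          \<le> L2.N lborel (u - trunc R u) + L2.N lborel (u - trunc R u)"
          unfolding eq using L2.N_triangle_diff[OF d translate_L2(1)[OF d, of h]] translate_L2[OF d, of h] d by simp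
      qed
    qed
  qed
qed simp

lemma translate_estimate:
  fixes u :: "'a::euclidean_space \<Rightarrow> real"
  assumes u: "u \<in> L2 lborel" and s: "0 < s" "s < 1"
    and w: "(\<lambda>\<xi>. (norm \<xi> powr s) *\<^sub>R fhat u \<xi>) \<in> L2 lborel"
  shows "L2.N lborel (translate h u - u) \<le> 2 * norm h powr s * L2.N lborel (\<lambda>\<xi>. (norm \<xi> powr s) *\<^sub>R fhat u \<xi>)"
  unfolding translate_fhat[OF u]
proof (rule L2_N_mono[OF w])
  show "(\<lambda>\<xi>. (cis (h \<bullet> \<xi>) - 1) * fhat u \<xi>) \<in> borel_measurable lborel"
    using L2_borel[OF fhat_L2[OF u]] by measurable
  show "AE \<xi> in lborel. norm ((cis (h \<bullet> \<xi>) - 1) * fhat u \<xi>) \<le> 2 * norm h powr s * norm ((norm \<xi> powr s) *\<^sub>R fhat u \<xi>)"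
  proof (rule AE_I2)
    fix \<xi>
    have "cmod (cis (h \<bullet> \<xi>) - 1) \<le> 2 * \<bar>h \<bullet> \<xi>\<bar> powr s" by (rule cis_minus_one_le[OF s])
    also have "\<dots> \<le> 2 * (norm h * norm \<xi>) powr s"
      using s by (intro mult_left_mono powr_mono2 Cauchy_Schwarz_ineq2) auto
    finally have "cmod (cis (h \<bullet> \<xi>) - 1) \<le> 2 * (norm h powr s * norm \<xi> powr s)" by (simp add: powr_mult)
    from mult_right_mono[OF this, of "norm (fhat u \<xi>)"]
    show "norm ((cis (h \<bullet> \<xi>) - 1) * fhat u \<xi>) \<le> 2 * norm h powr s * norm ((norm \<xi> powr s) *\<^sub>R fhat u \<xi>)"
      by (simp add: norm_mult mult_ac)
  qed
qed simp

section \<open>The energy space\<close>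

lemma ip_cong_AE:
  assumes "AE x in M. f x = f' x" "AE x in M. g x = g' x"
    "f \<in> borel_measurable M" "f' \<in> borel_measurable M" "g \<in> borel_measurable M" "g' \<in> borel_measurable M"
  shows "ip M f g = ip M f' g'"
  unfolding ip_def
proof (rule integral_cong_AE)
  show "AE x in M. f x \<bullet> g x = f' x \<bullet> g' x" using assms(1,2) by eventually_elim simp
qed (use assms in measurable)

locale fractional_space =
  fixes s :: real and V :: "'a::euclidean_space \<Rightarrow> real" and V0 :: real
  assumes s: "0 < s" "s < 1"
    and V_measurable [measurable]: "V \<in> borel_measurable borel"
    and V0: "0 < V0" "\<And>x. V0 \<le> V x"
begin

text \<open>\<open>freq\<close> carries half of the multiplier and \<open>pot\<close> the square
  root of the potential, so the form of the energy space is pulled back from two copies of L^2;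
  completeness and Cauchy-Schwarz are inherited from there.\<close>

definition freq :: "('a \<Rightarrow> real) \<Rightarrow> 'a \<Rightarrow> complex" where
  "freq u = (\<lambda>\<xi>. (norm \<xi> powr s) *\<^sub>R fhat u \<xi>)"

definition pot :: "('a \<Rightarrow> real) \<Rightarrow> 'a \<Rightarrow> real" where
  "pot u = (\<lambda>x. sqrt (V x) *\<^sub>R u x)"

definition Es :: "('a \<Rightarrow> real) set" where "Es = {u. in_Es V s u}"

definition BE :: "('a \<Rightarrow> real) \<Rightarrow> ('a \<Rightarrow> real) \<Rightarrow> real" where
  "BE u v = ip lborel (freq u) (freq v) + ip lborel (pot u) (pot v)"

lemma V_nonneg: "0 \<le> V x"
  using V0 less_imp_le order.trans by blast

lemma freq_measurable: "u \<in> L2 lborel \<Longrightarrow> freq u \<in> borel_measurable lborel"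
  using L2_borel[OF fhat_L2[of u]] unfolding freq_def by measurable

lemma powr_sq: "(x powr r)\<^sup>2 = x powr (2 * r)" for x r :: real
  by (simp add: power2_eq_square powr_add[symmetric])

text \<open>\<open>in_Es\<close> speaks of some transform of \<open>u\<close>. All transforms agree
  almost everywhere, so the weighted integral may be tested on \<open>fhat u\<close>.\<close>

lemma Es_iff: "u \<in> Es \<longleftrightarrow> u \<in> L2 lborel \<and> freq u \<in> L2 lborel \<and> pot u \<in> L2 lborel"
proof (cases "u \<in> L2 lborel")
  case u: True
  have [measurable]: "u \<in> borel_measurable borel" by (rule L2_borel[OF u])
  have nu: "(\<integral>\<^sup>+ x. ennreal ((u x)\<^sup>2) \<partial>lborel) < \<infinity>" using L2_nn[OF u] by simp
  have f: "(\<integral>\<^sup>+ \<xi>. ennreal (norm \<xi> powr (2 * s) * (cmod (g \<xi>))\<^sup>2) \<partial>lborel) < \<infinity> \<longleftrightarrow> freq u \<in> L2 lborel"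
    if "is_fourier_L2 u g" for g
  proof -
    have "(\<integral>\<^sup>+ \<xi>. ennreal (norm \<xi> powr (2 * s) * (cmod (g \<xi>))\<^sup>2) \<partial>lborel) = (\<integral>\<^sup>+ \<xi>. ennreal ((norm (freq u \<xi>))\<^sup>2) \<partial>lborel)"
      by (rule nn_integral_cong_AE)
        (use fhat_unique[OF u that] in eventually_elim, simp add: freq_def power_mult_distrib powr_sq)
    then show ?thesis using L2_iff_nn[OF freq_measurable[OF u]] by simp
  qed
  have v: "(\<integral>\<^sup>+ x. ennreal (V x * (u x)\<^sup>2) \<partial>lborel) < \<infinity> \<longleftrightarrow> pot u \<in> L2 lborel"
    by (subst L2_iff_nn) (simp_all add: pot_def power_mult_distrib V_nonneg)
  show ?thesis
    using u nu v f fhat_fourier[OF u] by (auto simp: Es_def in_Es_def)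
next
  case False
  then show ?thesis using L2_iff_nn[of u lborel] by (auto simp: Es_def in_Es_def)
qed

lemma Es_L2: "u \<in> Es \<Longrightarrow> u \<in> L2 lborel" and Es_freq: "u \<in> Es \<Longrightarrow> freq u \<in> L2 lborel"
  and Es_pot: "u \<in> Es \<Longrightarrow> pot u \<in> L2 lborel"
  by (auto simp: Es_iff)

lemma pot_linear: "pot (u + c *\<^sub>R v) = pot u + c *\<^sub>R pot v"
  by (auto simp: pot_def fun_eq_iff algebra_simps)

lemma freq_linear:
  assumes "u \<in> L2 lborel" "v \<in> L2 lborel"
  shows "AE \<xi> in lborel. freq (u + c *\<^sub>R v) \<xi> = (freq u + c *\<^sub>R freq v) \<xi>"
  using fhat_linear[OF assms, of c] by eventually_elim (simp add: freq_def algebra_simps)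

lemma Es_linear:
  assumes "u \<in> Es" "v \<in> Es" shows "u + c *\<^sub>R v \<in> Es"
proof -
  have uv: "u + c *\<^sub>R v \<in> L2 lborel" using assms Es_L2 by simp
  have "freq u + c *\<^sub>R freq v \<in> L2 lborel" using assms Es_freq by simp
  then have "freq (u + c *\<^sub>R v) \<in> L2 lborel"
  proof (rule L2_bound[of _ _ _ 1])
    show "AE x in lborel. norm (freq (u + c *\<^sub>R v) x) \<le> 1 * norm ((freq u + c *\<^sub>R freq v) x)"
      using freq_linear[OF Es_L2[OF assms(1)] Es_L2[OF assms(2)], of c] by eventually_elim simp
  qed (rule freq_measurable[OF uv])
  moreover have "pot (u + c *\<^sub>R v) \<in> L2 lborel" unfolding pot_linear using assms Es_pot by simp
  ultimately show ?thesis using uv by (simp add: Es_iff)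
qed

lemma BE_linear:
  assumes "u \<in> Es" "v \<in> Es" "w \<in> Es" shows "BE (u + c *\<^sub>R v) w = BE u w + c * BE v w"
proof -
  note m = Es_L2[OF assms(1)] Es_L2[OF assms(2)] Es_L2[OF assms(3)] Es_L2[OF Es_linear[OF assms(1,2), of c]]
  note W = Es_freq[OF assms(1)] Es_freq[OF assms(2)] Es_freq[OF assms(3)] Es_pot[OF assms(1)] Es_pot[OF assms(2)] Es_pot[OF assms(3)]
  have "ip lborel (freq (u + c *\<^sub>R v)) (freq w) = ip lborel (freq u + c *\<^sub>R freq v) (freq w)"
  proof (rule ip_cong_AE[OF freq_linear[OF m(1,2)]])
    show "freq u + c *\<^sub>R freq v \<in> borel_measurable lborel" using W by (intro L2_measurable[OF L2.E_add]) auto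
  qed (intro AE_I2 refl freq_measurable m)+
  then show ?thesis
    unfolding BE_def pot_linear using W by (simp add: L2.B_add L2.B_scale algebra_simps)
qed

sublocale E: semi_inner Es BE
proof
  have z: "0 \<in> Es"
  proof -
    have z: "(0 :: 'a \<Rightarrow> real) \<in> L2 lborel" by simp
    \<comment> \<open>\<open>fhat 0\<close> is a chosen representative, so its vanishing almost
      everywhere has to be derived from the isometry.\<close>
    have "AE \<xi> in lborel. fhat (0::'a\<Rightarrow>real) \<xi> = 0" 
      by (rule L2_N_zero_AE[OF fhat_L2[OF z]]) (simp add: fhat_N[OF z])
    then have "AE \<xi> in lborel. norm (freq 0 \<xi>) \<le> 0 * norm ((0 :: 'a \<Rightarrow> real) \<xi>)"
      by eventually_elim (simp add: freq_def)
    then have "freq 0 \<in> L2 lborel" by (rule L2_bound[OF z freq_measurable[OF z]])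
    moreover have "pot 0 = 0" by (auto simp: pot_def)
    ultimately show ?thesis using z by (simp add: Es_iff)
  qed
  show "subspace Es"
  proof (rule subspaceI)
    show "u + v \<in> Es" if "u \<in> Es" "v \<in> Es" for u v using Es_linear[OF that, of 1] by simp
    show "c *\<^sub>R u \<in> Es" if "u \<in> Es" for c u using Es_linear[OF z that, of c] by simp
  qed (rule z)
  show "BE u v = BE v u" if "u \<in> Es" "v \<in> Es" for u v
    using L2.B_sym[OF Es_freq[OF that(1)] Es_freq[OF that(2)]] L2.B_sym[OF Es_pot[OF that(1)] Es_pot[OF that(2)]] by (simp add: BE_def)
  show "BE (u + v) w = BE u w + BE v w" if "u \<in> Es" "v \<in> Es" "w \<in> Es" for u v w
    using BE_linear[OF that, of 1] by simp
  show "BE (r *\<^sub>R u) v = r * BE u v" if "u \<in> Es" "v \<in> Es" for r u v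
    \<comment> \<open>Here \<open>r *\<^sub>R u\<close> is read as \<open>0 + r *\<^sub>R u\<close>,
      and the second instance says that \<open>BE 0 v\<close> equals its own double.\<close>
    using BE_linear[OF z that(1) that(2), of r] BE_linear[OF z z that(2), of 1] by simp
  show "0 \<le> BE u u" if "u \<in> Es" for u
    using L2.B_nonneg[OF Es_freq[OF that]] L2.B_nonneg[OF Es_pot[OF that]] by (simp add: BE_def)
qed

lemma NE_sq: "u \<in> Es \<Longrightarrow> (E.N u)\<^sup>2 = (L2.N lborel (freq u))\<^sup>2 + (L2.N lborel (pot u))\<^sup>2"
  by (simp add: E.N_sq BE_def L2.N_sq Es_freq Es_pot)

lemma freq_le_NE: "u \<in> Es \<Longrightarrow> L2.N lborel (freq u) \<le> E.N u"
  and pot_le_NE: "u \<in> Es \<Longrightarrow> L2.N lborel (pot u) \<le> E.N u"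
  by (rule power2_le_imp_le; simp add: NE_sq)+

lemma L2_le_NE: assumes "u \<in> Es" shows "L2.N lborel u \<le> E.N u / sqrt V0"
proof -
  have "L2.N lborel u \<le> (1 / sqrt V0) * L2.N lborel (pot u)"
  proof (rule L2_N_mono[OF Es_pot[OF assms]])
    show "AE x in lborel. norm (u x) \<le> 1 / sqrt V0 * norm (pot u x)"
    proof (rule AE_I2)
      fix x
      have "sqrt V0 * norm (u x) \<le> sqrt (V x) * norm (u x)" using V0 by (intro mult_right_mono) auto
      then show "norm (u x) \<le> 1 / sqrt V0 * norm (pot u x)"
        using V0 V_nonneg by (simp add: pot_def field_simps abs_mult)
    qed
  qed (use V0 L2_measurable[OF Es_L2[OF assms]] in auto)
  also have "\<dots> \<le> (1 / sqrt V0) * E.N u" using pot_le_NE[OF assms] V0 by (intro mult_left_mono) auto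
  finally show ?thesis by simp
qed

lemma freq_diff_N:
  assumes "u \<in> Es" "v \<in> Es" shows "L2.N lborel (freq u - freq v) = L2.N lborel (freq (u - v))"
proof (rule L2_N_cong)
  show "AE x in lborel. norm ((freq u - freq v) x) = norm (freq (u - v) x)"
    using freq_linear[OF Es_L2[OF assms(1)] Es_L2[OF assms(2)], of "-1"] by eventually_elim simp
  show "freq u - freq v \<in> borel_measurable lborel"
    using assms by (intro L2_measurable L2.E_diff Es_freq)
  show "freq (u - v) \<in> borel_measurable lborel"
    using assms by (intro L2_measurable[OF Es_freq] E.E_diff)
qed

lemma pot_diff: "pot (u - v) = pot u - pot v"
  by (auto simp: pot_def fun_eq_iff algebra_simps)

lemma fhat_diff_N:
  assumes "u \<in> L2 lborel" "v \<in> L2 lborel" shows "L2.N lborel (fhat u - fhat v) = L2.N lborel (u - v)"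
proof -
  have "L2.N lborel (fhat u - fhat v) = L2.N lborel (fhat (u - v))"
  proof (rule L2_N_cong)
    show "AE x in lborel. norm ((fhat u - fhat v) x) = norm (fhat (u - v) x)"
      using fhat_linear[OF assms, of "-1"] by eventually_elim simp
    show "fhat u - fhat v \<in> borel_measurable lborel" using assms by (intro L2_measurable L2.E_diff fhat_L2)
    show "fhat (u - v) \<in> borel_measurable lborel" using assms by (intro L2_measurable[OF fhat_L2] L2.E_diff)
  qed
  also have "\<dots> = L2.N lborel (u - v)" using assms by (intro fhat_N) simp
  finally show ?thesis .
qed

text \<open>The positive lower bound of \<open>V\<close> gives a limit in L^2. The transforms
  converge too, by isometry, and \<open>L2_weighted_limit\<close> identifies the limits of
  \<open>freq\<close> and \<open>pot\<close>.\<close>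

lemma Es_complete:
  fixes X :: "nat \<Rightarrow> 'a \<Rightarrow> real"
  assumes X: "\<And>n. X n \<in> Es"
    and cauchy: "\<And>\<epsilon>. \<epsilon> > 0 \<Longrightarrow> \<exists>M. \<forall>m\<ge>M. \<forall>n\<ge>M. E.N (X m - X n) < \<epsilon>"
  shows "\<exists>l\<in>Es. (\<lambda>n. E.N (X n - l)) \<longlonglongrightarrow> 0"
proof -
  have D: "X m - X n \<in> Es" for m n using X by simp
  have "\<exists>l\<in>L2 lborel. (\<lambda>n. L2.N lborel (X n - l)) \<longlonglongrightarrow> 0"
  proof (rule L2_complete)
    fix \<epsilon> :: real assume "\<epsilon> > 0"
    then obtain M where M: "\<And>m n. m \<ge> M \<Longrightarrow> n \<ge> M \<Longrightarrow> E.N (X m - X n) < \<epsilon> * sqrt V0"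
      using cauchy[of "\<epsilon> * sqrt V0"] V0 by auto
    have "L2.N lborel (X m - X n) < \<epsilon>" if "m \<ge> M" "n \<ge> M" for m n
    proof -
      have "E.N (X m - X n) / sqrt V0 < \<epsilon>" using M[OF that] V0 by (simp add: divide_less_eq)
      then show ?thesis using L2_le_NE[OF D, of m n] by linarith
    qed
    then show "\<exists>K. \<forall>m\<ge>K. \<forall>n\<ge>K. L2.N lborel (X m - X n) < \<epsilon>" by blast
  qed (rule Es_L2[OF X])
  then obtain l where l: "l \<in> L2 lborel" "(\<lambda>n. L2.N lborel (X n - l)) \<longlonglongrightarrow> 0" by blast
  have c1: "\<exists>K. \<forall>m\<ge>K. \<forall>n\<ge>K. L2.N lborel (freq (X m) - freq (X n)) < \<epsilon>" if e: "\<epsilon> > 0" for \<epsilon>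
  proof -
    obtain M where M: "\<And>m n. m \<ge> M \<Longrightarrow> n \<ge> M \<Longrightarrow> E.N (X m - X n) < \<epsilon>" using cauchy[OF e] by auto
    have "L2.N lborel (freq (X m) - freq (X n)) < \<epsilon>" if "m \<ge> M" "n \<ge> M" for m n
      unfolding freq_diff_N[OF X X] using freq_le_NE[OF D, of m n] M[OF that] by simp
    then show ?thesis by blast
  qed
  have c2: "\<exists>K. \<forall>m\<ge>K. \<forall>n\<ge>K. L2.N lborel (pot (X m) - pot (X n)) < \<epsilon>" if e: "\<epsilon> > 0" for \<epsilon>
  proof -
    obtain M where M: "\<And>m n. m \<ge> M \<Longrightarrow> n \<ge> M \<Longrightarrow> E.N (X m - X n) < \<epsilon>" using cauchy[OF e] by auto
    have "L2.N lborel (pot (X m) - pot (X n)) < \<epsilon>" if "m \<ge> M" "n \<ge> M" for m n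
      unfolding pot_diff[symmetric] using pot_le_NE[OF D, of m n] M[OF that] by simp
    then show ?thesis by blast
  qed
  have fl: "(\<lambda>n. L2.N lborel (fhat (X n) - fhat l)) \<longlonglongrightarrow> 0"
    using l(2) by (simp only: fhat_diff_N[OF Es_L2[OF X] l(1)])
  note f = L2_weighted_limit[OF fhat_L2[OF Es_L2[OF X]] fhat_L2[OF l(1)] fl Es_freq[OF X, unfolded freq_def] _ c1[unfolded freq_def]]
  note v = L2_weighted_limit[OF Es_L2[OF X] l Es_pot[OF X, unfolded pot_def] _ c2[unfolded pot_def]]
  have lE: "l \<in> Es" unfolding Es_iff using l f(1) v(1) by (simp add: freq_def pot_def)
  have Dl: "X n - l \<in> Es" for n using X lE by simp
  have f2: "(\<lambda>n. L2.N lborel (freq (X n - l))) \<longlonglongrightarrow> 0"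
    unfolding freq_diff_N[OF X lE, symmetric] unfolding freq_def by (rule f(2)) simp
  have v2: "(\<lambda>n. L2.N lborel (pot (X n - l))) \<longlonglongrightarrow> 0"
    unfolding pot_diff unfolding pot_def by (rule v(2)) simp
  have "(\<lambda>n. (E.N (X n - l))\<^sup>2) \<longlonglongrightarrow> 0\<^sup>2 + 0\<^sup>2"
    unfolding NE_sq[OF Dl] by (intro tendsto_intros f2 v2)
  from tendsto_real_sqrt[OF this] have "(\<lambda>n. E.N (X n - l)) \<longlonglongrightarrow> 0" using Dl by simp
  then show ?thesis using lE by blast
qed

sublocale E: semi_hilbert Es BE
  by standard (rule Es_complete)

lemma Es_translate:
  assumes u: "u \<in> Es" shows "L2.N lborel (translate h u - u) \<le> 2 * E.N u * norm h powr s"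
proof -
  have "L2.N lborel (translate h u - u) \<le> 2 * norm h powr s * L2.N lborel (freq u)"
    unfolding freq_def by (rule translate_estimate[OF Es_L2[OF u] s Es_freq[OF u, unfolded freq_def]])
  also have "\<dots> \<le> 2 * norm h powr s * E.N u" by (intro mult_left_mono freq_le_NE u) simp
  finally show ?thesis by (simp add: mult_ac)
qed

end

section \<open>Dyadic averages\<close>

text \<open>The integer vector that labels the half-open dyadic cube of side 2^(-k) around
  \<open>x\<close>; two points share a cube exactly if their labels agree. The geometric corner is
  this label divided by 2^k.\<close>

definition corner :: "nat \<Rightarrow> 'a::euclidean_space \<Rightarrow> 'a" where
  "corner k x = (\<Sum>b\<in>Basis. real_of_int \<lfloor>2 ^ k * (x \<bullet> b)\<rfloor> *\<^sub>R b)"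

lemma corner_inner: "b \<in> Basis \<Longrightarrow> corner k x \<bullet> b = real_of_int \<lfloor>2 ^ k * (x \<bullet> b)\<rfloor>"
  by (simp add: corner_def inner_sum_left inner_Basis if_distrib sum.delta cong: if_cong)

lemma corner_eq_iff:
  "corner k x = corner k y \<longleftrightarrow> (\<forall>b\<in>Basis. \<lfloor>2 ^ k * (x \<bullet> b)\<rfloor> = \<lfloor>2 ^ k * (y \<bullet> b)\<rfloor>)"
  by (auto simp: euclidean_eq_iff[of "corner k x"] corner_inner)

lemma corner_measurable [measurable]: "corner k \<in> borel_measurable borel"
  unfolding corner_def by measurable

lemma corner_nested:
  fixes x y :: "'a::euclidean_space"
  assumes "corner (Suc k) x = corner (Suc k) y" shows "corner k x = corner k y"
proof -
  have "\<lfloor>t\<rfloor> = \<lfloor>2 * t\<rfloor> div 2" for t :: real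
    using floor_divide_real_eq_div[of 2 "2 * t"] by simp
  from this[of "2 ^ k * t" for t] have half: "\<lfloor>2 ^ k * t\<rfloor> = \<lfloor>2 ^ Suc k * t\<rfloor> div 2" for t :: real
    by (simp only: power_Suc mult.assoc)
  show ?thesis
    unfolding corner_eq_iff
  proof
    fix b :: 'a assume "b \<in> Basis"
    then have "\<lfloor>2 ^ Suc k * (x \<bullet> b)\<rfloor> = \<lfloor>2 ^ Suc k * (y \<bullet> b)\<rfloor>" using assms unfolding corner_eq_iff by blast
    then show "\<lfloor>2 ^ k * (x \<bullet> b)\<rfloor> = \<lfloor>2 ^ k * (y \<bullet> b)\<rfloor>" by (simp only: half[of "x \<bullet> b"] half[of "y \<bullet> b"])
  qed
qed

text \<open>The half-open cube lies between the open and the closed box with the same corners, and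
  these have equal measure.\<close>

lemma cube_emeasure:
  fixes x :: "'a::euclidean_space"
  shows "emeasure lborel {y. corner k x = corner k y} = ennreal ((1 / 2 ^ k) ^ DIM('a))"
proof (rule antisym)
  define a where "a = (1 / 2 ^ k) *\<^sub>R corner k x"
  define c where "c = a + (1 / 2 ^ k) *\<^sub>R (One :: 'a)"
  have ai: "a \<bullet> b = real_of_int \<lfloor>2 ^ k * (x \<bullet> b)\<rfloor> / 2 ^ k" if "b \<in> Basis" for b
    using that by (simp add: a_def corner_inner)
  have ci: "c \<bullet> b = (real_of_int \<lfloor>2 ^ k * (x \<bullet> b)\<rfloor> + 1) / 2 ^ k" if "b \<in> Basis" for b
    using that by (simp add: c_def inner_add_left ai add_divide_distrib)
  have le: "a \<bullet> b \<le> c \<bullet> b" if "b \<in> Basis" for b using that by (simp add: c_def inner_add_left)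
  have d: "(c - a) \<bullet> b = 1 / 2 ^ k" if "b \<in> Basis" for b using that by (simp add: c_def)
  have sub1: "{y. corner k x = corner k y} \<subseteq> cbox a c"
  proof (clarsimp simp: mem_box corner_eq_iff)
    fix y b :: 'a assume "b \<in> Basis" "\<forall>b\<in>Basis. \<lfloor>2 ^ k * (x \<bullet> b)\<rfloor> = \<lfloor>2 ^ k * (y \<bullet> b)\<rfloor>"
    then have "real_of_int \<lfloor>2 ^ k * (x \<bullet> b)\<rfloor> \<le> 2 ^ k * (y \<bullet> b)" "2 ^ k * (y \<bullet> b) \<le> real_of_int \<lfloor>2 ^ k * (x \<bullet> b)\<rfloor> + 1"
      by (auto simp: less_imp_le)
    then show "a \<bullet> b \<le> y \<bullet> b \<and> y \<bullet> b \<le> c \<bullet> b"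
      using \<open>b \<in> Basis\<close> by (simp add: ai ci field_simps)
  qed
  have sub2: "box a c \<subseteq> {y. corner k x = corner k y}"
  proof (clarsimp simp: mem_box corner_eq_iff)
    fix y b :: 'a assume b: "b \<in> Basis" and "\<forall>i\<in>Basis. a \<bullet> i < y \<bullet> i \<and> y \<bullet> i < c \<bullet> i"
    then have "a \<bullet> b < y \<bullet> b" "y \<bullet> b < c \<bullet> b" by auto
    then have "real_of_int \<lfloor>2 ^ k * (x \<bullet> b)\<rfloor> \<le> 2 ^ k * (y \<bullet> b)" "2 ^ k * (y \<bullet> b) < real_of_int \<lfloor>2 ^ k * (x \<bullet> b)\<rfloor> + 1"
      using b by (auto simp: ai ci field_simps)
    then have "\<lfloor>2 ^ k * (y \<bullet> b)\<rfloor> = \<lfloor>2 ^ k * (x \<bullet> b)\<rfloor>" by (simp add: floor_eq_iff)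
    then show "\<lfloor>2 ^ k * (x \<bullet> b)\<rfloor> = \<lfloor>2 ^ k * (y \<bullet> b)\<rfloor>" by simp
  qed
  have [measurable]: "{y. corner k x = corner k y} \<in> sets borel" by measurable
  have "emeasure lborel {y. corner k x = corner k y} \<le> emeasure lborel (cbox a c)"
    by (rule emeasure_mono[OF sub1]) simp
  also have "\<dots> = ennreal ((1 / 2 ^ k) ^ DIM('a))"
    using le d by (subst emeasure_lborel_cbox) simp_all
  finally show "emeasure lborel {y. corner k x = corner k y} \<le> ennreal ((1 / 2 ^ k) ^ DIM('a))" .
  have "ennreal ((1 / 2 ^ k) ^ DIM('a)) = emeasure lborel (box a c)"
    using le d by (subst emeasure_lborel_box) simp_all
  also have "\<dots> \<le> emeasure lborel {y. corner k x = corner k y}"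
    by (rule emeasure_mono[OF sub2]) simp
  finally show "ennreal ((1 / 2 ^ k) ^ DIM('a)) \<le> emeasure lborel {y. corner k x = corner k y}" .
qed

text \<open>The factor is the reciprocal volume of a cube. Hence \<open>cavg\<close> is the
  conditional expectation on the cubes of level \<open>k\<close>, written as an integral operator
  for the sake of Fubini's theorem.\<close>

definition cker :: "nat \<Rightarrow> 'a::euclidean_space \<Rightarrow> 'a \<Rightarrow> real" where
  "cker k x y = 2 ^ (k * DIM('a)) * indicator {y. corner k x = corner k y} y"

definition cavg :: "nat \<Rightarrow> ('a::euclidean_space \<Rightarrow> real) \<Rightarrow> 'a \<Rightarrow> real" where
  "cavg k u x = (\<integral>y. cker k x y * u y \<partial>lborel)"

lemma cker_nonneg: "0 \<le> cker k x y" and cker_le: "cker k x y \<le> 2 ^ (k * DIM('a))"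
  for x :: "'a::euclidean_space"
  by (auto simp: cker_def indicator_def)

lemma cker_pair_measurable [measurable]:
  "(\<lambda>(x, y). cker k x y) \<in> borel_measurable (borel \<Otimes>\<^sub>M borel)"
proof -
  have "(\<lambda>z::'a\<times>'a. cker k (fst z) (snd z)) = (\<lambda>z. 2 ^ (k * DIM('a)) * indicator {z. corner k (fst z) = corner k (snd z)} z)"
    by (auto simp: cker_def indicator_def fun_eq_iff)
  moreover have "{z::'a\<times>'a. corner k (fst z) = corner k (snd z)} \<in> sets (borel \<Otimes>\<^sub>M borel)"
  proof -
    have "{z \<in> space (borel \<Otimes>\<^sub>M borel). corner k (fst z) = corner k (snd z)} \<in> sets (borel \<Otimes>\<^sub>M (borel :: 'a measure))"
      by measurable
    then show ?thesis by (simp add: space_pair_measure)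
  qed
  ultimately show ?thesis by (simp add: case_prod_beta')
qed

lemma cker_measurable [measurable]: "cker k x \<in> borel_measurable borel"
  using measurable_compose_Pair1[OF _ cker_pair_measurable, of x k] by simp

lemma cker_integral: "integrable lborel (cker k x)" "(\<integral>y. cker k x y \<partial>lborel) = 1"
  for x :: "'a::euclidean_space"
proof -
  have [measurable]: "{y. corner k x = corner k y} \<in> sets borel" by measurable
  have p: "2 ^ (k * DIM('a)) * (1 / 2 ^ k) ^ DIM('a) = (1::real)"
    by (simp add: power_mult power_divide)
  show "integrable lborel (cker k x)"
    unfolding cker_def[abs_def] by (intro integrable_mult_right) (simp add: cube_emeasure)
  show "(\<integral>y. cker k x y \<partial>lborel) = 1"
    unfolding cker_def using p by (simp add: measure_def cube_emeasure)
qed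

lemma cker_L2_integrable:
  assumes u: "u \<in> L2 lborel"
  shows "integrable lborel (\<lambda>y. cker k x y * (u y)\<^sup>2)" "integrable lborel (\<lambda>y. cker k x y * u y)"
proof -
  have [measurable]: "u \<in> borel_measurable borel" by (rule L2_borel[OF u])
  show 1: "integrable lborel (\<lambda>y. cker k x y * (u y)\<^sup>2)"
  proof (rule Bochner_Integration.integrable_bound)
    show "integrable lborel (\<lambda>y. 2 ^ (k * DIM('a)) * (norm (u y))\<^sup>2)" using L2_integrable[OF u] by simp
    show "AE y in lborel. norm (cker k x y * (u y)\<^sup>2) \<le> norm (2 ^ (k * DIM('a)) * (norm (u y))\<^sup>2)"
      using cker_nonneg[of k x] cker_le[of k x] by (auto simp: abs_mult intro!: mult_right_mono)
  qed measurable
  show "integrable lborel (\<lambda>y. cker k x y * u y)"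
  proof (rule Bochner_Integration.integrable_bound)
    show "integrable lborel (\<lambda>y. cker k x y + cker k x y * (u y)\<^sup>2)"
      by (intro Bochner_Integration.integrable_add cker_integral(1) 1)
    have "\<bar>u y\<bar> \<le> 1 + (u y)\<^sup>2" for y using sum_squares_bound[of 1 "\<bar>u y\<bar>"] by (simp add: power2_eq_square)
    then have "cker k x y * \<bar>u y\<bar> \<le> cker k x y * (1 + (u y)\<^sup>2)" for y by (intro mult_left_mono cker_nonneg)
    then show "AE y in lborel. norm (cker k x y * u y) \<le> norm (cker k x y + cker k x y * (u y)\<^sup>2)"
      using cker_nonneg[of k x] by (simp add: abs_mult algebra_simps)
  qed measurable
qed

lemma cker_diff_integrable:
  assumes u: "u \<in> L2 lborel"
  shows "integrable lborel (\<lambda>y. cker k x y * (u y - a)\<^sup>2)"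
proof -
  have "integrable lborel (\<lambda>y. cker k x y * (u y)\<^sup>2 - 2 * a * (cker k x y * u y) + a\<^sup>2 * cker k x y)"
    using cker_L2_integrable[OF u, of k x] cker_integral(1)[of k x]
    by (intro Bochner_Integration.integrable_add Bochner_Integration.integrable_diff integrable_mult_right)
  then show ?thesis by (simp add: power2_diff algebra_simps)
qed

text \<open>Expanding the square shows that the right side is the variance of \<open>u\<close> on
  the cube plus the left side.\<close>

lemma cavg_jensen:
  assumes u: "u \<in> L2 lborel"
  shows "(cavg k u x - a)\<^sup>2 \<le> (\<integral>y. cker k x y * (u y - a)\<^sup>2 \<partial>lborel)"
proof -
  define m where "m = cavg k u x"
  note i = cker_L2_integrable[OF u, of k x] cker_integral(1)[of k x]
  have ex: "(\<integral>y. cker k x y * (u y - c)\<^sup>2 \<partial>lborel) = (\<integral>y. cker k x y * (u y)\<^sup>2 \<partial>lborel) - 2 * c * m + c\<^sup>2" for c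
  proof -
    have "(\<integral>y. cker k x y * (u y - c)\<^sup>2 \<partial>lborel)
      = (\<integral>y. cker k x y * (u y)\<^sup>2 - 2 * c * (cker k x y * u y) + c\<^sup>2 * cker k x y \<partial>lborel)"
      by (rule Bochner_Integration.integral_cong) (auto simp: power2_diff algebra_simps)
    also have "\<dots> = (\<integral>y. cker k x y * (u y)\<^sup>2 \<partial>lborel) - 2 * c * m + c\<^sup>2 * 1"
      using i by (simp add: m_def cavg_def cker_integral(2))
    finally show ?thesis by simp
  qed
  have "0 \<le> (\<integral>y. cker k x y * (u y - m)\<^sup>2 \<partial>lborel)"
    by (intro integral_nonneg_AE AE_I2 mult_nonneg_nonneg cker_nonneg) simp
  then show ?thesis unfolding ex m_def[symmetric] by (simp add: power2_eq_square algebra_simps)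
qed

text \<open>Jensen's inequality about 0, together with the bound of the kernel by the reciprocal
  volume of a cube.\<close>

lemma cavg_bound:
  fixes u :: "'a::euclidean_space \<Rightarrow> real"
  assumes u: "u \<in> L2 lborel"
  shows "\<bar>cavg k u x\<bar> \<le> 2 powr (k * DIM('a) / 2) * L2.N lborel u"
proof -
  have "(cavg k u x)\<^sup>2 \<le> (\<integral>y. cker k x y * (u y)\<^sup>2 \<partial>lborel)" using cavg_jensen[OF u, of k x 0] by simp
  also have "\<dots> \<le> (\<integral>y. 2 ^ (k * DIM('a)) * (norm (u y))\<^sup>2 \<partial>lborel)"
    using cker_L2_integrable(1)[OF u] L2_integrable[OF u] cker_le[of k x]
    by (intro integral_mono) (auto intro!: mult_right_mono)
  also have "\<dots> = (2 powr (k * DIM('a) / 2) * L2.N lborel u)\<^sup>2"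
    using powr_realpow[of 2 "k * DIM('a)"]
    by (simp add: power_mult_distrib L2_N_sq[OF u] power2_eq_square[of "_ powr _"] powr_add[symmetric])
  finally show ?thesis
    using u by - (rule power2_le_imp_le, simp_all)
qed

lemma cavg_measurable [measurable]:
  assumes [measurable]: "u \<in> borel_measurable borel"
  shows "cavg k u \<in> borel_measurable borel"
proof -
  have "(\<lambda>(x, y). cker k x y * u y) \<in> borel_measurable (borel \<Otimes>\<^sub>M lborel)" by measurable
  then show ?thesis unfolding cavg_def[abs_def] by measurable
qed

text \<open>The ball of radius \<open>G\<close> in the Nikolskii class of order \<open>s\<close>
  over L^2. Compactness and the Sobolev inequality use nothing else about the energy space, apart
  from tightness.\<close>

definition L2_hoelder :: "real \<Rightarrow> real \<Rightarrow> ('a::euclidean_space \<Rightarrow> real) \<Rightarrow> bool" where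
  "L2_hoelder s G u \<longleftrightarrow> u \<in> L2 lborel \<and> 0 \<le> G \<and> L2.N lborel u \<le> G \<and>
     (\<forall>h. L2.N lborel (translate h u - u) \<le> G * norm h powr s)"

text \<open>By Jensen's inequality the squared error at \<open>x\<close> is at most the mean over
  the cube of \<open>(u y - u x)^2\<close>. Enlarging the cube to \<open>x + Q\<close> with a fixed
  \<open>Q\<close> makes the domain translation invariant, so Fubini's theorem turns the bound into
  translation differences with shifts in \<open>Q\<close>.\<close>

lemma cavg_approx:
  fixes u :: "'a::euclidean_space \<Rightarrow> real"
  assumes H: "L2_hoelder s G u" and s: "0 < s"
  shows "u - cavg k u \<in> L2 lborel"
    and "L2.N lborel (u - cavg k u) \<le> 2 powr (DIM('a) / 2) * DIM('a) powr s * G * 2 powr (- (k * s))"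
proof -
  have u: "u \<in> L2 lborel" and G: "0 \<le> G" and h: "\<And>h. L2.N lborel (translate h u - u) \<le> G * norm h powr s"
    using H by (auto simp: L2_hoelder_def)
  have [measurable]: "u \<in> borel_measurable borel" by (rule L2_borel[OF u])
  let ?K = "2 ^ (k * DIM('a)) :: real"
  let ?r = "1 / 2 ^ k :: real"
  \<comment> \<open>Two points of one cube differ by an element of \<open>Q\<close>. Its volume is
    2^N times that of a cube, with N the dimension, which costs the factor 2^(N/2); its elements
    have norm at most N 2^(-k), which costs N^s.\<close>
  define Q where "Q = cbox (- (?r *\<^sub>R One)) (?r *\<^sub>R One :: 'a)"
  have [measurable]: "Q \<in> sets borel" by (simp add: Q_def)
  have Qm: "emeasure lborel Q = ennreal ((2 * ?r) ^ DIM('a))"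
  proof -
    have "emeasure lborel Q = ennreal (\<Prod>b\<in>Basis. (?r *\<^sub>R One - - (?r *\<^sub>R One)) \<bullet> (b::'a))"
      unfolding Q_def by (rule emeasure_lborel_cbox) simp
    also have "(\<Prod>b\<in>Basis. (?r *\<^sub>R One - - (?r *\<^sub>R One)) \<bullet> (b::'a)) = (\<Prod>b\<in>(Basis::'a set). 2 * ?r)"
      by (intro prod.cong refl) (simp add: inner_add_left)
    finally show ?thesis by simp
  qed
  have Qn: "norm h \<le> DIM('a) * ?r" if "h \<in> Q" for h
  proof -
    have "\<bar>h \<bullet> b\<bar> \<le> ?r" if "b \<in> Basis" for b
      using \<open>h \<in> Q\<close> that by (auto simp: Q_def mem_box abs_le_iff inner_minus_left)
    then have "(\<Sum>b\<in>Basis. \<bar>h \<bullet> b\<bar>) \<le> (\<Sum>b\<in>(Basis::'a set). ?r)" by (intro sum_mono)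
    then show ?thesis using norm_le_l1[of h] by simp
  qed
  have kerQ: "cker k x y \<le> ?K * indicator Q (y - x)" for x y :: 'a
  proof (cases "corner k x = corner k y")
    case True
    have "y - x \<in> Q"
      unfolding Q_def mem_box
    proof (intro ballI)
      fix b :: 'a assume b: "b \<in> Basis"
      then have "\<lfloor>2 ^ k * (x \<bullet> b)\<rfloor> = \<lfloor>2 ^ k * (y \<bullet> b)\<rfloor>" using True by (auto simp: corner_eq_iff)
      then have "\<bar>2 ^ k * (y \<bullet> b) - 2 ^ k * (x \<bullet> b)\<bar> \<le> 1" by linarith
      then have "\<bar>2 ^ k * ((y - x) \<bullet> b)\<bar> \<le> 1" by (simp add: inner_diff_left right_diff_distrib)
      then have "\<bar>(y - x) \<bullet> b\<bar> \<le> ?r" by (simp add: abs_mult field_simps)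
      then show "- (?r *\<^sub>R One) \<bullet> b \<le> (y - x) \<bullet> b \<and> (y - x) \<bullet> b \<le> (?r *\<^sub>R One) \<bullet> b"
        using b by (simp add: abs_le_iff inner_minus_left)
    qed
    then show ?thesis by (simp add: cker_def indicator_def)
  qed (simp add: cker_def)
  define C where "C = G * (DIM('a) * ?r) powr s"
  have C: "C \<ge> 0" using G by (simp add: C_def)
  have "(\<integral>\<^sup>+x. ennreal ((norm ((u - cavg k u) x))\<^sup>2) \<partial>lborel) \<le> (\<integral>\<^sup>+x. (\<integral>\<^sup>+y. ennreal (?K * indicator Q (y - x) * (u y - u x)\<^sup>2) \<partial>lborel) \<partial>lborel)"
  proof (rule nn_integral_mono)
    fix x :: 'a
    have "ennreal ((norm ((u - cavg k u) x))\<^sup>2) \<le> ennreal (\<integral>y. cker k x y * (u y - u x)\<^sup>2 \<partial>lborel)"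
      using cavg_jensen[OF u, of k x "u x"] by (intro ennreal_leI) (simp add: power2_commute)
    also have "\<dots> = (\<integral>\<^sup>+y. ennreal (cker k x y * (u y - u x)\<^sup>2) \<partial>lborel)"
      by (rule nn_integral_eq_integral[symmetric, OF cker_diff_integrable[OF u]]) (simp add: cker_nonneg)
    also have "\<dots> \<le> (\<integral>\<^sup>+y. ennreal (?K * indicator Q (y - x) * (u y - u x)\<^sup>2) \<partial>lborel)"
      by (intro nn_integral_mono ennreal_leI mult_right_mono kerQ) simp
    finally show "ennreal ((norm ((u - cavg k u) x))\<^sup>2) \<le> (\<integral>\<^sup>+y. ennreal (?K * indicator Q (y - x) * (u y - u x)\<^sup>2) \<partial>lborel)" .
  qed
  also have "\<dots> = (\<integral>\<^sup>+x. (\<integral>\<^sup>+h. ennreal (?K * indicator Q h * (u (x + h) - u x)\<^sup>2) \<partial>lborel) \<partial>lborel)"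
  proof (rule nn_integral_cong)
    fix x :: 'a
    have "(\<integral>\<^sup>+h. ennreal (?K * indicator Q (h + x - x) * (u (h + x) - u x)\<^sup>2) \<partial>lborel)
       = (\<integral>\<^sup>+y. ennreal (?K * indicator Q (y - x) * (u y - u x)\<^sup>2) \<partial>lborel)"
      by (rule nn_integral_translate[of "\<lambda>y. ennreal (?K * indicator Q (y - x) * (u y - u x)\<^sup>2)"]) measurable
    then show "(\<integral>\<^sup>+y. ennreal (?K * indicator Q (y - x) * (u y - u x)\<^sup>2) \<partial>lborel)
      = (\<integral>\<^sup>+h. ennreal (?K * indicator Q h * (u (x + h) - u x)\<^sup>2) \<partial>lborel)"
      by (simp add: add.commute)
  qed
  also have "\<dots> = (\<integral>\<^sup>+h. (\<integral>\<^sup>+x. ennreal (?K * indicator Q h * (u (x + h) - u x)\<^sup>2) \<partial>lborel) \<partial>lborel)"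
    by (rule lborel_pair.Fubini'[symmetric]) measurable
  also have "\<dots> \<le> (\<integral>\<^sup>+h. ennreal (?K * C\<^sup>2) * indicator Q h \<partial>(lborel :: 'a measure))"
  proof (rule nn_integral_mono)
    fix h :: 'a
    note d = L2.E_diff[OF translate_L2(1)[OF u, of h] u]
    have "(\<integral>\<^sup>+x. ennreal (?K * indicator Q h * (u (x + h) - u x)\<^sup>2) \<partial>lborel)
      = ennreal (?K * indicator Q h) * (\<integral>\<^sup>+x. ennreal ((norm ((translate h u - u) x))\<^sup>2) \<partial>lborel)"
      by (subst nn_integral_cmult[symmetric]) (auto simp: translate_def ennreal_mult fun_diff_def)
    also have "\<dots> = ennreal (?K * indicator Q h) * ennreal ((L2.N lborel (translate h u - u))\<^sup>2)"
      by (simp only: L2_nn[OF d])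
    also have "\<dots> \<le> ennreal (?K * C\<^sup>2) * indicator Q h"
    proof (cases "h \<in> Q")
      case True
      have "L2.N lborel (translate h u - u) \<le> C"
        using h[of h] Qn[OF True] G s unfolding C_def
        by (elim order.trans) (intro mult_left_mono powr_mono2, auto)
      then have "(L2.N lborel (translate h u - u))\<^sup>2 \<le> C\<^sup>2" using d by (intro power_mono) auto
      then show ?thesis using True by (simp add: ennreal_mult[symmetric] ennreal_leI)
    qed simp
    finally show "(\<integral>\<^sup>+x. ennreal (?K * indicator Q h * (u (x + h) - u x)\<^sup>2) \<partial>lborel) \<le> ennreal (?K * C\<^sup>2) * indicator Q h" .
  qed
  also have "\<dots> = ennreal (?K * C\<^sup>2) * ennreal ((2 * ?r) ^ DIM('a))"
    by (simp add: nn_integral_cmult_indicator Qm)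
  also have "\<dots> = ennreal (?K * C\<^sup>2 * (2 * ?r) ^ DIM('a))"
    by (simp add: ennreal_mult)
  also have "?K * C\<^sup>2 * (2 * ?r) ^ DIM('a) = (2 powr (DIM('a) / 2) * C)\<^sup>2"
  proof -
    have "?K * (2 * ?r) ^ DIM('a) = 2 ^ DIM('a)"
    proof -
      have "?K * (2 * ?r) ^ DIM('a) = (2 ^ k * (2 * ?r)) ^ DIM('a)" by (simp only: power_mult power_mult_distrib)
      also have "2 ^ k * (2 * ?r) = 2" by simp
      finally show ?thesis .
    qed
    moreover have "(2 powr (DIM('a) / 2))\<^sup>2 = (2::real) ^ DIM('a)"
      by (simp add: power2_eq_square powr_add[symmetric] powr_realpow)
    ultimately show ?thesis by (simp only: power_mult_distrib mult_ac)
  qed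
  finally have le: "(\<integral>\<^sup>+x. ennreal ((norm ((u - cavg k u) x))\<^sup>2) \<partial>lborel) \<le> ennreal ((2 powr (DIM('a) / 2) * C)\<^sup>2)" .
  have m: "u - cavg k u \<in> borel_measurable lborel" by (simp add: fun_diff_def)
  note R = L2_nn_le[of "u - cavg k u", OF m le]
  show "u - cavg k u \<in> L2 lborel" using R(1) C by simp
  have "C = DIM('a) powr s * G * 2 powr (- (k * s))"
  proof -
    have "?r = 2 powr (- real k)" by (simp add: powr_minus powr_realpow divide_inverse)
    then show ?thesis by (simp add: C_def powr_mult powr_powr)
  qed
  then show "L2.N lborel (u - cavg k u) \<le> 2 powr (DIM('a) / 2) * DIM('a) powr s * G * 2 powr (- (k * s))"
    using R(2) C by (simp add: mult.assoc)
qed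

lemma cavg_cong_corner: "corner k x = corner k y \<Longrightarrow> cavg k u x = cavg k u y"
  by (simp add: cavg_def cker_def)

text \<open>The difference of two successive averages is constant on the finer cubes because the
  cubes are nested. So it equals its own average, and \<open>cavg_bound\<close> applies: a Bernstein
  inequality.\<close>

lemma cavg_increment:
  fixes u :: "'a::euclidean_space \<Rightarrow> real"
  assumes "cavg (Suc k) u - cavg k u \<in> L2 lborel"
  shows "\<bar>cavg (Suc k) u x - cavg k u x\<bar> \<le> 2 powr (Suc k * DIM('a) / 2) * L2.N lborel (cavg (Suc k) u - cavg k u)"
proof -
  let ?v = "cavg (Suc k) u - cavg k u"
  have "cker (Suc k) x y * ?v y = cker (Suc k) x y * ?v x" for y
  proof (cases "corner (Suc k) x = corner (Suc k) y")
    case True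
    then show ?thesis using cavg_cong_corner[OF True, of u] cavg_cong_corner[OF corner_nested[OF True], of u] by simp
  qed (simp add: cker_def)
  then have "cavg (Suc k) ?v x = (\<integral>y. cker (Suc k) x y * ?v x \<partial>lborel)" unfolding cavg_def[of _ ?v] by presburger
  also have "\<dots> = ?v x" using cker_integral[of "Suc k" x] by simp
  finally show ?thesis using cavg_bound[OF assms, of "Suc k" x] by simp
qed

text \<open>The increment from level \<open>k\<close> to \<open>k + 1\<close> has L^2 norm of order
  2^(-ks) and hence sup norm of order 2^(k \<beta>), where \<beta> is positive. The increments form
  a growing geometric series, which its last term dominates.\<close>

lemma cavg_sup:
  fixes s :: real
  assumes s: "0 < s" "2 * s < DIM('a::euclidean_space)"
  shows "\<exists>A>0. \<forall>(u::'a\<Rightarrow>real) G k x. L2_hoelder s G u \<longrightarrow> \<bar>cavg k u x\<bar> \<le> A * G * 2 powr (k * (DIM('a) / 2 - s))"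
proof -
  define \<beta> where "\<beta> = DIM('a) / 2 - s"
  define c where "c = 2 powr (DIM('a) / 2) * DIM('a) powr s"
  define D where "D = c * (1 + 2 powr s)"
  \<comment> \<open>\<open>A\<close> absorbs one step of the induction,
    \<open>A * 2 powr (- \<beta>) + D \<le> A\<close>, and is at least 1 for its start.
    \<open>D\<close> collects the errors of two neighbouring levels.\<close>
  define A where "A = max 1 (D / (1 - 2 powr (- \<beta>)))"
  have \<beta>: "\<beta> > 0" using s by (simp add: \<beta>_def)
  have lt: "2 powr (- \<beta>) < 1" using \<beta> by (simp add: powr_less_one)
  have DA: "A * 2 powr (- \<beta>) + D \<le> A"
  proof -
    have "D / (1 - 2 powr (- \<beta>)) \<le> A" by (simp add: A_def)
    then show ?thesis using lt by (simp add: divide_le_eq algebra_simps)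
  qed
  have "\<bar>cavg k u x\<bar> \<le> A * G * 2 powr (k * \<beta>)" if H: "L2_hoelder s G u" for u :: "'a \<Rightarrow> real" and G k x
  proof (induction k)
    case 0
    have "\<bar>cavg 0 u x\<bar> \<le> L2.N lborel u" using cavg_bound[of u 0 x] H by (simp add: L2_hoelder_def)
    also have "\<dots> \<le> 1 * G" using H by (simp add: L2_hoelder_def)
    also have "\<dots> \<le> A * G" using H by (intro mult_right_mono) (auto simp: A_def L2_hoelder_def)
    finally show ?case by simp
  next
    case (Suc k)
    have G: "G \<ge> 0" using H by (simp add: L2_hoelder_def)
    note a0 = cavg_approx[OF H s(1), of k] and a1 = cavg_approx[OF H s(1), of "Suc k"]
    have eq: "cavg (Suc k) u - cavg k u = (u - cavg k u) - (u - cavg (Suc k) u)" by simp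
    have L: "cavg (Suc k) u - cavg k u \<in> L2 lborel" unfolding eq using a0(1) a1(1) by (rule L2.E_diff)
    have "L2.N lborel (cavg (Suc k) u - cavg k u) \<le> L2.N lborel (u - cavg k u) + L2.N lborel (u - cavg (Suc k) u)"
      unfolding eq by (rule L2.N_triangle_diff[OF a0(1) a1(1)])
    also have "\<dots> \<le> c * G * 2 powr (- (k * s)) + c * G * 2 powr (- (Suc k * s))"
      using a0(2) a1(2) by (simp add: c_def)
    also have "\<dots> = D * G * 2 powr (- (Suc k * s))"
    proof -
      have "(2::real) powr (- (k * s)) = 2 powr s * 2 powr (- (Suc k * s))"
        by (simp add: powr_add[symmetric] algebra_simps)
      then show ?thesis by (simp add: D_def algebra_simps)
    qed
    finally have N: "L2.N lborel (cavg (Suc k) u - cavg k u) \<le> D * G * 2 powr (- (Suc k * s))" .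
    have "\<bar>cavg (Suc k) u x - cavg k u x\<bar> \<le> 2 powr (Suc k * DIM('a) / 2) * L2.N lborel (cavg (Suc k) u - cavg k u)"
      by (rule cavg_increment[OF L])
    also have "\<dots> \<le> 2 powr (Suc k * DIM('a) / 2) * (D * G * 2 powr (- (Suc k * s)))"
      by (intro mult_left_mono N) simp
    also have "\<dots> = D * G * (2 powr (Suc k * DIM('a) / 2) * 2 powr (- (Suc k * s)))" by simp
    also have "2 powr (Suc k * DIM('a) / 2) * 2 powr (- (Suc k * s)) = 2 powr (Suc k * \<beta>)"
      by (simp only: powr_add[symmetric]) (simp add: \<beta>_def algebra_simps)
    finally have "\<bar>cavg (Suc k) u x\<bar> \<le> A * G * 2 powr (k * \<beta>) + D * G * 2 powr (Suc k * \<beta>)"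
      using Suc.IH by linarith
    also have "(2::real) powr (k * \<beta>) = 2 powr (- \<beta>) * 2 powr (Suc k * \<beta>)"
      by (simp add: powr_add[symmetric] algebra_simps)
    also have "A * G * (2 powr (- \<beta>) * 2 powr (Suc k * \<beta>)) + D * G * 2 powr (Suc k * \<beta>)
       = (A * 2 powr (- \<beta>) + D) * (G * 2 powr (Suc k * \<beta>))" by (simp add: algebra_simps)
    also have "\<dots> \<le> A * (G * 2 powr (Suc k * \<beta>))" using DA G by (intro mult_right_mono) auto
    finally show ?case by (simp add: mult.assoc)
  qed
  moreover have "A > 0" by (simp add: A_def)
  ultimately show ?thesis unfolding \<beta>_def by blast
qed

section \<open>Compactness and the subcritical Sobolev inequality\<close>

lemma diagonal_convergent:
  fixes a :: "nat \<Rightarrow> nat \<Rightarrow> real"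
  assumes bdd: "\<And>j. bounded (range (a j))"
  shows "\<exists>r::nat\<Rightarrow>nat. strict_mono r \<and> (\<forall>j. convergent (\<lambda>n. a j (r n)))"
proof -
  let ?P = "\<lambda>j s. convergent (\<lambda>n. a j (s n))"
  interpret d: subseqs ?P
  proof
    fix j :: nat and s :: "nat \<Rightarrow> nat" assume "strict_mono s"
    have "bounded (range (\<lambda>n. a j (s n)))" by (rule bounded_subset[OF bdd[of j]]) auto
    then obtain l and r :: "nat \<Rightarrow> nat" where "strict_mono r" "((\<lambda>n. a j (s n)) \<circ> r) \<longlonglongrightarrow> l"
      using bounded_imp_convergent_subsequence by blast
    then show "\<exists>r'. strict_mono r' \<and> convergent (\<lambda>n. a j ((s \<circ> r') n))"
      by (auto simp: convergent_def comp_def)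
  qed
  have "?P j d.diagseq" for j
  proof -
    have "?P j (d.seqseq (Suc j))" by (rule d.seqseq_holds)
    \<comment> \<open>From index \<open>Suc j\<close> on, the diagonal sequence is a subsequence of
      the one selected for index \<open>j\<close>.\<close>
    then have "convergent ((\<lambda>n. a j (d.seqseq (Suc j) n)) \<circ> (\<lambda>k. d.fold_reduce (Suc j) k (Suc j + k)))"
      by (intro convergent_subseq_convergent d.subseq_diagonal_rest)
    then have "convergent (\<lambda>k. a j ((d.diagseq \<circ> ((+) (Suc j))) k))"
      unfolding d.diagseq_seqseq by (simp add: comp_def)
    then have "convergent (\<lambda>k. a j (d.diagseq (k + Suc j)))" by (simp add: comp_def add.commute)
    then show ?thesis by (subst (asm) convergent_ignore_initial_segment)
  qed
  then show ?thesis using d.subseq_diagseq by blast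
qed

lemma countable_corners: "countable (range (corner k :: 'a::euclidean_space \<Rightarrow> 'a))"
proof (rule countable_subset)
  show "range (corner k) \<subseteq> (\<lambda>m. \<Sum>b\<in>Basis. real_of_int (m b) *\<^sub>R (b::'a)) ` (PiE Basis (\<lambda>_. UNIV))"
  proof
    fix z :: 'a assume "z \<in> range (corner k)"
    then obtain x where "z = corner k x" by blast
    then have "z = (\<Sum>b\<in>Basis. real_of_int (restrict (\<lambda>b. \<lfloor>2 ^ k * (x \<bullet> b)\<rfloor>) Basis b) *\<^sub>R b)"
      by (simp add: corner_def)
    then show "z \<in> (\<lambda>m. \<Sum>b\<in>Basis. real_of_int (m b) *\<^sub>R (b::'a)) ` (PiE Basis (\<lambda>_. UNIV))"
      by (intro image_eqI[where x="restrict (\<lambda>b. \<lfloor>2 ^ k * (x \<bullet> b)\<rfloor>) Basis"]) auto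
  qed
  show "countable ((\<lambda>m. \<Sum>b\<in>Basis. real_of_int (m b) *\<^sub>R (b::'a)) ` (PiE Basis (\<lambda>_. UNIV)))"
    by (intro countable_image countable_PiE) auto
qed

text \<open>All averages of all levels are determined by countably many numbers, one for each cube,
  and each of them is bounded along the sequence; a diagonal choice makes all of them
  converge.\<close>

lemma cavg_convergent_subseq:
  fixes X :: "nat \<Rightarrow> 'a::euclidean_space \<Rightarrow> real"
  assumes X: "\<And>n. X n \<in> L2 lborel" and G: "\<And>n. L2.N lborel (X n) \<le> G"
  shows "\<exists>r::nat\<Rightarrow>nat. strict_mono r \<and> (\<forall>k x. convergent (\<lambda>n. cavg k (X (r n)) x))"
proof -
  define S where "S = (SIGMA k:UNIV. range (corner k :: 'a \<Rightarrow> 'a))"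
  have cS: "countable S" unfolding S_def by (intro countable_SIGMA countable_corners) auto
  have neS: "S \<noteq> {}" by (auto simp: S_def)
  define p where "p = from_nat_into S"
  define a where "a j n = cavg (fst (p j)) (X n) (SOME x. corner (fst (p j)) x = snd (p j))" for j n
  have "bounded (range (a j))" for j
    unfolding bounded_real
  proof (intro exI ballI, clarify)
    fix n
    have "\<bar>a j n\<bar> \<le> 2 powr (fst (p j) * DIM('a) / 2) * L2.N lborel (X n)" unfolding a_def by (rule cavg_bound[OF X])
    also have "\<dots> \<le> 2 powr (fst (p j) * DIM('a) / 2) * G" by (intro mult_left_mono G) simp
    finally show "\<bar>a j n\<bar> \<le> 2 powr (fst (p j) * DIM('a) / 2) * G" .
  qed
  then obtain r :: "nat \<Rightarrow> nat" where r: "strict_mono r" "\<And>j. convergent (\<lambda>n. a j (r n))"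
    using diagonal_convergent[of a] by blast
  have "convergent (\<lambda>n. cavg k (X (r n)) x)" for k x
  proof -
    have "(k, corner k x) \<in> S" by (auto simp: S_def)
    then obtain j where j: "p j = (k, corner k x)"
      unfolding p_def using from_nat_into_surj[OF cS] by blast
    have "corner k (SOME y. corner k y = corner k x) = corner k x" by (rule someI[of _ x]) simp
    then have "a j n = cavg k (X n) x" for n unfolding a_def j fst_conv snd_conv by (rule cavg_cong_corner)
    then show ?thesis using r(2)[of j] by simp
  qed
  then show ?thesis using r(1) by blast
qed

lemma trunc_diff: "trunc R (u - v) = trunc R u - trunc R v"
  by (auto simp: trunc_def fun_eq_iff algebra_simps)

lemma trunc_N_le: "u \<in> L2 lborel \<Longrightarrow> L2.N lborel (trunc R u) \<le> L2.N lborel u"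
  using L2_N_mono[of u lborel "trunc R u" 1] L2_measurable[OF trunc_L2[of u R]]
  by (simp add: trunc_def indicator_def)

text \<open>Tightness discards the complement of a ball, and \<open>cavg_approx\<close> replaces the
  functions by averages of one level, both uniformly in \<open>n\<close>. The averages converge
  pointwise along the diagonal subsequence and are uniformly bounded, so on the ball they converge
  by dominated convergence.\<close>

theorem L2_compactness:
  fixes X :: "nat \<Rightarrow> 'a::euclidean_space \<Rightarrow> real"
  assumes H: "\<And>n. L2_hoelder s G (X n)" and s: "0 < s"
    and tight: "\<And>\<epsilon>. \<epsilon> > 0 \<Longrightarrow> \<exists>R. \<forall>n. L2.N lborel (X n - trunc R (X n)) \<le> \<epsilon>"
  shows "\<exists>r::nat\<Rightarrow>nat. strict_mono r \<and> (\<forall>\<epsilon>>0. \<exists>M. \<forall>m\<ge>M. \<forall>n\<ge>M. L2.N lborel (X (r m) - X (r n)) < \<epsilon>)"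
proof -
  have X: "X n \<in> L2 lborel" "L2.N lborel (X n) \<le> G" and G: "0 \<le> G" for n using H[of n] by (auto simp: L2_hoelder_def)
  obtain r :: "nat \<Rightarrow> nat" where r: "strict_mono r" "\<And>k x. convergent (\<lambda>n. cavg k (X (r n)) x)"
    using cavg_convergent_subseq[of X G] X by blast
  define Z where "Z n = X (r n)" for n
  have Z: "Z n \<in> L2 lborel" "L2_hoelder s G (Z n)" for n using X H by (auto simp: Z_def)
  have [measurable]: "Z n \<in> borel_measurable borel" for n by (rule L2_borel[OF Z(1)])
  have "\<exists>M. \<forall>m\<ge>M. \<forall>n\<ge>M. L2.N lborel (Z m - Z n) < \<epsilon>" if \<epsilon>: "\<epsilon> > 0" for \<epsilon>
  proof -
    define c where "c = 2 powr (DIM('a) / 2) * DIM('a) powr s * G"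
    have c: "c \<ge> 0" using G by (simp add: c_def)
    obtain R where R: "\<And>n. L2.N lborel (X n - trunc R (X n)) \<le> \<epsilon> / 8" using tight[of "\<epsilon> / 8"] \<epsilon> by auto
    obtain k where k: "c * 2 powr (- (real k * s)) \<le> \<epsilon> / 8"
    proof -
      have "(2::real) powr (- s) < 1" using s by (simp add: powr_less_one)
      then have "(\<lambda>k. c * (2 powr (- s)) ^ k) \<longlonglongrightarrow> 0"
        by (intro tendsto_mult_right_zero LIMSEQ_realpow_zero) auto
      from LIMSEQ_D[OF this, of "\<epsilon> / 8"] \<epsilon> obtain k where "norm (c * (2 powr (- s)) ^ k - 0) < \<epsilon> / 8" by auto
      moreover have "((2::real) powr (- s)) ^ k = 2 powr (- (real k * s))"
        by (simp add: powr_realpow[symmetric] powr_powr mult.commute)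
      ultimately show ?thesis using that[of k] by simp
    qed
    \<comment> \<open>Within \<epsilon>/4 of \<open>Z n\<close>: one eighth is for the tail outside
      the ball and one for the averaging. The final estimate goes from \<open>Z m\<close> through
      \<open>Y m\<close>, the limit and \<open>Y n\<close> to \<open>Z n\<close>.\<close>
    define Y where "Y n = trunc R (cavg k (Z n))" for n
    have ap: "Z n - cavg k (Z n) \<in> L2 lborel" "L2.N lborel (Z n - cavg k (Z n)) \<le> \<epsilon> / 8" for n
      using cavg_approx[OF Z(2)[of n] s, of k] k by (auto simp: c_def)
    have Yeq: "Y n = trunc R (Z n) - trunc R (Z n - cavg k (Z n))" for n
      unfolding Y_def trunc_diff by simp
    have YL: "Y n \<in> L2 lborel" for n
      unfolding Yeq using trunc_L2[OF Z(1)] trunc_L2[OF ap(1)] by (rule L2.E_diff)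
    have ZY: "L2.N lborel (Z n - Y n) \<le> \<epsilon> / 4" for n
    proof -
      have eq: "Z n - Y n = (Z n - trunc R (Z n)) + trunc R (Z n - cavg k (Z n))" unfolding Yeq by simp
      have "L2.N lborel (Z n - Y n) \<le> L2.N lborel (Z n - trunc R (Z n)) + L2.N lborel (trunc R (Z n - cavg k (Z n)))"
        unfolding eq using Z(1) trunc_L2[OF Z(1)] trunc_L2[OF ap(1)] by (intro L2.N_triangle) auto
      also have "\<dots> \<le> \<epsilon> / 8 + \<epsilon> / 8"
        using R[of "r n"] order.trans[OF trunc_N_le[OF ap(1)] ap(2)] unfolding Z_def by (rule add_mono)
      finally show ?thesis by simp
    qed
    define L where "L x = lim (\<lambda>n. cavg k (Z n) x)" for x
    have lim: "(\<lambda>n. cavg k (Z n) x) \<longlonglongrightarrow> L x" for x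
      using r(2)[of k x] unfolding L_def Z_def by (simp add: convergent_LIMSEQ_iff)
    define b where "b = 2 powr (k * DIM('a) / 2) * G"
    have bb: "\<bar>cavg k (Z n) x\<bar> \<le> b" for n x
    proof -
      have "\<bar>cavg k (Z n) x\<bar> \<le> 2 powr (k * DIM('a) / 2) * L2.N lborel (Z n)" by (rule cavg_bound[OF Z(1)])
      also have "\<dots> \<le> b" unfolding b_def using X(2) by (intro mult_left_mono) (auto simp: Z_def)
      finally show ?thesis .
    qed
    have bL: "\<bar>L x\<bar> \<le> b" for x
      by (rule LIMSEQ_le_const2[OF tendsto_rabs[OF lim]]) (use bb in auto)
    have [measurable]: "L \<in> borel_measurable borel"
      by (rule borel_measurable_LIMSEQ_metric[OF _ lim]) simp
    have fin: "emeasure lborel (ball (0::'a) R) < \<infinity>" by (rule emeasure_bounded_finite) simp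
    have TL: "trunc R L \<in> L2 lborel"
    proof (rule L2_bound)
      show "(indicator (ball 0 R) :: 'a \<Rightarrow> real) \<in> L2 lborel" using fin by (intro indicator_L2) auto
      show "AE x in lborel. norm (trunc R L x) \<le> b * norm (indicator (ball 0 R) x :: real)"
        using bL by (auto simp: trunc_def indicator_def)
    qed simp
    have "(\<lambda>n. \<integral>x. (norm ((Y n - trunc R L) x))\<^sup>2 \<partial>lborel) \<longlonglongrightarrow> (\<integral>x. 0 \<partial>(lborel::'a measure))"
    proof (rule integral_dominated_convergence[where w="\<lambda>x. (2 * b)\<^sup>2 * indicator (ball 0 R) x"])
      show "integrable lborel (\<lambda>x::'a. (2 * b)\<^sup>2 * indicator (ball 0 R) x)"
        using fin by (intro integrable_mult_right) (simp add: less_top[symmetric])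
      show "AE x in lborel. (\<lambda>n. (norm ((Y n - trunc R L) x))\<^sup>2) \<longlonglongrightarrow> 0"
      proof (rule AE_I2)
        fix x
        have "(\<lambda>n. (norm (indicator (ball 0 R) x * cavg k (Z n) x - trunc R L x))\<^sup>2)
            \<longlonglongrightarrow> (norm (indicator (ball 0 R) x * L x - trunc R L x))\<^sup>2"
          by (intro tendsto_intros lim)
        then show "(\<lambda>n. (norm ((Y n - trunc R L) x))\<^sup>2) \<longlonglongrightarrow> 0" by (simp add: Y_def trunc_def)
      qed
      show "AE x in lborel. norm ((norm ((Y n - trunc R L) x))\<^sup>2) \<le> (2 * b)\<^sup>2 * indicator (ball 0 R) x" for n
      proof (rule AE_I2)
        fix x
        have "\<bar>cavg k (Z n) x - L x\<bar> \<le> 2 * b" using bb[of n x] bL[of x] by linarith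
        then have "(cavg k (Z n) x - L x)\<^sup>2 \<le> (2 * b)\<^sup>2" by (metis abs_ge_zero power2_abs power_mono)
        then show "norm ((norm ((Y n - trunc R L) x))\<^sup>2) \<le> (2 * b)\<^sup>2 * indicator (ball 0 R) x"
          by (simp add: Y_def trunc_def indicator_def)
      qed
    qed (auto simp: fun_diff_def Y_def)
    then have "(\<lambda>n. (L2.N lborel (Y n - trunc R L))\<^sup>2) \<longlonglongrightarrow> 0"
      using L2_N_sq[OF L2.E_diff[OF YL TL]] by simp
    from tendsto_real_sqrt[OF this] have "(\<lambda>n. L2.N lborel (Y n - trunc R L)) \<longlonglongrightarrow> 0"
      using L2.N_nonneg[OF L2.E_diff[OF YL TL]] by simp
    from LIMSEQ_D[OF this, of "\<epsilon> / 4"] \<epsilon> obtain M where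
      M: "\<And>n. n \<ge> M \<Longrightarrow> norm (L2.N lborel (Y n - trunc R L) - 0) < \<epsilon> / 4" by auto
    have "L2.N lborel (Z m - Z n) < \<epsilon>" if mn: "m \<ge> M" "n \<ge> M" for m n
    proof -
      note mem = Z(1)[of m] Z(1)[of n] YL[of m] YL[of n] TL
      have "L2.N lborel (Z m - Z n) \<le> L2.N lborel (Z m - Y m) + L2.N lborel (Y m - Z n)"
        by (rule L2.N_triangle3[OF mem(1,3,2)])
      moreover have "L2.N lborel (Y m - Z n) \<le> L2.N lborel (Y m - trunc R L) + L2.N lborel (trunc R L - Z n)"
        by (rule L2.N_triangle3[OF mem(3,5,2)])
      moreover have "L2.N lborel (trunc R L - Z n) \<le> L2.N lborel (trunc R L - Y n) + L2.N lborel (Y n - Z n)"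
        by (rule L2.N_triangle3[OF mem(5,4,2)])
      moreover have "L2.N lborel (trunc R L - Y n) = L2.N lborel (Y n - trunc R L)" by (rule L2.N_diff_commute[OF mem(5,4)])
      moreover have "L2.N lborel (Y n - Z n) = L2.N lborel (Z n - Y n)" by (rule L2.N_diff_commute[OF mem(4,2)])
      moreover have "L2.N lborel (Y m - trunc R L) < \<epsilon> / 4" "L2.N lborel (Y n - trunc R L) < \<epsilon> / 4"
        using M[OF mn(1)] M[OF mn(2)] by (simp_all add: abs_less_iff)
      ultimately show ?thesis using ZY[of m] ZY[of n] by linarith
    qed
    then show ?thesis by blast
  qed
  then show ?thesis using r(1) unfolding Z_def by blast
qed

text \<open>Where \<open>2 M k < |u| \<le> 2 M (k + 1)\<close>, the average of level \<open>k\<close> is at most \<open>|u| / 2\<close>, so \<open>|u|\<^sup>2\<close> is at most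
  four times the squared distance of \<open>u\<close> to that average.\<close>

theorem Lq_estimate:
  fixes s q \<epsilon> :: real
  assumes s: "0 < s" "2 * s < DIM('a::euclidean_space)" and q: "2 < q" "(DIM('a) / 2 - s) * (q - 2) < 2 * s"
    and \<epsilon>: "\<epsilon> > 0"
  shows "\<exists>C\<ge>0. \<forall>u::'a\<Rightarrow>real. L2_hoelder s 1 u \<longrightarrow>
     (\<integral>\<^sup>+x. ennreal (\<bar>u x\<bar> powr q) \<partial>lborel) \<le> ennreal (C * (L2.N lborel u)\<^sup>2 + \<epsilon>)"
proof -
  define \<beta> where "\<beta> = DIM('a) / 2 - s"
  have \<beta>: "\<beta> > 0" using s by (simp add: \<beta>_def)
  obtain A where A: "A > 0" "\<And>(u::'a\<Rightarrow>real) k x. L2_hoelder s 1 u \<Longrightarrow> \<bar>cavg k u x\<bar> \<le> A * 2 powr (k * \<beta>)"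
    using cavg_sup[OF s] unfolding \<beta>_def by force
  define M where "M k = A * 2 powr (real k * \<beta>)" for k :: nat
  have M0: "M k > 0" for k using A by (simp add: M_def)
  define c0 where "c0 = 2 powr (DIM('a) / 2) * DIM('a) powr s"
  \<comment> \<open>One level higher multiplies the weight \<open>|u|^(q-2)\<close> by
    2^(\<beta>(q-2)) and the bound for the squared distance to the average by 2^(-2s).
    Subcriticality of \<open>q\<close> says exactly that the product is below 1.\<close>
  define \<rho> where "\<rho> = 2 powr (\<beta> * (q - 2) - 2 * s)"
  have \<rho>: "0 < \<rho>" "\<rho> < 1" using q by (auto simp: \<rho>_def \<beta>_def powr_less_one)
  \<comment> \<open>The factor with exponent \<open>\<beta> * (q - 2)\<close> arises since a layer
    is bounded above by the threshold of level \<open>k + 1\<close>, while its average has level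
    \<open>k\<close>.\<close>
  define c where "c = 4 * (2 * A) powr (q - 2) * 2 powr (\<beta> * (q - 2)) * c0\<^sup>2"
  have c: "c \<ge> 0" by (simp add: c_def)
  \<comment> \<open>All layers from level \<open>K\<close> on together contribute at most
    \<epsilon>, uniformly in \<open>u\<close>. Where \<open>|u|\<close> stays below the threshold of
    \<open>K\<close>, its power is at most \<open>C\<close> times the square.\<close>
  obtain K where K: "c * \<rho> ^ K / (1 - \<rho>) \<le> \<epsilon>"
  proof -
    have "(\<lambda>K. c / (1 - \<rho>) * \<rho> ^ K) \<longlonglongrightarrow> 0"
      using \<rho> by (intro tendsto_mult_right_zero LIMSEQ_realpow_zero) auto
    from LIMSEQ_D[OF this \<epsilon>] obtain K where "norm (c / (1 - \<rho>) * \<rho> ^ K - 0) < \<epsilon>" by auto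
    then have "c / (1 - \<rho>) * \<rho> ^ K < \<epsilon>"
      unfolding real_norm_def diff_0_right by (rule le_less_trans[OF abs_ge_self])
    then show ?thesis using that[of K] by simp
  qed
  define w where "w k = 4 * (2 * M (Suc (K + k))) powr (q - 2)" for k
  have wk: "w k * (c0 * 2 powr (- (real (K + k) * s)))\<^sup>2 = c * \<rho> ^ K * \<rho> ^ k" for k
  proof -
    have e: "\<beta> * (q - 2) * real (Suc (K + k)) + (- (real (K + k) * s) + - (real (K + k) * s))
      = \<beta> * (q - 2) + (\<beta> * (q - 2) - 2 * s) * real (K + k)" by (simp add: algebra_simps)
    have "(2 * M (Suc (K + k))) powr (q - 2) = (2 * A) powr (q - 2) * 2 powr (\<beta> * (q - 2) * real (Suc (K + k)))"
      using A by (simp add: M_def powr_mult[symmetric] powr_powr mult.assoc[symmetric]) (simp add: powr_mult powr_powr mult_ac)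
    then have "w k * (c0 * 2 powr (- (real (K + k) * s)))\<^sup>2 = 4 * (2 * A) powr (q - 2) * c0\<^sup>2 *
       (2 powr (\<beta> * (q - 2) * real (Suc (K + k))) * (2 powr (- (real (K + k) * s)) * 2 powr (- (real (K + k) * s))))"
      by (simp add: w_def power2_eq_square mult_ac)
    also have "2 powr (\<beta> * (q - 2) * real (Suc (K + k))) * (2 powr (- (real (K + k) * s)) * 2 powr (- (real (K + k) * s)))
      = 2 powr (\<beta> * (q - 2)) * \<rho> ^ (K + k)"
      unfolding powr_add[symmetric] e unfolding powr_add \<rho>_def by (simp add: powr_realpow[symmetric] powr_powr)
    finally show ?thesis by (simp add: c_def power_add mult_ac)
  qed
  define C where "C = (2 * M K) powr (q - 2)"
  have main: "(\<integral>\<^sup>+x. ennreal (\<bar>u x\<bar> powr q) \<partial>lborel) \<le> ennreal (C * (L2.N lborel u)\<^sup>2 + \<epsilon>)" if H: "L2_hoelder s 1 u" for u :: "'a \<Rightarrow> real"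
  proof -
    have u: "u \<in> L2 lborel" using H by (simp add: L2_hoelder_def)
    have [measurable]: "u \<in> borel_measurable borel" by (rule L2_borel[OF u])
    have split: "\<bar>t\<bar> powr q = \<bar>t\<bar> powr (q - 2) * t\<^sup>2" for t :: real
    proof (cases "t = 0")
      case False
      then have b: "\<bar>t\<bar> powr 2 = t\<^sup>2" using powr_realpow[of "\<bar>t\<bar>" 2] by simp
      have "\<bar>t\<bar> powr q = \<bar>t\<bar> powr (q - 2) * \<bar>t\<bar> powr 2"
        using powr_add[of "\<bar>t\<bar>" "q - 2" 2] by simp
      then show ?thesis unfolding b .
    qed simp
    have pw: "ennreal (\<bar>u x\<bar> powr q) \<le> ennreal (C * (norm (u x))\<^sup>2) + (\<Sum>k. ennreal (w k * (norm ((u - cavg (K + k) u) x))\<^sup>2))" for x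
    proof (cases "\<bar>u x\<bar> \<le> 2 * M K")
      case True
      have "\<bar>u x\<bar> powr (q - 2) \<le> C" unfolding C_def using True q by (intro powr_mono2) auto
      then have "\<bar>u x\<bar> powr q \<le> C * (norm (u x))\<^sup>2" unfolding split by (simp add: mult_right_mono)
      then have "ennreal (\<bar>u x\<bar> powr q) \<le> ennreal (C * (norm (u x))\<^sup>2)" by (rule ennreal_leI)
      then show ?thesis by (rule order.trans) simp
    next
      case False
      have "\<exists>k. \<bar>u x\<bar> \<le> 2 * M (Suc (K + k))"
      proof -
        have "1 < (2::real) powr \<beta>" using \<beta> by simp
        then obtain n where n: "\<bar>u x\<bar> / (2 * A) < (2 powr \<beta>) ^ n" using real_arch_pow by blast
        have "(2 powr \<beta>) ^ n \<le> (2 powr \<beta>) ^ (Suc (K + n))" using \<open>1 < 2 powr \<beta>\<close> by (intro power_increasing) auto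
        also have "\<dots> = 2 powr (real (Suc (K + n)) * \<beta>)" 
          by (subst powr_realpow[symmetric]) (simp_all add: powr_powr mult.commute del: of_nat_Suc)
        finally have "\<bar>u x\<bar> / (2 * A) \<le> 2 powr (real (Suc (K + n)) * \<beta>)" using n by linarith
        then have "\<bar>u x\<bar> \<le> 2 * M (Suc (K + n))" using A by (simp add: M_def field_simps)
        then show ?thesis by blast
      qed
      \<comment> \<open>The first layer whose upper threshold reaches \<bar>u x\<bar>; by minimality
        the lower threshold is exceeded, for index 0 by the case assumption.\<close>
      define j where "j = (LEAST k. \<bar>u x\<bar> \<le> 2 * M (Suc (K + k)))"
      have j1: "\<bar>u x\<bar> \<le> 2 * M (Suc (K + j))" unfolding j_def by (rule LeastI_ex) fact
      have j2: "2 * M (K + j) < \<bar>u x\<bar>"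
      proof (cases j)
        case 0
        then show ?thesis using False by simp
      next
        case (Suc i)
        then have "i < j" by simp
        from not_less_Least[OF this[unfolded j_def]] show ?thesis using Suc by (simp add: not_le)
      qed
      have "\<bar>cavg (K + j) u x\<bar> \<le> M (K + j)" using A(2)[OF H, of "K + j" x] by (simp add: M_def)
      moreover have "A \<le> 2 * d" if "B \<le> m" "2 * m < A" "A - B \<le> d" for A B d m :: real
        using that by linarith
      ultimately have "\<bar>u x\<bar> \<le> 2 * \<bar>u x - cavg (K + j) u x\<bar>" using j2 abs_triangle_ineq2 by blast
      then have sq: "(u x)\<^sup>2 \<le> 4 * (u x - cavg (K + j) u x)\<^sup>2"
        using power_mono[of "\<bar>u x\<bar>" "2 * \<bar>u x - cavg (K + j) u x\<bar>" 2] by (simp add: power_mult_distrib)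
      have "\<bar>u x\<bar> powr q \<le> (2 * M (Suc (K + j))) powr (q - 2) * (4 * (u x - cavg (K + j) u x)\<^sup>2)"
        unfolding split using j1 q sq by (intro mult_mono powr_mono2) auto
      then have "ennreal (\<bar>u x\<bar> powr q) \<le> ennreal (w j * (norm ((u - cavg (K + j) u) x))\<^sup>2)"
        by (intro ennreal_leI) (simp add: w_def mult_ac)
      also have "\<dots> \<le> (\<Sum>k. ennreal (w k * (norm ((u - cavg (K + k) u) x))\<^sup>2))"
        using sum_le_suminf[of "\<lambda>k. ennreal (w k * (norm ((u - cavg (K + k) u) x))\<^sup>2)" "{j}"] by simp
      also have "\<dots> \<le> ennreal (C * (norm (u x))\<^sup>2) + (\<Sum>k. ennreal (w k * (norm ((u - cavg (K + k) u) x))\<^sup>2))" by simp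
      finally show ?thesis .
    qed
    have [measurable]: "(\<lambda>x. norm ((u - cavg (K + k) u) x)) \<in> borel_measurable borel" for k
      by simp
    have w0: "w k \<ge> 0" for k by (simp add: w_def)
    have "(\<integral>\<^sup>+x. ennreal (\<bar>u x\<bar> powr q) \<partial>lborel)
      \<le> (\<integral>\<^sup>+x. ennreal (C * (norm (u x))\<^sup>2) + (\<Sum>k. ennreal (w k * (norm ((u - cavg (K + k) u) x))\<^sup>2)) \<partial>lborel)"
      by (intro nn_integral_mono pw)
    also have "\<dots> = (\<integral>\<^sup>+x. ennreal (C * (norm (u x))\<^sup>2) \<partial>lborel)
        + (\<Sum>k. \<integral>\<^sup>+x. ennreal (w k * (norm ((u - cavg (K + k) u) x))\<^sup>2) \<partial>lborel)"
      by (subst nn_integral_add) (auto intro!: arg_cong2[where f="(+)"] nn_integral_suminf)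
    also have "(\<integral>\<^sup>+x. ennreal (C * (norm (u x))\<^sup>2) \<partial>lborel) = ennreal (C * (L2.N lborel u)\<^sup>2)"
    proof -
      have "(\<integral>\<^sup>+x. ennreal (C * (norm (u x))\<^sup>2) \<partial>lborel) = ennreal C * (\<integral>\<^sup>+x. ennreal ((norm (u x))\<^sup>2) \<partial>lborel)"
        by (subst nn_integral_cmult[symmetric]) (auto simp: ennreal_mult C_def)
      then show ?thesis unfolding L2_nn[OF u] by (simp add: ennreal_mult C_def)
    qed
    also have "(\<Sum>k. \<integral>\<^sup>+x. ennreal (w k * (norm ((u - cavg (K + k) u) x))\<^sup>2) \<partial>lborel) \<le> (\<Sum>k. ennreal (c * \<rho> ^ K * \<rho> ^ k))"
    proof (intro suminf_le)
      fix k
      note ap = cavg_approx[OF H s(1), of "K + k"]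
      have "(\<integral>\<^sup>+x. ennreal (w k * (norm ((u - cavg (K + k) u) x))\<^sup>2) \<partial>lborel)
         = ennreal (w k) * (\<integral>\<^sup>+x. ennreal ((norm ((u - cavg (K + k) u) x))\<^sup>2) \<partial>lborel)"
        by (subst nn_integral_cmult[symmetric]) (auto simp: ennreal_mult w0)
      also have "\<dots> = ennreal (w k * (L2.N lborel (u - cavg (K + k) u))\<^sup>2)"
        unfolding L2_nn[OF ap(1)] by (simp add: ennreal_mult w0)
      also have "\<dots> \<le> ennreal (w k * (c0 * 2 powr (- (real (K + k) * s)))\<^sup>2)"
        using ap L2.N_nonneg[OF ap(1)] by (intro ennreal_leI mult_left_mono power_mono w0) (auto simp: c0_def)
      finally show "(\<integral>\<^sup>+x. ennreal (w k * (norm ((u - cavg (K + k) u) x))\<^sup>2) \<partial>lborel) \<le> ennreal (c * \<rho> ^ K * \<rho> ^ k)"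
        unfolding wk .
    qed auto
    also have "(\<Sum>k. ennreal (c * \<rho> ^ K * \<rho> ^ k)) = ennreal (c * \<rho> ^ K / (1 - \<rho>))"
    proof -
      have "(\<lambda>k. c * \<rho> ^ K * \<rho> ^ k) sums (c * \<rho> ^ K * (1 / (1 - \<rho>)))"
        using \<rho> by (intro sums_mult geometric_sums) auto
      then have "(\<lambda>k. ennreal (c * \<rho> ^ K * \<rho> ^ k)) sums ennreal (c * \<rho> ^ K * (1 / (1 - \<rho>)))"
        using \<rho> c by (subst sums_ennreal) auto
      then show ?thesis by (simp add: sums_iff)
    qed
    also have "ennreal (C * (L2.N lborel u)\<^sup>2) + ennreal (c * \<rho> ^ K / (1 - \<rho>)) \<le> ennreal (C * (L2.N lborel u)\<^sup>2 + \<epsilon>)"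
    proof -
      have "0 \<le> C * (L2.N lborel u)\<^sup>2" "0 \<le> c * \<rho> ^ K / (1 - \<rho>)" using c \<rho> by (simp_all add: C_def)
      from ennreal_plus[OF this, symmetric] show ?thesis by (rule ord_eq_le_trans) (use K in \<open>simp add: ennreal_leI\<close>)
    qed
    finally show ?thesis by (simp add: add_left_mono)
  qed
  moreover have "C \<ge> 0" by (simp add: C_def)
  ultimately show ?thesis by blast
qed

section \<open>Pointwise bounds for the nonlinearity\<close>

locale schroedinger = fractional_space s V V0 for s and V :: "'a::euclidean_space \<Rightarrow> real" and V0 +
  fixes f fd :: "'a \<Rightarrow> real \<Rightarrow> real" and a1 a2 p \<mu> :: real
  assumes dim: "2 * s < DIM('a)"
    and V_coercive: "\<And>c. \<exists>R. \<forall>x. R \<le> norm x \<longrightarrow> c \<le> V x"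
    and f_continuous: "continuous_on UNIV (\<lambda>(x, t). f x t)"
    and f_deriv: "\<And>x t. (f x has_real_derivative fd x t) (at t)"
    and fd_continuous: "continuous_on UNIV (\<lambda>(x, t). fd x t)"
    and f_zero: "\<And>x. f x 0 = 0" and fd_zero: "\<And>x. fd x 0 = 0"
    and growth: "\<And>x t. \<bar>fd x t\<bar> \<le> a1 + a2 * \<bar>t\<bar> powr (p - 1)"
    and a_pos: "0 < a1" "0 < a2"
    and p: "1 < p" "p < (DIM('a) + 2 * s) / (DIM('a) - 2 * s)"
    and \<mu>: "2 < \<mu>"
    and AR: "\<And>x t. t \<noteq> 0 \<Longrightarrow> 0 < \<mu> * (LBINT \<tau>=0..t. f x \<tau>) \<and> \<mu> * (LBINT \<tau>=0..t. f x \<tau>) \<le> t * f x t"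
begin

definition F :: "'a \<Rightarrow> real \<Rightarrow> real" where "F x t = (LBINT \<tau>=0..t. f x \<tau>)"

definition q :: real where "q = p + 1"

text \<open>The second inequality is \<open>q < 2 N / (N - 2 s)\<close> for the dimension N, in the
  form that \<open>Lq_estimate\<close> asks for.\<close>

lemma q_bounds: "2 < q" "(DIM('a) / 2 - s) * (q - 2) < 2 * s"
proof -
  show "2 < q" using p by (simp add: q_def)
  have "p * (DIM('a) - 2 * s) < DIM('a) + 2 * s" using p dim by (simp add: less_divide_eq)
  then show "(DIM('a) / 2 - s) * (q - 2) < 2 * s" by (simp add: q_def algebra_simps)
qed

lemma f_continuous_t: "continuous_on S (f x)"
  using DERIV_isCont[OF f_deriv] by (auto intro: continuous_at_imp_continuous_on)

lemma F_deriv: "(F x has_real_derivative f x t) (at t)"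
proof -
  define a b where "a = min 0 t - 1" and "b = max 0 t + 1"
  have ab: "a \<le> b" "t \<in> {a<..<b}" "a < 0" "0 < b" "a < t" "t < b" by (auto simp: a_def b_def)
  have "((\<lambda>u. LBINT y=ereal 0..u. f x y) has_vector_derivative f x t) (at t within {a..b})"
    by (rule interval_integral_FTC2) (use ab f_continuous_t in auto)
  then have "((\<lambda>u. LBINT y=ereal 0..u. f x y) has_vector_derivative f x t) (at t)"
    using ab at_within_Icc_at[of a t b] by simp
  then show ?thesis
    by (simp add: F_def[abs_def] zero_ereal_def has_real_derivative_iff_has_vector_derivative)
qed

lemma F_zero [simp]: "F x 0 = 0"
  by (simp add: F_def zero_ereal_def[symmetric])

lemma F_pos: "t \<noteq> 0 \<Longrightarrow> 0 < F x t"
  using AR[of t x] \<mu> by (simp add: F_def zero_less_mult_iff)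

lemma F_nonneg: "0 \<le> F x t"
  using F_pos[of t x] by (cases "t = 0") auto

lemma AR': "\<mu> * F x t \<le> t * f x t"
  using AR[of t x] by (cases "t = 0") (auto simp: F_def zero_ereal_def[symmetric])

lemma fd_bound: assumes "\<bar>t\<bar> \<le> m" shows "\<bar>fd x t\<bar> \<le> a1 + a2 * m powr (p - 1)"
proof -
  have "\<bar>t\<bar> powr (p - 1) \<le> m powr (p - 1)" using assms p by (intro powr_mono2) auto
  then have "a2 * \<bar>t\<bar> powr (p - 1) \<le> a2 * m powr (p - 1)" using a_pos by (intro mult_left_mono) auto
  then show ?thesis using growth[of x t] by linarith
qed

lemma f_lipschitz:
  assumes "\<bar>t\<bar> \<le> m" "\<bar>r\<bar> \<le> m" shows "\<bar>f x t - f x r\<bar> \<le> (a1 + a2 * m powr (p - 1)) * \<bar>t - r\<bar>"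
proof -
  have "norm (f x t - f x r) \<le> (a1 + a2 * m powr (p - 1)) * norm (t - r)"
  proof (rule field_differentiable_bound[where S="{-m..m}" and f'="fd x"])
    show "(f x has_field_derivative fd x z) (at z within {-m..m})" for z
      by (rule has_field_derivative_at_within[OF f_deriv])
    show "norm (fd x z) \<le> a1 + a2 * m powr (p - 1)" if "z \<in> {-m..m}" for z
      using fd_bound[of z m x] that by (simp add: abs_le_iff)
  qed (use assms in \<open>auto simp: abs_le_iff\<close>)
  then show ?thesis by simp
qed

lemma max_powr_le:
  fixes t r e :: real assumes "0 \<le> e" shows "(max \<bar>t\<bar> \<bar>r\<bar>) powr e \<le> \<bar>t\<bar> powr e + \<bar>r\<bar> powr e"
  by (cases "\<bar>t\<bar> \<le> \<bar>r\<bar>") (auto simp: max_def)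

lemma weight_le:
  "a1 + a2 * (max \<bar>t\<bar> \<bar>r\<bar>) powr (p - 1) \<le> a1 + a2 * (\<bar>t\<bar> powr (p - 1) + \<bar>r\<bar> powr (p - 1))"
  using max_powr_le[of "p - 1" t r] p a_pos by simp

lemma f_diff_le: "\<bar>f x t - f x r\<bar> \<le> (a1 + a2 * (\<bar>t\<bar> powr (p - 1) + \<bar>r\<bar> powr (p - 1))) * \<bar>t - r\<bar>"
  using f_lipschitz[of t "max \<bar>t\<bar> \<bar>r\<bar>" r x] mult_right_mono[OF weight_le[of t r], of "\<bar>t - r\<bar>"] by simp

text \<open>Mean value inequality for \<open>F x z - f x t * z\<close> as a function of
  \<open>z\<close> between \<open>t\<close> and \<open>r\<close>; its derivative is a difference of
  values of \<open>f\<close>, which \<open>f_lipschitz\<close> bounds.\<close>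

lemma F_taylor:
  "\<bar>F x r - F x t - f x t * (r - t)\<bar> \<le> (a1 + a2 * (\<bar>t\<bar> powr (p - 1) + \<bar>r\<bar> powr (p - 1))) * (r - t)\<^sup>2"
proof -
  define m where "m = max \<bar>t\<bar> \<bar>r\<bar>"
  define c where "c = (a1 + a2 * m powr (p - 1)) * \<bar>r - t\<bar>"
  define S where "S = {min t r..max t r}"
  have "norm ((F x r - f x t * r) - (F x t - f x t * t)) \<le> c * norm (r - t)"
  proof (rule field_differentiable_bound[where S=S and f'="\<lambda>z. f x z - f x t"])
    show "((\<lambda>z. F x z - f x t * z) has_field_derivative f x z - f x t) (at z within S)" for z
      by (rule has_field_derivative_at_within) (auto intro!: derivative_eq_intros F_deriv)
    show "norm (f x z - f x t) \<le> c" if "z \<in> S" for z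
    proof -
      have "t \<le> z \<and> z \<le> r \<or> r \<le> z \<and> z \<le> t" using that by (auto simp: S_def min_def max_def split: if_splits)
      then have "\<bar>z\<bar> \<le> m" "\<bar>z - t\<bar> \<le> \<bar>r - t\<bar>" unfolding m_def by auto
      then have "\<bar>f x z - f x t\<bar> \<le> (a1 + a2 * m powr (p - 1)) * \<bar>z - t\<bar>" by (intro f_lipschitz) (auto simp: m_def)
      also have "\<dots> \<le> c" unfolding c_def using a_pos \<open>\<bar>z - t\<bar> \<le> _\<close> by (intro mult_left_mono) auto
      finally show ?thesis by simp
    qed
  qed (auto simp: S_def)
  note bd = this
  have "\<bar>F x r - F x t - f x t * (r - t)\<bar> \<le> (a1 + a2 * m powr (p - 1)) * (r - t)\<^sup>2"
  proof -
    have "(F x r - f x t * r) - (F x t - f x t * t) = F x r - F x t - f x t * (r - t)"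
      by (simp add: algebra_simps)
    moreover have "c * norm (r - t) = (a1 + a2 * m powr (p - 1)) * (r - t)\<^sup>2"
      by (simp add: c_def mult.assoc power2_eq_square abs_mult_self_eq)
    ultimately show ?thesis using bd by simp
  qed
  also have "\<dots> \<le> (a1 + a2 * (\<bar>t\<bar> powr (p - 1) + \<bar>r\<bar> powr (p - 1))) * (r - t)\<^sup>2"
    unfolding m_def by (intro mult_right_mono weight_le) simp
  finally show ?thesis .
qed

text \<open>By the Ambrosetti-Rabinowitz condition the function
  \<open>r powr (- \<mu>) * F x (r * t)\<close> has a nonnegative derivative. This superquadratic
  growth makes \<open>J\<close> negative far out on a ray.\<close>

lemma F_homogeneous: assumes "1 \<le> c" shows "c powr \<mu> * F x t \<le> F x (c * t)"
proof (cases "t = 0")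
  case False
  define g where "g = (\<lambda>r. r powr (- \<mu>) * F x (r * t))"
  have "g 1 \<le> g c"
  proof (rule DERIV_nonneg_imp_nondecreasing[OF assms])
    fix r :: real assume r: "1 \<le> r" "r \<le> c"
    have "(g has_real_derivative r powr (- \<mu>) * (f x (r * t) * t) + (- \<mu> * r powr (- \<mu> - 1)) * F x (r * t)) (at r)"
      unfolding g_def
    proof (rule DERIV_mult')
      show "((\<lambda>r. r powr - \<mu>) has_real_derivative - \<mu> * r powr (- \<mu> - 1)) (at r)"
        using r has_real_derivative_powr[of r "- \<mu>"] by simp
      have "((\<lambda>r. r * t) has_real_derivative t) (at r)" by (auto intro!: derivative_eq_intros)
      from DERIV_chain2[OF F_deriv this] show "((\<lambda>r. F x (r * t)) has_real_derivative f x (r * t) * t) (at r)" .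
    qed
    moreover have "r powr (- \<mu>) * (f x (r * t) * t) + (- \<mu> * r powr (- \<mu> - 1)) * F x (r * t)
       = r powr (- \<mu> - 1) * (r * t * f x (r * t) - \<mu> * F x (r * t))"
    proof -
      have "r powr (- \<mu>) = r powr (- \<mu> - 1) * r" using r powr_add[of r "- \<mu> - 1" 1] by simp
      then show ?thesis by (simp add: algebra_simps)
    qed
    moreover have "\<dots> \<ge> 0" using AR'[of x "r * t"] by (intro mult_nonneg_nonneg) auto
    ultimately show "\<exists>y. (g has_real_derivative y) (at r) \<and> 0 \<le> y" by auto
  qed
  then have "F x t \<le> c powr (- \<mu>) * F x (c * t)" by (simp add: g_def)
  then have "c powr \<mu> * F x t \<le> c powr \<mu> * (c powr (- \<mu>) * F x (c * t))" by (intro mult_left_mono) auto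
  also have "\<dots> = F x (c * t)" using assms by (simp add: powr_minus field_simps)
  finally show ?thesis .
qed simp

text \<open>Since \<open>fd\<close> is only locally uniformly small at \<open>t = 0\<close>, the coercivity of \<open>V\<close> absorbs the
  linear growth of \<open>f\<close> outside a ball.\<close>

lemma F_upper: "\<exists>C\<ge>0. \<forall>x t. F x t \<le> V x / 4 * t\<^sup>2 + C * \<bar>t\<bar> powr q"
proof -
  obtain R where R: "\<And>x. R \<le> norm x \<Longrightarrow> 4 * a1 \<le> V x" using V_coercive[of "4 * a1"] by blast
  \<comment> \<open>Two applications of the mean value inequality, starting from
    \<open>f x 0 = 0\<close> and \<open>F x 0 = 0\<close>.\<close>
  have bnd: "F x t \<le> c * t\<^sup>2" if c: "\<And>z. \<bar>z\<bar> \<le> \<bar>t\<bar> \<Longrightarrow> \<bar>fd x z\<bar> \<le> c" for x t c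
  proof -
    have c0: "0 \<le> c" using c[of 0] by (simp add: fd_zero)
    have fb: "\<bar>f x z\<bar> \<le> c * \<bar>z\<bar>" if z: "\<bar>z\<bar> \<le> \<bar>t\<bar>" for z
    proof -
      have "norm (f x z - f x 0) \<le> c * norm (z - 0)"
      proof (rule field_differentiable_bound[where S="{-\<bar>t\<bar>..\<bar>t\<bar>}" and f'="fd x"])
        show "(f x has_field_derivative fd x y) (at y within {-\<bar>t\<bar>..\<bar>t\<bar>})" for y
          by (rule has_field_derivative_at_within[OF f_deriv])
        show "norm (fd x y) \<le> c" if "y \<in> {-\<bar>t\<bar>..\<bar>t\<bar>}" for y using c[of y] that by (simp add: abs_le_iff)
      qed (use z in \<open>auto simp: abs_le_iff\<close>)
      then show ?thesis by (simp add: f_zero)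
    qed
    have "norm (F x t - F x 0) \<le> (c * \<bar>t\<bar>) * norm (t - 0)"
    proof (rule field_differentiable_bound[where S="{-\<bar>t\<bar>..\<bar>t\<bar>}" and f'="f x"])
      show "(F x has_field_derivative f x y) (at y within {-\<bar>t\<bar>..\<bar>t\<bar>})" for y
        by (rule has_field_derivative_at_within[OF F_deriv])
      show "norm (f x y) \<le> c * \<bar>t\<bar>" if "y \<in> {-\<bar>t\<bar>..\<bar>t\<bar>}" for y
      proof -
        have y: "\<bar>y\<bar> \<le> \<bar>t\<bar>" using that by (simp add: abs_le_iff)
        show ?thesis using fb[OF y] mult_left_mono[OF y c0] by simp
      qed
    qed (auto simp: abs_le_iff)
    then show ?thesis by (simp add: power2_eq_square mult.assoc abs_mult_self_eq abs_le_iff)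
  qed
  have sp: "\<bar>t\<bar> powr q = \<bar>t\<bar> powr (p - 1) * t\<^sup>2" for t :: real
  proof (cases "t = 0")
    case False
    then have b: "\<bar>t\<bar> powr 2 = t\<^sup>2" using powr_realpow[of "\<bar>t\<bar>" 2] by simp
    show ?thesis unfolding b[symmetric] q_def using powr_add[of "\<bar>t\<bar>" "p - 1" 2] by (simp add: add.commute)
  qed (simp add: q_def)
  have glob: "F x t \<le> a1 * t\<^sup>2 + a2 * \<bar>t\<bar> powr q" for x t
    using bnd[of t x "a1 + a2 * \<bar>t\<bar> powr (p - 1)", OF fd_bound] by (simp add: sp algebra_simps)
  obtain d where d: "d > 0" "\<And>x t. norm x \<le> R \<Longrightarrow> \<bar>t\<bar> \<le> d \<Longrightarrow> \<bar>fd x t\<bar> \<le> V0 / 4"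
  proof -
    \<comment> \<open>On this compact set \<open>fd\<close> is uniformly continuous, so its
      vanishing at \<open>t = 0\<close> is uniform in \<open>x\<close>.\<close>
    define S where "S = cball (0::'a) R \<times> {-1..1::real}"
    have "uniformly_continuous_on S (\<lambda>(x, t). fd x t)"
      unfolding S_def by (intro compact_uniformly_continuous continuous_on_subset[OF fd_continuous] compact_Times) auto
    moreover have "V0 / 4 > 0" using V0 by simp
    ultimately obtain e where e: "e > 0" "\<And>z z'. z \<in> S \<Longrightarrow> z' \<in> S \<Longrightarrow> dist z' z < e \<Longrightarrow>
        dist ((\<lambda>(x, t). fd x t) z') ((\<lambda>(x, t). fd x t) z) < V0 / 4"
      unfolding uniformly_continuous_on_def by metis
    have "\<bar>fd x t\<bar> \<le> V0 / 4" if "norm x \<le> R" "\<bar>t\<bar> \<le> min 1 (e / 2)" for x t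
    proof -
      have "(x, 0) \<in> S" "(x, t) \<in> S" using that by (auto simp: S_def abs_le_iff)
      moreover have "dist (x, t) (x, 0) < e" using that e(1) by (auto simp: dist_Pair_Pair dist_real_def)
      ultimately have "dist (fd x t) (fd x 0) < V0 / 4" using e(2)[of "(x, 0)" "(x, t)"] by simp
      then show ?thesis by (simp add: fd_zero dist_real_def)
    qed
    then show ?thesis using that[of "min 1 (e / 2)"] e(1) by simp
  qed
  \<comment> \<open>For \<bar>t\<bar> above \<open>d\<close> the square of \<open>t\<close> is at
    most \<open>d powr (2 - q)\<close> times the power with exponent \<open>q\<close>, so the global
    quadratic part can be charged to that power.\<close>
  define C where "C = a1 * d powr (2 - q) + a2"
  have C: "0 \<le> C" "a2 \<le> C" using a_pos by (simp_all add: C_def)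
  have "F x t \<le> V x / 4 * t\<^sup>2 + C * \<bar>t\<bar> powr q" for x t
  proof -
    have aC: "a2 * \<bar>t\<bar> powr q \<le> C * \<bar>t\<bar> powr q" using C by (intro mult_right_mono) auto
    have pos: "0 \<le> C * \<bar>t\<bar> powr q" "0 \<le> V x / 4 * t\<^sup>2" using C V_nonneg[of x] by auto
    consider "R \<le> norm x" | "norm x \<le> R" "\<bar>t\<bar> \<le> d" | "d < \<bar>t\<bar>" by linarith
    then show ?thesis
    proof cases
      case 1
      have "a1 * t\<^sup>2 \<le> V x / 4 * t\<^sup>2" using R[OF 1] by (intro mult_right_mono) auto
      then show ?thesis using glob[of x t] aC by linarith
    next
      case 2
      have "F x t \<le> V0 / 4 * t\<^sup>2" using 2 d(2) by (intro bnd) auto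
      also have "\<dots> \<le> V x / 4 * t\<^sup>2" using V0 by (intro mult_right_mono) auto
      finally show ?thesis using pos by linarith
    next
      case 3
      have "t\<^sup>2 \<le> d powr (2 - q) * \<bar>t\<bar> powr q"
      proof -
        have "d powr (q - 2) \<le> \<bar>t\<bar> powr (q - 2)" using 3 d q_bounds by (intro powr_mono2) auto
        then have "d powr (2 - q) * d powr (q - 2) \<le> d powr (2 - q) * \<bar>t\<bar> powr (q - 2)"
          by (intro mult_left_mono) auto
        then have "1 \<le> d powr (2 - q) * \<bar>t\<bar> powr (q - 2)"
          using d(1) by (simp add: powr_add[symmetric])
        then have "1 * t\<^sup>2 \<le> d powr (2 - q) * \<bar>t\<bar> powr (q - 2) * t\<^sup>2" by (intro mult_right_mono) auto
        then show ?thesis using sp[of t] by (simp add: q_def mult.assoc)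
      qed
      then have "a1 * t\<^sup>2 \<le> a1 * (d powr (2 - q) * \<bar>t\<bar> powr q)" using a_pos by (intro mult_left_mono) auto
      then show ?thesis using glob[of x t] pos by (simp add: C_def algebra_simps)
    qed
  qed
  then show ?thesis using C by blast
qed

section \<open>Measurability of the compositions with the nonlinearity\<close>

lemma f_measurable [measurable]: "(\<lambda>z. f (fst z) (snd z)) \<in> borel_measurable (borel \<Otimes>\<^sub>M borel)"
proof -
  have "(\<lambda>z. f (fst z) (snd z)) \<in> borel_measurable borel"
    using borel_measurable_continuous_onI[OF f_continuous] by (simp add: case_prod_beta')
  then show ?thesis by (simp add: borel_prod)
qed

lemma f_comp_measurable [measurable]:
  assumes [measurable]: "u \<in> borel_measurable borel" shows "(\<lambda>x. f x (u x)) \<in> borel_measurable borel"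
proof -
  have "(\<lambda>x. (x, u x)) \<in> borel \<rightarrow>\<^sub>M borel \<Otimes>\<^sub>M borel" by measurable
  from measurable_compose[OF this f_measurable] show ?thesis by simp
qed

text \<open>The oriented integral is rewritten over the whole line with a signed indicator, so that
  \<open>x\<close> enters through a jointly measurable integrand.\<close>

lemma F_comp_measurable [measurable]:
  assumes [measurable]: "u \<in> borel_measurable borel" shows "(\<lambda>x. F x (u x)) \<in> borel_measurable borel"
proof -
  define g where "g = (\<lambda>x \<tau>. (indicator {y. 0 \<le> y \<and> y \<le> u x} \<tau> - indicator {y. u x \<le> y \<and> y \<le> 0} \<tau>) * f x \<tau>)"
  have eq: "F x (u x) = (\<integral>\<tau>. g x \<tau> \<partial>lborel)" for x
  proof (cases "0 \<le> u x")
    case True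
    \<comment> \<open>For \<open>u x = 0\<close> both indicators contain the point 0; there the
      integrand vanishes.\<close>
    have z: "f x \<tau> = 0" if "u x \<le> \<tau>" "\<tau> \<le> 0" for \<tau>
      using that True f_zero[of x] by (metis order.antisym order.trans)
    have "F x (u x) = (LBINT \<tau>:{0..u x}. f x \<tau>)"
      unfolding F_def using True interval_integral_Icc[of "0::real" "u x" "f x"] by (simp add: zero_ereal_def)
    also have "\<dots> = (\<integral>\<tau>. g x \<tau> \<partial>lborel)"
      unfolding set_lebesgue_integral_def g_def
      by (rule Bochner_Integration.integral_cong)
        (use True z in \<open>auto simp: indicator_def\<close>)
    finally show ?thesis .
  next
    case False
    have "F x (u x) = - (LBINT \<tau>:{u x..0}. f x \<tau>)"
      unfolding F_def using False interval_integral_Icc[of "u x" "0::real" "f x"]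
      by (subst interval_integral_endpoints_reverse) (simp add: zero_ereal_def)
    also have "\<dots> = (\<integral>\<tau>. g x \<tau> \<partial>lborel)"
      unfolding set_lebesgue_integral_def g_def integral_minus[symmetric]
      by (rule Bochner_Integration.integral_cong) (use False in \<open>auto simp: indicator_def\<close>)
    finally show ?thesis .
  qed
  have "(\<lambda>(x, \<tau>). g x \<tau>) \<in> borel_measurable (borel \<Otimes>\<^sub>M lborel)"
  proof -
    have [measurable]: "(\<lambda>z. f (fst z) (snd z)) \<in> borel_measurable (borel \<Otimes>\<^sub>M lborel)"
      using f_measurable by (simp cong: measurable_cong_sets)
    show ?thesis unfolding g_def indicator_def of_bool_def by measurable
  qed
  then show ?thesis unfolding eq by measurable
qed

end

section \<open>Integral bounds for the nonlinearity\<close>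

lemma L2_abs: "u \<in> L2 M \<Longrightarrow> (\<lambda>x. \<bar>u x\<bar>) \<in> L2 M" "L2.N M (\<lambda>x. \<bar>u x\<bar>) = L2.N M u"
  for u :: "'a \<Rightarrow> real"
proof -
  show "u \<in> L2 M \<Longrightarrow> (\<lambda>x. \<bar>u x\<bar>) \<in> L2 M" by (auto simp: L2_def)
  show "L2.N M (\<lambda>x. \<bar>u x\<bar>) = L2.N M u" by (simp add: L2.N_def ip_def)
qed

lemma L2_abs_product:
  fixes u v :: "'a \<Rightarrow> real"
  assumes "u \<in> L2 M" "v \<in> L2 M"
  shows "integrable M (\<lambda>x. \<bar>u x\<bar> * \<bar>v x\<bar>)" "(\<integral>x. \<bar>u x\<bar> * \<bar>v x\<bar> \<partial>M) \<le> L2.N M u * L2.N M v"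
  using L2_inner_integrable[OF L2_abs(1)[OF assms(1)] L2_abs(1)[OF assms(2)]]
    L2.cauchy_schwarz[OF L2_abs(1)[OF assms(1)] L2_abs(1)[OF assms(2)]]
  by (simp_all add: ip_def L2_abs(2))

context schroedinger
begin

text \<open>Chosen so that \<open>g0 * E.N u\<close> bounds both the L^2 norm and the translation
  constant of \<open>u\<close>.\<close>

definition g0 :: real where "g0 = max (1 / sqrt V0) 2"

lemma g0: "g0 > 0" "1 / sqrt V0 \<le> g0" "2 \<le> g0" by (auto simp: g0_def)

lemma Es_hoelder:
  assumes u: "u \<in> Es" and G: "g0 * E.N u \<le> G" shows "L2_hoelder s G u"
proof -
  have n: "0 \<le> E.N u" using u by simp
  have "L2.N lborel u \<le> (1 / sqrt V0) * E.N u" using L2_le_NE[OF u] by simp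
  also have "\<dots> \<le> g0 * E.N u" using g0 n by (intro mult_right_mono) auto
  finally have 1: "L2.N lborel u \<le> G" using G by simp
  have "L2.N lborel (translate h u - u) \<le> G * norm h powr s" for h
  proof -
    have "2 * E.N u \<le> g0 * E.N u" using g0 n by (intro mult_right_mono) auto
    then have "2 * E.N u * norm h powr s \<le> G * norm h powr s" using G by (intro mult_right_mono) auto
    then show ?thesis using Es_translate[OF u, of h] by linarith
  qed
  moreover have "0 \<le> G" using G g0 n by (meson mult_nonneg_nonneg less_imp_le order.trans)
  ultimately show ?thesis using 1 Es_L2[OF u] by (simp add: L2_hoelder_def)
qed

text \<open>\<open>Lq_estimate\<close> for balls of arbitrary radius, by scaling into the unit
  Nikolskii ball. On bounded sets of the energy space a small L^2 norm thus forces a small L^q norm,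
  up to an \<epsilon> fixed in advance; this stands in for interpolation with the critical
  exponent.\<close>

lemma Lq_small_nn:
  assumes \<epsilon>: "\<epsilon> > 0" and R: "R > 0"
  shows "\<exists>C\<ge>0. \<forall>u\<in>Es. E.N u \<le> R \<longrightarrow> (\<integral>\<^sup>+x. ennreal (\<bar>u x\<bar> powr q) \<partial>lborel) \<le> ennreal (C * (L2.N lborel u)\<^sup>2 + \<epsilon>)"
proof -
  define k where "k = g0 * R"
  have k: "k > 0" using g0 R by (simp add: k_def)
  \<comment> \<open>Scaling back multiplies the integral by \<open>k powr q\<close>, so the error is
    divided by that factor beforehand.\<close>
  have "\<epsilon> / k powr q > 0" using \<epsilon> k by simp
  from Lq_estimate[OF s(1) dim q_bounds this] obtain C where C: "C \<ge> 0"
    "\<And>u::'a\<Rightarrow>real. L2_hoelder s 1 u \<Longrightarrow> (\<integral>\<^sup>+x. ennreal (\<bar>u x\<bar> powr q) \<partial>lborel) \<le> ennreal (C * (L2.N lborel u)\<^sup>2 + \<epsilon> / k powr q)"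
    by blast
  have "(\<integral>\<^sup>+x. ennreal (\<bar>u x\<bar> powr q) \<partial>lborel) \<le> ennreal (k powr q * C / k\<^sup>2 * (L2.N lborel u)\<^sup>2 + \<epsilon>)"
    if u: "u \<in> Es" "E.N u \<le> R" for u
  proof -
    define v where "v = (1 / k) *\<^sub>R u"
    have [measurable]: "u \<in> borel_measurable borel" by (rule L2_borel[OF Es_L2[OF u(1)]])
    have v: "v \<in> Es" using u by (simp add: v_def)
    have Nv: "E.N v = E.N u / k" "L2.N lborel v = L2.N lborel u / k"
      using u k by (simp_all add: v_def E.N_scale L2.N_scale Es_L2)
    have "g0 * E.N v \<le> 1" using u k g0 R by (simp add: Nv k_def)
    from C(2)[OF Es_hoelder[OF v this]]
    have le: "(\<integral>\<^sup>+x. ennreal (\<bar>v x\<bar> powr q) \<partial>lborel) \<le> ennreal (C * (L2.N lborel v)\<^sup>2 + \<epsilon> / k powr q)" .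
    have "(\<integral>\<^sup>+x. ennreal (\<bar>u x\<bar> powr q) \<partial>lborel) = (\<integral>\<^sup>+x. ennreal (k powr q) * ennreal (\<bar>v x\<bar> powr q) \<partial>lborel)"
    proof (rule nn_integral_cong)
      fix x
      have "\<bar>u x\<bar> = k * \<bar>v x\<bar>" using k by (simp add: v_def abs_mult)
      then show "ennreal (\<bar>u x\<bar> powr q) = ennreal (k powr q) * ennreal (\<bar>v x\<bar> powr q)"
        using k by (simp add: powr_mult ennreal_mult)
    qed
    also have "\<dots> = ennreal (k powr q) * (\<integral>\<^sup>+x. ennreal (\<bar>v x\<bar> powr q) \<partial>lborel)"
      by (rule nn_integral_cmult) (simp add: v_def)
    also have "\<dots> \<le> ennreal (k powr q) * ennreal (C * (L2.N lborel v)\<^sup>2 + \<epsilon> / k powr q)"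
      by (intro mult_left_mono le) simp
    also have "\<dots> = ennreal (k powr q * C / k\<^sup>2 * (L2.N lborel u)\<^sup>2 + \<epsilon>)"
      using C(1) \<epsilon> k unfolding Nv by (subst ennreal_mult[symmetric]) (auto simp: field_simps power_divide)
    finally show ?thesis .
  qed
  moreover have "0 \<le> k powr q * C / k\<^sup>2" using C(1) by simp
  ultimately show ?thesis by blast
qed

lemma Lq_integrable:
  assumes u: "u \<in> Es" shows "integrable lborel (\<lambda>x. \<bar>u x\<bar> powr q)"
proof -
  have [measurable]: "u \<in> borel_measurable borel" by (rule L2_borel[OF Es_L2[OF u]])
  have "0 < E.N u + 1" using E.N_nonneg[OF u] by linarith
  from Lq_small_nn[OF zero_less_one this] obtain C where
    "(\<integral>\<^sup>+x. ennreal (\<bar>u x\<bar> powr q) \<partial>lborel) \<le> ennreal (C * (L2.N lborel u)\<^sup>2 + 1)"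
    using u by fastforce
  also have "\<dots> < \<infinity>" by simp
  finally show ?thesis by (intro integrableI_bounded) auto
qed

lemma Lq_small:
  assumes \<epsilon>: "\<epsilon> > 0" and R: "R > 0"
  shows "\<exists>C\<ge>0. \<forall>u\<in>Es. E.N u \<le> R \<longrightarrow> (\<integral>x. \<bar>u x\<bar> powr q \<partial>lborel) \<le> C * (L2.N lborel u)\<^sup>2 + \<epsilon>"
proof -
  obtain C where C: "C \<ge> 0" "\<And>u. u \<in> Es \<Longrightarrow> E.N u \<le> R \<Longrightarrow> (\<integral>\<^sup>+x. ennreal (\<bar>u x\<bar> powr q) \<partial>lborel) \<le> ennreal (C * (L2.N lborel u)\<^sup>2 + \<epsilon>)"
    using Lq_small_nn[OF assms] by blast
  have "(\<integral>x. \<bar>u x\<bar> powr q \<partial>lborel) \<le> C * (L2.N lborel u)\<^sup>2 + \<epsilon>" if "u \<in> Es" "E.N u \<le> R" for u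
  proof -
    have "ennreal (\<integral>x. \<bar>u x\<bar> powr q \<partial>lborel) \<le> ennreal (C * (L2.N lborel u)\<^sup>2 + \<epsilon>)"
      using C(2)[OF that] nn_integral_eq_integral[OF Lq_integrable[OF that(1)]] by simp
    then show ?thesis using C(1) \<epsilon> by (subst (asm) ennreal_le_iff) auto
  qed
  then show ?thesis using C(1) by blast
qed

lemma Lq_scale:
  fixes u :: "'a \<Rightarrow> real"
  assumes "c \<ge> 0" shows "(\<integral>x. \<bar>(c *\<^sub>R u) x\<bar> powr q \<partial>lborel) = c powr q * (\<integral>x. \<bar>u x\<bar> powr q \<partial>lborel)"
  using assms by (simp add: abs_mult powr_mult)

lemma Es_zero_AE: assumes u: "u \<in> Es" "E.N u = 0" shows "AE x in lborel. u x = 0"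
proof -
  have "L2.N lborel u = 0" using L2_le_NE[OF u(1)] u(2) L2.N_nonneg[OF Es_L2[OF u(1)]] by simp
  then show ?thesis by (rule L2_N_zero_AE[OF Es_L2[OF u(1)]])
qed

text \<open>The bound on the unit ball extends by homogeneity. A function of seminorm zero cannot be
  normalised, but it vanishes almost everywhere.\<close>

lemma Lq_bound: "\<exists>S>0. \<forall>u\<in>Es. (\<integral>x. \<bar>u x\<bar> powr q \<partial>lborel) \<le> (S * E.N u) powr q"
proof -
  obtain C where C: "C \<ge> 0" "\<And>u. u \<in> Es \<Longrightarrow> E.N u \<le> 1 \<Longrightarrow> (\<integral>x. \<bar>u x\<bar> powr q \<partial>lborel) \<le> C * (L2.N lborel u)\<^sup>2 + 1"
    using Lq_small[OF zero_less_one zero_less_one] by blast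
  define T where "T = C * (1 / sqrt V0)\<^sup>2 + 1"
  have T: "T > 0" using C by (simp add: T_def add_nonneg_pos)
  have unit: "(\<integral>x. \<bar>u x\<bar> powr q \<partial>lborel) \<le> T" if "u \<in> Es" "E.N u \<le> 1" for u
  proof -
    have "L2.N lborel u \<le> 1 / sqrt V0"
      using L2_le_NE[OF that(1)] divide_right_mono[OF that(2), of "sqrt V0"] V0 by simp
    then have "C * (L2.N lborel u)\<^sup>2 \<le> C * (1 / sqrt V0)\<^sup>2"
      using C(1) L2.N_nonneg[OF Es_L2[OF that(1)]] by (intro mult_left_mono power_mono) auto
    then show ?thesis using C(2)[OF that] by (simp add: T_def)
  qed
  define S where "S = T powr (1 / q)"
  have S: "S > 0" "S powr q = T" using T q_bounds by (auto simp: S_def powr_powr)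
  have "(\<integral>x. \<bar>u x\<bar> powr q \<partial>lborel) \<le> (S * E.N u) powr q" if u: "u \<in> Es" for u
  proof (cases "E.N u = 0")
    case True
    have [measurable]: "u \<in> borel_measurable borel" by (rule L2_borel[OF Es_L2[OF u]])
    have "(\<integral>x. \<bar>u x\<bar> powr q \<partial>lborel) = (\<integral>x. 0 \<partial>(lborel::'a measure))"
      by (rule integral_cong_AE) (use Es_zero_AE[OF u True] in auto)
    then show ?thesis by simp
  next
    case False
    then have n: "E.N u > 0" using E.N_nonneg[OF u] by simp
    define v where "v = (1 / E.N u) *\<^sub>R u"
    have v: "v \<in> Es" "E.N v = 1" using u n by (simp_all add: v_def E.N_scale)
    have uv: "u = E.N u *\<^sub>R v" using n by (simp add: v_def)
    have "(\<integral>x. \<bar>u x\<bar> powr q \<partial>lborel) = (\<integral>x. \<bar>(E.N u *\<^sub>R v) x\<bar> powr q \<partial>lborel)"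
      by (subst uv) (rule refl)
    also have "\<dots> = E.N u powr q * (\<integral>x. \<bar>v x\<bar> powr q \<partial>lborel)" using n by (intro Lq_scale) simp
    also have "\<dots> \<le> E.N u powr q * T" using unit[OF v(1)] v(2) by (intro mult_left_mono) auto
    also have "\<dots> = (S * E.N u) powr q" using S n by (simp add: powr_mult)
    finally show ?thesis .
  qed
  then show ?thesis using S by blast
qed

definition S :: real where "S = (SOME S. S > 0 \<and> (\<forall>u\<in>Es. (\<integral>x. \<bar>u x\<bar> powr q \<partial>lborel) \<le> (S * E.N u) powr q))"

lemma S: "S > 0" "u \<in> Es \<Longrightarrow> (\<integral>x. \<bar>u x\<bar> powr q \<partial>lborel) \<le> (S * E.N u) powr q"
  using someI_ex[OF Lq_bound[unfolded Bex_def]] unfolding S_def[symmetric] by auto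

text \<open>Replace every factor by the largest of the three; the exponents add up to
  \<open>q\<close>, and that power is one of the summands.\<close>

lemma young3:
  fixes a b c :: real assumes "0 \<le> a" "0 \<le> b" "0 \<le> c"
  shows "a powr (p - 1) * b * c \<le> a powr q + b powr q + c powr q"
proof -
  define m where "m = max a (max b c)"
  have m: "0 \<le> m" "a \<le> m" "b \<le> m" "c \<le> m" using assms by (auto simp: m_def)
  have "a powr (p - 1) * b * c \<le> m powr (p - 1) * m * m"
    using assms m p by (intro mult_mono powr_mono2) auto
  also have "\<dots> = m powr q"
  proof (cases "m = 0")
    case False
    then have "m powr (p - 1) * m powr 1 * m powr 1 = m powr (p - 1 + 1 + 1)" by (simp only: powr_add)
    then show ?thesis using m by (simp add: q_def)
  qed (simp add: q_def)
  also have "\<dots> \<le> a powr q + b powr q + c powr q" by (auto simp: m_def max_def)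
  finally show ?thesis .
qed

text \<open>Young's inequality after normalising \<open>b\<close> and \<open>c\<close> takes the place of Hoelder's inequality.\<close>

lemma trilinear:
  fixes a b c :: "'a \<Rightarrow> real"
  assumes [measurable]: "a \<in> borel_measurable borel" "b \<in> borel_measurable borel" "c \<in> borel_measurable borel"
    and int: "integrable lborel (\<lambda>x. \<bar>a x\<bar> powr q)" "integrable lborel (\<lambda>x. \<bar>b x\<bar> powr q)" "integrable lborel (\<lambda>x. \<bar>c x\<bar> powr q)"
    and A: "(\<integral>x. \<bar>a x\<bar> powr q \<partial>lborel) \<le> A"
    and \<beta>: "(\<integral>x. \<bar>b x\<bar> powr q \<partial>lborel) \<le> \<beta> powr q" "0 \<le> \<beta>"
    and \<gamma>: "(\<integral>x. \<bar>c x\<bar> powr q \<partial>lborel) \<le> \<gamma> powr q" "0 \<le> \<gamma>"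
  shows "integrable lborel (\<lambda>x. \<bar>a x\<bar> powr (p - 1) * (\<bar>b x\<bar> * \<bar>c x\<bar>))"
    and "(\<integral>x. \<bar>a x\<bar> powr (p - 1) * (\<bar>b x\<bar> * \<bar>c x\<bar>) \<partial>lborel) \<le> (A + 2) * \<beta> * \<gamma>"
proof -
  show i: "integrable lborel (\<lambda>x. \<bar>a x\<bar> powr (p - 1) * (\<bar>b x\<bar> * \<bar>c x\<bar>))"
  proof (rule Bochner_Integration.integrable_bound)
    show "integrable lborel (\<lambda>x. \<bar>a x\<bar> powr q + \<bar>b x\<bar> powr q + \<bar>c x\<bar> powr q)" using int by simp
    show "AE x in lborel. norm (\<bar>a x\<bar> powr (p - 1) * (\<bar>b x\<bar> * \<bar>c x\<bar>)) \<le> norm (\<bar>a x\<bar> powr q + \<bar>b x\<bar> powr q + \<bar>c x\<bar> powr q)"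
      using young3[of "\<bar>a x\<bar>" "\<bar>b x\<bar>" "\<bar>c x\<bar>" for x] by (simp add: abs_mult mult.assoc)
  qed measurable
  have zero: "AE x in lborel. g x = 0" if "integrable lborel (\<lambda>x. \<bar>g x\<bar> powr q)" "(\<integral>x. \<bar>g x\<bar> powr q \<partial>lborel) \<le> 0" for g :: "'a \<Rightarrow> real"
  proof -
    have "0 \<le> (\<integral>x. \<bar>g x\<bar> powr q \<partial>lborel)" by (rule integral_nonneg_AE) simp
    then have "(\<integral>x. \<bar>g x\<bar> powr q \<partial>lborel) = 0" using that(2) by linarith
    then have "AE x in lborel. \<bar>g x\<bar> powr q = 0"
      using integral_nonneg_eq_0_iff_AE[OF that(1)] by simp
    then show ?thesis by eventually_elim simp
  qed
  show "(\<integral>x. \<bar>a x\<bar> powr (p - 1) * (\<bar>b x\<bar> * \<bar>c x\<bar>) \<partial>lborel) \<le> (A + 2) * \<beta> * \<gamma>"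
  \<comment> \<open>Normalising divides by \<beta> and \<gamma>. If one of them is 0, the
    corresponding function vanishes almost everywhere. The factor \<open>a\<close> is not
    normalised, which is why \<open>A\<close> enters additively.\<close>
  proof (cases "\<beta> = 0 \<or> \<gamma> = 0")
    case True
    then have "(AE x in lborel. b x = 0) \<or> (AE x in lborel. c x = 0)"
      using zero[OF int(2)] zero[OF int(3)] \<beta> \<gamma> by auto
    then have "AE x in lborel. \<bar>a x\<bar> powr (p - 1) * (\<bar>b x\<bar> * \<bar>c x\<bar>) = 0"
      by (elim disjE; elim eventually_mono; simp)
    then have "(\<integral>x. \<bar>a x\<bar> powr (p - 1) * (\<bar>b x\<bar> * \<bar>c x\<bar>) \<partial>lborel) = 0"
      by (rule integral_eq_zero_AE)
    then show ?thesis using True by auto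
  next
    case False
    then have pos: "\<beta> > 0" "\<gamma> > 0" using \<beta> \<gamma> by auto
    have pw: "\<bar>a x\<bar> powr (p - 1) * (\<bar>b x\<bar> * \<bar>c x\<bar>)
        \<le> (\<beta> * \<gamma>) * (\<bar>a x\<bar> powr q + \<bar>b x\<bar> powr q / \<beta> powr q + \<bar>c x\<bar> powr q / \<gamma> powr q)" for x
    proof -
      have "\<bar>a x\<bar> powr (p - 1) * (\<bar>b x\<bar> / \<beta>) * (\<bar>c x\<bar> / \<gamma>) \<le> \<bar>a x\<bar> powr q + (\<bar>b x\<bar> / \<beta>) powr q + (\<bar>c x\<bar> / \<gamma>) powr q"
        using pos by (intro young3) auto
      then have "(\<beta> * \<gamma>) * (\<bar>a x\<bar> powr (p - 1) * (\<bar>b x\<bar> / \<beta>) * (\<bar>c x\<bar> / \<gamma>))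
          \<le> (\<beta> * \<gamma>) * (\<bar>a x\<bar> powr q + (\<bar>b x\<bar> / \<beta>) powr q + (\<bar>c x\<bar> / \<gamma>) powr q)"
        using pos by (intro mult_left_mono) auto
      moreover have "(\<beta> * \<gamma>) * (\<bar>a x\<bar> powr (p - 1) * (\<bar>b x\<bar> / \<beta>) * (\<bar>c x\<bar> / \<gamma>)) = \<bar>a x\<bar> powr (p - 1) * (\<bar>b x\<bar> * \<bar>c x\<bar>)"
        using pos by (simp add: field_simps)
      ultimately show ?thesis using pos by (simp add: powr_divide)
    qed
    have "(\<integral>x. \<bar>a x\<bar> powr (p - 1) * (\<bar>b x\<bar> * \<bar>c x\<bar>) \<partial>lborel)
      \<le> (\<integral>x. (\<beta> * \<gamma>) * (\<bar>a x\<bar> powr q + \<bar>b x\<bar> powr q / \<beta> powr q + \<bar>c x\<bar> powr q / \<gamma> powr q) \<partial>lborel)"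
      using int by (intro integral_mono i pw) auto
    also have "\<dots> = (\<beta> * \<gamma>) * ((\<integral>x. \<bar>a x\<bar> powr q \<partial>lborel) + (\<integral>x. \<bar>b x\<bar> powr q \<partial>lborel) / \<beta> powr q
        + (\<integral>x. \<bar>c x\<bar> powr q \<partial>lborel) / \<gamma> powr q)"
      using int by simp
    also have "\<dots> \<le> (\<beta> * \<gamma>) * (A + 1 + 1)"
      using pos A \<beta>(1) \<gamma>(1) by (intro mult_left_mono add_mono) (auto simp: divide_le_eq)
    finally show ?thesis by (simp add: algebra_simps)
  qed
qed

lemma Es_borel: "u \<in> Es \<Longrightarrow> u \<in> borel_measurable borel"
  by (rule L2_borel[OF Es_L2])

text \<open>With \<open>\<beta>\<close> proportional to \<open>E.N b\<close> this gives Lipschitz continuity of the gradient; with \<open>\<beta>\<close>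
  independent of \<open>E.N b\<close> it gives compactness.\<close>

lemma weight_integral:
  assumes uv: "u \<in> Es" "v \<in> Es" "E.N u \<le> R" "E.N v \<le> R" and b: "b \<in> Es" and c: "c \<in> Es"
    and \<beta>: "(\<integral>x. \<bar>b x\<bar> powr q \<partial>lborel) \<le> \<beta> powr q" "0 \<le> \<beta>"
  defines "w \<equiv> \<lambda>x. (a1 + a2 * (\<bar>u x\<bar> powr (p - 1) + \<bar>v x\<bar> powr (p - 1))) * (\<bar>b x\<bar> * \<bar>c x\<bar>)"
  shows "integrable lborel w"
    and "(\<integral>x. w x \<partial>lborel) \<le> (a1 * L2.N lborel b / sqrt V0 + 2 * a2 * ((S * R) powr q + 2) * \<beta> * S) * E.N c"
proof -
  note [measurable] = Es_borel[OF uv(1)] Es_borel[OF uv(2)] Es_borel[OF b] Es_borel[OF c]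
  have Sc: "0 \<le> S * E.N c" using S(1) c by simp
  have A: "(\<integral>x. \<bar>z x\<bar> powr q \<partial>lborel) \<le> (S * R) powr q" if "z \<in> Es" "E.N z \<le> R" for z
  proof -
    have "(S * E.N z) powr q \<le> (S * R) powr q"
      using S(1) that q_bounds by (intro powr_mono2 mult_left_mono) auto
    then show ?thesis using S(2)[OF that(1)] by linarith
  qed
  note t1 = trilinear[OF Es_borel[OF uv(1)] Es_borel[OF b] Es_borel[OF c] Lq_integrable[OF uv(1)] Lq_integrable[OF b] Lq_integrable[OF c]
      A[OF uv(1,3)] \<beta> S(2)[OF c] Sc]
  note t2 = trilinear[OF Es_borel[OF uv(2)] Es_borel[OF b] Es_borel[OF c] Lq_integrable[OF uv(2)] Lq_integrable[OF b] Lq_integrable[OF c]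
      A[OF uv(2,4)] \<beta> S(2)[OF c] Sc]
  note cs = L2_abs_product[OF Es_L2[OF b] Es_L2[OF c]]
  have w: "w x = a1 * (\<bar>b x\<bar> * \<bar>c x\<bar>) + a2 * (\<bar>u x\<bar> powr (p - 1) * (\<bar>b x\<bar> * \<bar>c x\<bar>)) + a2 * (\<bar>v x\<bar> powr (p - 1) * (\<bar>b x\<bar> * \<bar>c x\<bar>))" for x
    by (simp add: w_def algebra_simps)
  show "integrable lborel w" unfolding w[abs_def] using t1(1) t2(1) cs(1) by simp
  have "(\<integral>x. w x \<partial>lborel) = a1 * (\<integral>x. \<bar>b x\<bar> * \<bar>c x\<bar> \<partial>lborel) + a2 * (\<integral>x. \<bar>u x\<bar> powr (p - 1) * (\<bar>b x\<bar> * \<bar>c x\<bar>) \<partial>lborel)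
     + a2 * (\<integral>x. \<bar>v x\<bar> powr (p - 1) * (\<bar>b x\<bar> * \<bar>c x\<bar>) \<partial>lborel)"
    unfolding w using t1(1) t2(1) cs(1) by simp
  also have "\<dots> \<le> a1 * (L2.N lborel b * (E.N c / sqrt V0)) + a2 * (((S * R) powr q + 2) * \<beta> * (S * E.N c))
     + a2 * (((S * R) powr q + 2) * \<beta> * (S * E.N c))"
  proof (intro add_mono mult_left_mono t1(2) t2(2))
    have "L2.N lborel b * L2.N lborel c \<le> L2.N lborel b * (E.N c / sqrt V0)"
      using L2_le_NE[OF c] L2.N_nonneg[OF Es_L2[OF b]] by (intro mult_left_mono) auto
    then show "(\<integral>x. \<bar>b x\<bar> * \<bar>c x\<bar> \<partial>lborel) \<le> L2.N lborel b * (E.N c / sqrt V0)" using cs(2) by linarith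
  qed (use a_pos in auto)
  also have "\<dots> = (a1 * L2.N lborel b / sqrt V0 + 2 * a2 * ((S * R) powr q + 2) * \<beta> * S) * E.N c"
    by (simp add: algebra_simps add_divide_distrib)
  finally show "(\<integral>x. w x \<partial>lborel) \<le> (a1 * L2.N lborel b / sqrt V0 + 2 * a2 * ((S * R) powr q + 2) * \<beta> * S) * E.N c" .
qed

end

section \<open>The energy functional\<close>

context schroedinger
begin

definition \<Psi> :: "('a \<Rightarrow> real) \<Rightarrow> real" where "\<Psi> u = (\<integral>x. F x (u x) \<partial>lborel)"

definition l :: "('a \<Rightarrow> real) \<Rightarrow> ('a \<Rightarrow> real) \<Rightarrow> real" where "l u w = (\<integral>x. f x (u x) * w x \<partial>lborel)"

text \<open>\<delta> bounds the L^2 norm and \<beta> the L^q norm of a difference: the constant part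
  \<open>a1\<close> of the weight is paid for by \<delta>, the power part \<open>a2\<close> by
  \<beta>. Both small makes the difference of \<open>K\<close> small.\<close>

definition Lc :: "real \<Rightarrow> real \<Rightarrow> real \<Rightarrow> real" where
  "Lc R \<delta> \<beta> = a1 * \<delta> / sqrt V0 + 2 * a2 * ((S * R) powr q + 2) * \<beta> * S"

lemma f_diff_integral:
  assumes uv: "u \<in> Es" "v \<in> Es" "E.N u \<le> R" "E.N v \<le> R" and w: "w \<in> Es"
    and \<beta>: "(\<integral>x. \<bar>(u - v) x\<bar> powr q \<partial>lborel) \<le> \<beta> powr q" "0 \<le> \<beta>"
  shows "integrable lborel (\<lambda>x. (f x (u x) - f x (v x)) * w x)"
    and "\<bar>\<integral>x. (f x (u x) - f x (v x)) * w x \<partial>lborel\<bar> \<le> Lc R (L2.N lborel (u - v)) \<beta> * E.N w"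
proof -
  have d: "u - v \<in> Es" using uv by simp
  note [measurable] = Es_borel[OF uv(1)] Es_borel[OF uv(2)] Es_borel[OF w]
  note W = weight_integral[OF uv d w \<beta>]
  have pw: "\<bar>(f x (u x) - f x (v x)) * w x\<bar>
     \<le> (a1 + a2 * (\<bar>u x\<bar> powr (p - 1) + \<bar>v x\<bar> powr (p - 1))) * (\<bar>(u - v) x\<bar> * \<bar>w x\<bar>)" for x
    using mult_right_mono[OF f_diff_le[of x "u x" "v x"], of "\<bar>w x\<bar>"] by (simp add: abs_mult mult.assoc)
  show i: "integrable lborel (\<lambda>x. (f x (u x) - f x (v x)) * w x)"
    by (rule Bochner_Integration.integrable_bound[OF W(1)])
      (use order.trans[OF pw abs_ge_self] in \<open>auto simp del: minus_apply\<close>)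
  have "\<bar>\<integral>x. (f x (u x) - f x (v x)) * w x \<partial>lborel\<bar> \<le> (\<integral>x. \<bar>(f x (u x) - f x (v x)) * w x\<bar> \<partial>lborel)"
    by (rule integral_abs_bound)
  also have "\<dots> \<le> (\<integral>x. (a1 + a2 * (\<bar>u x\<bar> powr (p - 1) + \<bar>v x\<bar> powr (p - 1))) * (\<bar>(u - v) x\<bar> * \<bar>w x\<bar>) \<partial>lborel)"
    using i W(1) by (intro integral_mono pw) auto
  also have "\<dots> \<le> Lc R (L2.N lborel (u - v)) \<beta> * E.N w" using W(2) by (simp only: Lc_def)
  finally show "\<bar>\<integral>x. (f x (u x) - f x (v x)) * w x \<partial>lborel\<bar> \<le> Lc R (L2.N lborel (u - v)) \<beta> * E.N w" .
qed

lemma l_integrable: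
  assumes u: "u \<in> Es" and w: "w \<in> Es" shows "integrable lborel (\<lambda>x. f x (u x) * w x)"
    and "\<bar>l u w\<bar> \<le> Lc (E.N u) (L2.N lborel u) (S * E.N u) * E.N w"
  \<comment> \<open>Comparison with the zero function, on which \<open>f\<close> vanishes.\<close>
  using f_diff_integral[OF u E.E_zero order_refl _ w, of "S * E.N u"] S(1) S(2)[OF u] E.N_nonneg[OF u]
  by (simp_all add: f_zero l_def)

lemma l_diff:
  assumes uv: "u \<in> Es" "v \<in> Es" "E.N u \<le> R" "E.N v \<le> R" and w: "w \<in> Es"
    and \<beta>: "(\<integral>x. \<bar>(u - v) x\<bar> powr q \<partial>lborel) \<le> \<beta> powr q" "0 \<le> \<beta>"
  shows "\<bar>l u w - l v w\<bar> \<le> Lc R (L2.N lborel (u - v)) \<beta> * E.N w"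
proof -
  have "l u w - l v w = (\<integral>x. (f x (u x) - f x (v x)) * w x \<partial>lborel)"
    using l_integrable(1)[OF uv(1) w] l_integrable(1)[OF uv(2) w] by (simp add: l_def left_diff_distrib)
  then show ?thesis using f_diff_integral(2)[OF assms] by simp
qed

lemma l_riesz: assumes u: "u \<in> Es" shows "\<exists>k\<in>Es. \<forall>w\<in>Es. BE k w = l u w"
proof (rule E.riesz)
  show "l u (v + w) = l u v + l u w" if "v \<in> Es" "w \<in> Es" for v w
    using l_integrable(1)[OF u that(1)] l_integrable(1)[OF u that(2)] by (simp add: l_def distrib_left)
  show "l u (r *\<^sub>R w) = r * l u w" if "w \<in> Es" for w r
    by (simp add: l_def mult.left_commute)
  show "\<bar>l u w\<bar> \<le> Lc (E.N u) (L2.N lborel u) (S * E.N u) * E.N w" if "w \<in> Es" for w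
    by (rule l_integrable(2)[OF u that])
qed

text \<open>The Riesz representative of the derivative of \<Psi> at \<open>u\<close>. It is
  determined only up to seminorm zero, and only its products and its seminorm are ever used.\<close>

definition K :: "('a \<Rightarrow> real) \<Rightarrow> 'a \<Rightarrow> real" where "K u = (SOME k. k \<in> Es \<and> (\<forall>w\<in>Es. BE k w = l u w))"

lemma K: assumes "u \<in> Es" shows "K u \<in> Es" "w \<in> Es \<Longrightarrow> BE (K u) w = l u w"
  using someI_ex[OF l_riesz[OF assms, unfolded Bex_def]] unfolding K_def[symmetric] by auto

text \<open>Test the difference of the functionals \<open>l u\<close> and \<open>l v\<close> with
  \<open>K u - K v\<close> itself and divide by its seminorm.\<close>

lemma K_diff:
  assumes uv: "u \<in> Es" "v \<in> Es" "E.N u \<le> R" "E.N v \<le> R"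
    and \<beta>: "(\<integral>x. \<bar>(u - v) x\<bar> powr q \<partial>lborel) \<le> \<beta> powr q" "0 \<le> \<beta>"
  shows "E.N (K u - K v) \<le> Lc R (L2.N lborel (u - v)) \<beta>"
proof (cases "E.N (K u - K v) = 0")
  case True
  have "0 \<le> L2.N lborel (u - v)" using uv by (simp add: Es_L2)
  then have "0 \<le> Lc R (L2.N lborel (u - v)) \<beta>"
    unfolding Lc_def using a_pos S(1) \<beta>(2) V0(1) by (intro add_nonneg_nonneg mult_nonneg_nonneg divide_nonneg_nonneg) auto
  then show ?thesis using True by simp
next
  case False
  define w where "w = K u - K v"
  have w: "w \<in> Es" using K(1) uv by (simp add: w_def)
  have "(E.N w)\<^sup>2 = BE (K u) w - BE (K v) w"
    using w K(1)[OF uv(1)] K(1)[OF uv(2)] E.B_diff[of "K u" "K v" w] by (simp add: E.N_sq flip: w_def)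
  also have "\<dots> = l u w - l v w" using K(2)[OF uv(1) w] K(2)[OF uv(2) w] by simp
  also have "\<dots> \<le> Lc R (L2.N lborel (u - v)) \<beta> * E.N w" using l_diff[OF uv w \<beta>] by linarith
  finally have "E.N w * E.N w \<le> Lc R (L2.N lborel (u - v)) \<beta> * E.N w" by (simp add: power2_eq_square)
  moreover have "E.N w > 0" using False E.N_nonneg[OF w] by (simp add: w_def)
  ultimately show ?thesis by (simp add: w_def)
qed

lemma F_integrable: assumes u: "u \<in> Es" shows "integrable lborel (\<lambda>x. F x (u x))"
proof -
  note [measurable] = Es_borel[OF u]
  have \<beta>: "(\<integral>x. \<bar>u x\<bar> powr q \<partial>lborel) \<le> (S * E.N u) powr q" "0 \<le> S * E.N u" using S u by auto
  note W = weight_integral[OF u E.E_zero order_refl _ u u \<beta>]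
  have "\<bar>F x (u x)\<bar> \<le> (a1 + a2 * (\<bar>u x\<bar> powr (p - 1) + \<bar>0 x\<bar> powr (p - 1))) * (\<bar>u x\<bar> * \<bar>u x\<bar>)" for x
    using F_taylor[of x "u x" 0] by (simp add: f_zero power2_eq_square)
  then show ?thesis
    by (intro Bochner_Integration.integrable_bound[OF W(1)]) (use E.N_nonneg[OF u] order.trans[OF _ abs_ge_self] in auto)
qed

text \<open>The pointwise remainder from \<open>F_taylor\<close> is the weight times the square of
  \<open>v - u\<close>, so \<open>weight_integral\<close> applies with both further factors equal to
  \<open>v - u\<close>.\<close>

lemma \<Psi>_taylor:
  assumes uv: "u \<in> Es" "v \<in> Es" "E.N u \<le> R" "E.N v \<le> R"
  shows "\<bar>\<Psi> v - \<Psi> u - l u (v - u)\<bar> \<le> Lc R (L2.N lborel (v - u)) (S * E.N (v - u)) * E.N (v - u)"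
proof -
  have d: "v - u \<in> Es" using uv by simp
  note [measurable] = Es_borel[OF uv(1)] Es_borel[OF uv(2)]
  have \<beta>: "(\<integral>x. \<bar>(v - u) x\<bar> powr q \<partial>lborel) \<le> (S * E.N (v - u)) powr q" "0 \<le> S * E.N (v - u)"
    using S(1) S(2)[OF d] E.N_nonneg[OF d] by auto
  note W = weight_integral[OF uv d d \<beta>]
  note i = F_integrable[OF uv(1)] F_integrable[OF uv(2)] l_integrable(1)[OF uv(1) d]
  have pw: "\<bar>F x (v x) - F x (u x) - f x (u x) * (v - u) x\<bar>
     \<le> (a1 + a2 * (\<bar>u x\<bar> powr (p - 1) + \<bar>v x\<bar> powr (p - 1))) * (\<bar>(v - u) x\<bar> * \<bar>(v - u) x\<bar>)" for x
    using F_taylor[of x "v x" "u x"] by (simp add: power2_eq_square abs_mult_self_eq)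
  have "\<bar>\<Psi> v - \<Psi> u - l u (v - u)\<bar> = \<bar>\<integral>x. F x (v x) - F x (u x) - f x (u x) * (v - u) x \<partial>lborel\<bar>"
    unfolding \<Psi>_def l_def using i by (simp del: minus_apply)
  also have "\<dots> \<le> (\<integral>x. \<bar>F x (v x) - F x (u x) - f x (u x) * (v - u) x\<bar> \<partial>lborel)" by (rule integral_abs_bound)
  also have "\<dots> \<le> (\<integral>x. (a1 + a2 * (\<bar>u x\<bar> powr (p - 1) + \<bar>v x\<bar> powr (p - 1))) * (\<bar>(v - u) x\<bar> * \<bar>(v - u) x\<bar>) \<partial>lborel)"
    using i W(1) by (intro integral_mono pw integrable_abs Bochner_Integration.integrable_diff) auto
  also have "\<dots> \<le> Lc R (L2.N lborel (v - u)) (S * E.N (v - u)) * E.N (v - u)" using W(2) by (simp only: Lc_def)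
  finally show ?thesis .
qed

definition J :: "('a \<Rightarrow> real) \<Rightarrow> real" where "J u = BE u u / 2 - \<Psi> u"

definition G :: "('a \<Rightarrow> real) \<Rightarrow> 'a \<Rightarrow> real" where "G u = u - K u"

definition LR :: "real \<Rightarrow> real" where "LR R = a1 / V0 + 2 * a2 * ((S * R) powr q + 2) * S\<^sup>2"

text \<open>With both norms estimated by the energy, the two-number bound becomes a Lipschitz
  bound.\<close>

lemma Lc_le_LR:
  assumes d: "d \<in> Es" shows "Lc R (L2.N lborel d) (S * E.N d) \<le> LR R * E.N d"
proof -
  have "a1 * L2.N lborel d / sqrt V0 \<le> a1 * (E.N d / sqrt V0) / sqrt V0"
    using L2_le_NE[OF d] a_pos V0 by (intro divide_right_mono mult_left_mono) auto
  also have "\<dots> = a1 / V0 * E.N d" using V0 by (simp add: field_simps flip: real_sqrt_mult power2_eq_square)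
  finally show ?thesis by (simp add: Lc_def LR_def algebra_simps power2_eq_square)
qed

lemma LR_nonneg: "0 \<le> LR R"
  using a_pos V0 by (simp add: LR_def)

lemma C1_lip_J: "E.C1_lip J G"
  unfolding E.C1_lip_def
proof (intro conjI ballI allI)
  show "G u \<in> Es" if "u \<in> Es" for u using that K(1) by (simp add: G_def)
  fix R
  show "\<exists>L\<ge>0. \<forall>u\<in>Es. \<forall>v\<in>Es. E.N u \<le> R \<longrightarrow> E.N v \<le> R \<longrightarrow>
       \<bar>J v - J u - BE (G u) (v - u)\<bar> \<le> L * (E.N (v - u))\<^sup>2 \<and> E.N (G u - G v) \<le> L * E.N (u - v)"
  proof (intro exI[of _ "1 + LR R"] conjI ballI impI)
    show "0 \<le> 1 + LR R" using LR_nonneg[of R] by simp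
    fix u v assume uv: "u \<in> Es" "v \<in> Es" "E.N u \<le> R" "E.N v \<le> R"
    have d: "v - u \<in> Es" "u - v \<in> Es" using uv by auto
    have eq: "J v - J u - BE (G u) (v - u) = (E.N (v - u))\<^sup>2 / 2 - (\<Psi> v - \<Psi> u - l u (v - u))"
    proof -
      have "BE (G u) (v - u) = BE u (v - u) - l u (v - u)"
        using uv K[OF uv(1)] d by (simp add: G_def E.B_diff)
      moreover have "BE v v = BE u u + 2 * BE u (v - u) + BE (v - u) (v - u)"
        using E.quadratic_expand[OF uv(1) d(1), of 1] by simp
      ultimately show ?thesis unfolding E.N_sq[OF d(1)] by (simp add: J_def field_simps)
    qed
    have "\<bar>\<Psi> v - \<Psi> u - l u (v - u)\<bar> \<le> LR R * E.N (v - u) * E.N (v - u)"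
      using \<Psi>_taylor[OF uv] mult_right_mono[OF Lc_le_LR[OF d(1), of R] E.N_nonneg[OF d(1)]] by linarith
    then have "\<bar>\<Psi> v - \<Psi> u - l u (v - u)\<bar> \<le> LR R * (E.N (v - u))\<^sup>2" by (simp add: power2_eq_square)
    moreover have "\<bar>n / 2 - m\<bar> \<le> n + b" if "\<bar>m\<bar> \<le> b" "0 \<le> n" for n m b :: real using that by linarith
    ultimately have "\<bar>J v - J u - BE (G u) (v - u)\<bar> \<le> (E.N (v - u))\<^sup>2 + LR R * (E.N (v - u))\<^sup>2"
      unfolding eq by simp
    then show "\<bar>J v - J u - BE (G u) (v - u)\<bar> \<le> (1 + LR R) * (E.N (v - u))\<^sup>2"
      by (simp add: distrib_right)
    have \<beta>: "(\<integral>x. \<bar>(u - v) x\<bar> powr q \<partial>lborel) \<le> (S * E.N (u - v)) powr q" "0 \<le> S * E.N (u - v)"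
      using S(1) S(2)[OF d(2)] E.N_nonneg[OF d(2)] by auto
    have kd: "K u - K v \<in> Es" using K(1) uv by simp
    have "G u - G v = (u - v) - (K u - K v)" by (simp add: G_def)
    then have "E.N (G u - G v) \<le> E.N (u - v) + E.N (K u - K v)" using E.N_triangle_diff[OF d(2) kd] by simp
    moreover have "E.N (K u - K v) \<le> LR R * E.N (u - v)"
      using K_diff[OF uv \<beta>] Lc_le_LR[OF d(2), of R] by linarith
    ultimately show "E.N (G u - G v) \<le> (1 + LR R) * E.N (u - v)" unfolding distrib_right by linarith
  qed
qed

lemma J_zero: "J 0 = 0"
  by (simp add: J_def \<Psi>_def E.B_zero)

section \<open>Mountain pass geometry near 0 and the Palais-Smale condition\<close>

lemma V_integral: assumes u: "u \<in> Es" shows "integrable lborel (\<lambda>x. V x * (u x)\<^sup>2)" "(\<integral>x. V x * (u x)\<^sup>2 \<partial>lborel) \<le> (E.N u)\<^sup>2"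
proof -
  have e: "(norm (pot u x))\<^sup>2 = V x * (u x)\<^sup>2" for x by (simp add: pot_def power_mult_distrib V_nonneg)
  show "integrable lborel (\<lambda>x. V x * (u x)\<^sup>2)" using L2_integrable[OF Es_pot[OF u]] unfolding e .
  have "(\<integral>x. V x * (u x)\<^sup>2 \<partial>lborel) = (L2.N lborel (pot u))\<^sup>2" using L2_N_sq[OF Es_pot[OF u]] unfolding e by simp
  then show "(\<integral>x. V x * (u x)\<^sup>2 \<partial>lborel) \<le> (E.N u)\<^sup>2" unfolding NE_sq[OF u] by simp
qed

text \<open>By \<open>F_upper\<close>, \<Psi> is at most a quarter of the squared norm plus
  \<open>D\<close> times its power \<open>q\<close>. As \<open>q\<close> exceeds 2, a small sphere
  keeps an eighth of the squared norm out of the leading half.\<close>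

lemma mountain_ring: "\<exists>r>0. \<forall>u\<in>Es. E.N u = r \<longrightarrow> r\<^sup>2 / 8 \<le> J u"
proof -
  obtain C where C: "C \<ge> 0" "\<And>x t. F x t \<le> V x / 4 * t\<^sup>2 + C * \<bar>t\<bar> powr q" using F_upper by blast
  define D where "D = C * S powr q"
  have D: "D \<ge> 0" using C by (simp add: D_def)
  \<comment> \<open>Solves \<open>r powr (q - 2) = 1 / (8 * (D + 1))\<close>; the 1 guards against
    \<open>D = 0\<close>.\<close>
  define r where "r = (1 / (8 * (D + 1))) powr (1 / (q - 2))"
  have r: "r > 0" using D by (simp add: r_def)
  have rq: "D * r powr q \<le> r\<^sup>2 / 8"
  proof -
    have "r powr (q - 2) = 1 / (8 * (D + 1))" using D q_bounds by (simp add: r_def powr_powr)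
    moreover have "D * (1 / (8 * (D + 1))) \<le> 1 / 8" using D by (simp add: field_simps)
    ultimately have "D * r powr (q - 2) \<le> 1 / 8" by simp
    then have "D * r powr (q - 2) * r\<^sup>2 \<le> 1 / 8 * r\<^sup>2" by (intro mult_right_mono) auto
    moreover have "r powr q = r powr (q - 2) * r\<^sup>2"
      using powr_add[of r "q - 2" 2] r powr_realpow[of r 2] by simp
    ultimately show ?thesis by (simp add: mult.assoc)
  qed
  have "r\<^sup>2 / 8 \<le> J u" if u: "u \<in> Es" "E.N u = r" for u
  proof -
    note Vi = V_integral[OF u(1)]
    have "\<Psi> u \<le> (\<integral>x. V x * (u x)\<^sup>2 / 4 + C * \<bar>u x\<bar> powr q \<partial>lborel)"
      unfolding \<Psi>_def using Vi(1) Lq_integrable[OF u(1)] C(2)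
      by (intro integral_mono F_integrable u) auto
    also have "\<dots> = (\<integral>x. V x * (u x)\<^sup>2 \<partial>lborel) / 4 + C * (\<integral>x. \<bar>u x\<bar> powr q \<partial>lborel)"
      using Vi(1) Lq_integrable[OF u(1)] by simp
    also have "\<dots> \<le> r\<^sup>2 / 4 + C * (S * r) powr q"
      using Vi(2) S(2)[OF u(1)] C(1) u(2) by (intro add_mono mult_left_mono) auto
    also have "C * (S * r) powr q = D * r powr q" using S(1) r by (simp add: D_def powr_mult)
    finally have "\<Psi> u \<le> r\<^sup>2 / 4 + r\<^sup>2 / 8" using rq by simp
    moreover have "BE u u = r\<^sup>2" using E.N_sq[OF u(1)] u(2) by simp
    ultimately show ?thesis by (simp add: J_def)
  qed
  then show ?thesis using r by blast
qed

text \<open>In \<open>\<mu> * J u - BE (G u) u\<close> the Ambrosetti-Rabinowitz condition makes the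
  nonlinear terms nonnegative in sum, and \<open>\<mu> / 2 - 1\<close> times the squared norm
  remains. Above norm 1 the resulting quadratic inequality is divided by the norm.\<close>

lemma PS_bounded:
  assumes u: "u \<in> Es" and c: "J u \<le> c" and g: "E.N (G u) \<le> g" and pos: "0 \<le> c" "0 \<le> g"
  shows "E.N u \<le> 1 + (\<mu> * c + g) / (\<mu> / 2 - 1)"
proof -
  have m: "\<mu> / 2 - 1 > 0" using \<mu> by simp
  have Gu: "G u \<in> Es" using u K(1) by (simp add: G_def)
  have "BE (G u) u = BE u u - l u u" using u K[OF u] by (simp add: G_def E.B_diff)
  moreover have "\<mu> * \<Psi> u \<le> l u u"
  proof -
    have "(\<integral>x. \<mu> * F x (u x) \<partial>lborel) \<le> (\<integral>x. f x (u x) * u x \<partial>lborel)"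
      using F_integrable[OF u] l_integrable(1)[OF u u] AR' by (intro integral_mono) (auto simp: mult.commute)
    then show ?thesis by (simp add: \<Psi>_def l_def)
  qed
  ultimately have "(\<mu> / 2 - 1) * (E.N u)\<^sup>2 \<le> \<mu> * J u - BE (G u) u"
    unfolding E.N_sq[OF u] J_def by (simp add: algebra_simps)
  also have "\<dots> \<le> \<mu> * c + g * E.N u"
  proof -
    have "\<mu> * J u \<le> \<mu> * c" using c \<mu> by (intro mult_left_mono) auto
    moreover have "- BE (G u) u \<le> E.N (G u) * E.N u" using E.cauchy_schwarz[OF Gu u] by linarith
    moreover have "E.N (G u) * E.N u \<le> g * E.N u" using g u by (intro mult_right_mono) auto
    ultimately show ?thesis by linarith
  qed
  finally have le: "(\<mu> / 2 - 1) * (E.N u)\<^sup>2 \<le> \<mu> * c + g * E.N u" .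
  show ?thesis
  proof (cases "E.N u \<le> 1")
    case True
    have "0 \<le> (\<mu> * c + g) / (\<mu> / 2 - 1)" using m pos \<mu> by simp
    then show ?thesis using True by linarith
  next
    case False
    then have n: "1 \<le> E.N u" by simp
    have "\<mu> * c * 1 \<le> \<mu> * c * E.N u" using n pos \<mu> by (intro mult_left_mono) auto
    then have "(\<mu> / 2 - 1) * E.N u * E.N u \<le> (\<mu> * c + g) * E.N u"
      using le by (simp add: power2_eq_square algebra_simps)
    then have "(\<mu> / 2 - 1) * E.N u \<le> \<mu> * c + g" using n by simp
    then have "E.N u \<le> (\<mu> * c + g) / (\<mu> / 2 - 1)" using m by (simp add: pos_le_divide_eq mult.commute)
    then show ?thesis by simp
  qed
qed

text \<open>Outside a large ball the square root of \<open>V\<close> is at least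
  \<open>R / \<epsilon>\<close>, so there \<open>u\<close> is at most \<open>\<epsilon> / R\<close>
  times \<open>pot u\<close>.\<close>

lemma Es_tight:
  assumes "\<epsilon> > 0" "R > 0" shows "\<exists>T. \<forall>u\<in>Es. E.N u \<le> R \<longrightarrow> L2.N lborel (u - trunc T u) \<le> \<epsilon>"
proof -
  obtain T where T: "\<And>x. T \<le> norm x \<Longrightarrow> (R / \<epsilon>)\<^sup>2 \<le> V x" using V_coercive by blast
  have "L2.N lborel (u - trunc T u) \<le> \<epsilon>" if u: "u \<in> Es" "E.N u \<le> R" for u
  proof -
    have "L2.N lborel (u - trunc T u) \<le> (\<epsilon> / R) * L2.N lborel (pot u)"
    proof (rule L2_N_mono[OF Es_pot[OF u(1)]])
      show "u - trunc T u \<in> borel_measurable lborel"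
        using Es_L2[OF u(1)] trunc_L2 by (intro L2_measurable[OF L2.E_diff]) auto
      show "AE x in lborel. norm ((u - trunc T u) x) \<le> \<epsilon> / R * norm (pot u x)"
      proof (rule AE_I2)
        fix x
        show "norm ((u - trunc T u) x) \<le> \<epsilon> / R * norm (pot u x)"
        proof (cases "norm x < T")
          case True
          then show ?thesis using assms by (simp add: trunc_def)
        next
          case False
          then have "R / \<epsilon> \<le> sqrt (V x)" using T[of x] by (intro real_le_rsqrt) auto
          then have "R / \<epsilon> * \<bar>u x\<bar> \<le> sqrt (V x) * \<bar>u x\<bar>" by (intro mult_right_mono) auto
          then have "\<bar>u x\<bar> \<le> \<epsilon> / R * (sqrt (V x) * \<bar>u x\<bar>)" using assms by (simp add: field_simps)
          then show ?thesis using False V_nonneg[of x] by (simp add: trunc_def pot_def abs_mult)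
        qed
      qed
    qed (use assms in simp)
    also have "\<dots> \<le> (\<epsilon> / R) * R"
      using pot_le_NE[OF u(1)] u(2) assms by (intro mult_left_mono) auto
    finally show ?thesis using assms by simp
  qed
  then show ?thesis by blast
qed

text \<open>Boundedness and tightness give an L^2 Cauchy subsequence. Since \<open>G\<close> tends
  to 0 along it, only the differences of \<open>K\<close> need to be small, and
  \<open>K_diff\<close> measures them by the L^2 and L^q norms.\<close>

lemma palais_smale:
  assumes X: "\<And>n::nat. X n \<in> Es" and bd: "bounded (range (\<lambda>n. J (X n)))" and G0: "(\<lambda>n. E.N (G (X n))) \<longlonglongrightarrow> 0"
  shows "\<exists>r::nat\<Rightarrow>nat. strict_mono r \<and> (\<forall>\<epsilon>>0. \<exists>M. \<forall>m\<ge>M. \<forall>n\<ge>M. E.N (X (r m) - X (r n)) < \<epsilon>)"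
proof -
  have GX: "G (X n) \<in> Es" for n using X K(1) by (simp add: G_def)
  obtain c where c: "c > 0" "\<And>n. \<bar>J (X n)\<bar> \<le> c" using bd unfolding bounded_pos by auto
  have "bounded (range (\<lambda>n. E.N (G (X n))))" by (rule convergent_imp_bounded[OF G0])
  then obtain g where g: "g > 0" "\<And>n. \<bar>E.N (G (X n))\<bar> \<le> g" unfolding bounded_pos by auto
  define R where "R = 1 + (\<mu> * c + g) / (\<mu> / 2 - 1)"
  have XR: "E.N (X n) \<le> R" for n
    unfolding R_def using c g abs_le_D1[OF c(2)[of n]] abs_le_D1[OF g(2)[of n]] by (intro PS_bounded X) auto
  have R: "R > 0" unfolding R_def using c g \<mu> by (intro add_pos_nonneg) auto
  have "\<exists>r::nat\<Rightarrow>nat. strict_mono r \<and> (\<forall>\<epsilon>>0. \<exists>M. \<forall>m\<ge>M. \<forall>n\<ge>M. L2.N lborel (X (r m) - X (r n)) < \<epsilon>)"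
  proof (rule L2_compactness[OF _ s(1)])
    show "L2_hoelder s (g0 * R) (X n)" for n using XR[of n] g0 by (intro Es_hoelder X mult_left_mono) auto
    show "\<exists>T. \<forall>n. L2.N lborel (X n - trunc T (X n)) \<le> \<epsilon>" if "\<epsilon> > 0" for \<epsilon>
      using Es_tight[OF that R] X XR by blast
  qed
  then obtain r :: "nat \<Rightarrow> nat" where r: "strict_mono r"
    "\<And>\<epsilon>. \<epsilon> > 0 \<Longrightarrow> \<exists>M. \<forall>m\<ge>M. \<forall>n\<ge>M. L2.N lborel (X (r m) - X (r n)) < \<epsilon>" by blast
  have "\<exists>M. \<forall>m\<ge>M. \<forall>n\<ge>M. E.N (X (r m) - X (r n)) < \<epsilon>" if \<epsilon>: "\<epsilon> > 0" for \<epsilon>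
  proof -
    define Q where "Q = 2 * a2 * ((S * R) powr q + 2) * S"
    have Q: "Q > 0" unfolding Q_def using a_pos S(1) by (intro mult_pos_pos add_nonneg_pos) auto
    \<comment> \<open>The admissible L^q norm of a difference, so that the power part of
      \<open>Lc\<close> costs at most \<epsilon>/8.\<close>
    define \<beta> where "\<beta> = \<epsilon> / (8 * Q)"
    have \<beta>: "\<beta> > 0" "Q * \<beta> \<le> \<epsilon> / 8" using \<epsilon> Q by (auto simp: \<beta>_def)
    have bq: "\<beta> powr q / 2 > 0" using \<beta> by simp
    obtain C where C: "C \<ge> 0" "\<And>u. u \<in> Es \<Longrightarrow> E.N u \<le> 2 * R \<Longrightarrow> (\<integral>x. \<bar>u x\<bar> powr q \<partial>lborel) \<le> C * (L2.N lborel u)\<^sup>2 + \<beta> powr q / 2"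
      using Lq_small[OF bq, of "2 * R"] R by auto
    \<comment> \<open>The L^2 threshold has two duties: through \<open>C\<close> it keeps the L^q
      norm of differences, whose energy is at most \<open>2 * R\<close>, below \<beta>; and it makes
      the \<open>a1\<close> part of \<open>Lc\<close> at most \<epsilon>/8.\<close>
    define \<eta> where "\<eta> = min (sqrt (\<beta> powr q / (2 * (C + 1)))) (\<epsilon> * sqrt V0 / (8 * a1))"
    have \<eta>: "\<eta> > 0" unfolding \<eta>_def using \<beta> C \<epsilon> V0 a_pos by simp
    have \<eta>1: "C * \<eta>\<^sup>2 \<le> \<beta> powr q / 2"
    proof -
      have "\<eta>\<^sup>2 \<le> (sqrt (\<beta> powr q / (2 * (C + 1))))\<^sup>2" using \<eta> by (intro power_mono) (auto simp: \<eta>_def)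
      also have "\<dots> = \<beta> powr q / (2 * (C + 1))" using C by simp
      finally have "(C + 1) * \<eta>\<^sup>2 \<le> \<beta> powr q / 2" using C by (simp add: field_simps)
      moreover have "C * \<eta>\<^sup>2 \<le> (C + 1) * \<eta>\<^sup>2" by (intro mult_right_mono) auto
      ultimately show ?thesis by linarith
    qed
    have \<eta>2: "a1 * \<eta> / sqrt V0 \<le> \<epsilon> / 8"
    proof -
      have "\<eta> \<le> \<epsilon> * sqrt V0 / (8 * a1)" by (simp add: \<eta>_def)
      then show ?thesis using a_pos V0 by (simp add: field_simps)
    qed
    obtain M1 where M1: "\<And>m n. m \<ge> M1 \<Longrightarrow> n \<ge> M1 \<Longrightarrow> L2.N lborel (X (r m) - X (r n)) < \<eta>" using r(2)[OF \<eta>] by blast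
    from LIMSEQ_D[OF LIMSEQ_subseq_LIMSEQ[OF G0 r(1)], of "\<epsilon> / 4"] \<epsilon> obtain M2 where
      M2: "\<And>n. n \<ge> M2 \<Longrightarrow> norm (E.N (G (X (r n))) - 0) < \<epsilon> / 4" by (auto simp: o_def)
    have "E.N (X (r m) - X (r n)) < \<epsilon>" if mn: "m \<ge> max M1 M2" "n \<ge> max M1 M2" for m n
    proof -
      let ?u = "X (r m)" and ?v = "X (r n)"
      note uv = X[of "r m"] X[of "r n"] XR[of "r m"] XR[of "r n"]
      have d: "?u - ?v \<in> Es" using uv by simp
      have L: "L2.N lborel (?u - ?v) \<le> \<eta>" using M1[of m n] mn by simp
      have "(L2.N lborel (?u - ?v))\<^sup>2 \<le> \<eta>\<^sup>2" using L L2.N_nonneg[OF Es_L2[OF d]] by (intro power_mono)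
      then have "C * (L2.N lborel (?u - ?v))\<^sup>2 \<le> C * \<eta>\<^sup>2" using C by (intro mult_left_mono)
      moreover have "E.N (?u - ?v) \<le> 2 * R" using E.N_triangle_diff[OF uv(1,2)] uv(3,4) by linarith
      ultimately have b: "(\<integral>x. \<bar>(?u - ?v) x\<bar> powr q \<partial>lborel) \<le> \<beta> powr q" using C(2)[OF d] \<eta>1 by linarith
      have "E.N (K ?u - K ?v) \<le> Lc R (L2.N lborel (?u - ?v)) \<beta>"
        using K_diff[OF uv b] \<beta> by simp
      also have "\<dots> \<le> a1 * \<eta> / sqrt V0 + Q * \<beta>"
        unfolding Lc_def Q_def using L a_pos V0 by (intro add_mono divide_right_mono mult_left_mono) (auto simp: mult_ac)
      finally have kk: "E.N (K ?u - K ?v) \<le> \<epsilon> / 4" using \<eta>2 \<beta>(2) by linarith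
      have kd: "K ?u - K ?v \<in> Es" "G ?u - G ?v \<in> Es" using K(1) uv GX by auto
      have "?u - ?v = (G ?u - G ?v) + (K ?u - K ?v)" by (simp add: G_def)
      then have "E.N (?u - ?v) \<le> E.N (G ?u - G ?v) + E.N (K ?u - K ?v)" using E.N_triangle[OF kd(2,1)] by simp
      moreover have "E.N (G ?u - G ?v) \<le> E.N (G ?u) + E.N (G ?v)" by (rule E.N_triangle_diff[OF GX GX])
      moreover have "E.N (G ?u) < \<epsilon> / 4" "E.N (G ?v) < \<epsilon> / 4"
        using M2[of m] M2[of n] mn by (auto simp: abs_less_iff)
      ultimately show ?thesis using kk \<epsilon> by linarith
    qed
    then show ?thesis by blast
  qed
  then show ?thesis using r(1) by blast
qed

end

section \<open>Existence of a solution\<close>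

lemma difference_quotient_cis:
  fixes \<theta> :: real assumes "t \<longlonglongrightarrow> 0" "\<And>n. t n > 0"
  shows "(\<lambda>n. cmod (cis (t n * \<theta>) - 1) / t n) \<longlonglongrightarrow> \<bar>\<theta>\<bar>"
proof -
  have "((\<lambda>r. 2 * sin (r * \<theta> / 2)) has_real_derivative \<theta>) (at 0)"
    by (auto intro!: derivative_eq_intros)
  then have "((\<lambda>h. 2 * sin (h * \<theta> / 2) / h) \<longlongrightarrow> \<theta>) (at 0)" by (simp add: DERIV_def)
  moreover have "filterlim t (at 0) sequentially"
    using assms by (auto simp: filterlim_at less_imp_neq[THEN not_sym])
  ultimately have "(\<lambda>n. 2 * sin (t n * \<theta> / 2) / t n) \<longlonglongrightarrow> \<theta>" by (rule filterlim_compose)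
  then have "(\<lambda>n. \<bar>2 * sin (t n * \<theta> / 2) / t n\<bar>) \<longlonglongrightarrow> \<bar>\<theta>\<bar>" by (rule tendsto_rabs)
  moreover have "\<bar>2 * sin (t n * \<theta> / 2) / t n\<bar> = cmod (cis (t n * \<theta>) - 1) / t n" for n
    using assms(2)[of n] by (simp add: cmod_cis_minus_one abs_mult)
  ultimately show ?thesis by simp
qed

text \<open>Difference quotients in direction \<open>b\<close> are bounded in L^2 by
  \<open>C\<close>. By Plancherel's theorem so are their transforms, and Fatou's lemma gives the
  bound in the limit, without differentiating \<open>u\<close>.\<close>

lemma fourier_gradient_bound:
  fixes u :: "'a::euclidean_space \<Rightarrow> real"
  assumes u: "integrable lborel u" "u \<in> L2 lborel"
    and lip: "\<And>h. L2.N lborel (translate h u - u) \<le> C * norm h" and b: "b \<in> Basis"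
  shows "(\<integral>\<^sup>+\<xi>. ennreal ((\<bar>\<xi> \<bullet> b\<bar> * cmod (fourier1 u \<xi>))\<^sup>2) \<partial>lborel) \<le> ennreal (C\<^sup>2)"
proof -
  have [measurable]: "u \<in> borel_measurable borel" by (rule L2_borel[OF u(2)])
  define t where "t n = inverse (real (Suc n))" for n
  have t: "t \<longlonglongrightarrow> 0" "\<And>n. t n > 0" unfolding t_def using LIMSEQ_inverse_real_of_nat by auto
  let ?q = "\<lambda>n \<xi>. cmod (cis (t n * (\<xi> \<bullet> b)) - 1) / t n * cmod (fourier1 u \<xi>)"
  have int: "(\<integral>\<^sup>+\<xi>. ennreal ((?q n \<xi>)\<^sup>2) \<partial>lborel) \<le> ennreal (C\<^sup>2)" for n
  proof -
    let ?h = "t n *\<^sub>R b"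
    let ?w = "translate ?h u - u"
    have w: "?w \<in> L2 lborel" using translate_L2(1)[OF u(2)] u(2) by simp
    have si: "integrable lborel (translate ?h u)" using integrable_translate[OF u(1)] by (simp add: translate_def)
    have wi: "integrable lborel ?w" using si u(1) by (simp add: fun_diff_def)
    have F: "fourier1 ?w \<xi> = (cis (t n * (\<xi> \<bullet> b)) - 1) * fourier1 u \<xi>" for \<xi>
      unfolding fourier1_diff[OF si u(1)] using fourier1_translate[OF u(1), of ?h \<xi>]
      by (simp add: algebra_simps inner_commute)
    have "(?q n \<xi>)\<^sup>2 = (1 / t n)\<^sup>2 * (norm (fourier1 ?w \<xi>))\<^sup>2" for \<xi>
      unfolding F norm_mult by (simp add: power_mult_distrib power_divide)
    then have "(\<integral>\<^sup>+\<xi>. ennreal ((?q n \<xi>)\<^sup>2) \<partial>lborel) = (\<integral>\<^sup>+\<xi>. ennreal ((1 / t n)\<^sup>2) * ennreal ((norm (fourier1 ?w \<xi>))\<^sup>2) \<partial>lborel)"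
      by (simp add: ennreal_mult)
    also have "\<dots> = ennreal ((1 / t n)\<^sup>2) * (\<integral>\<^sup>+\<xi>. ennreal ((norm (fourier1 ?w \<xi>))\<^sup>2) \<partial>lborel)"
      using L2_borel[OF plancherel(1)[OF wi w]] by (intro nn_integral_cmult) simp
    also have "\<dots> = ennreal ((1 / t n)\<^sup>2 * (L2.N lborel ?w)\<^sup>2)"
      unfolding L2_nn[OF plancherel(1)[OF wi w]] plancherel(2)[OF wi w] by (simp add: ennreal_mult)
    also have "\<dots> \<le> ennreal (C\<^sup>2)"
    proof (rule ennreal_leI)
      have "L2.N lborel ?w \<le> C * t n" using lip[of ?h] b t(2)[of n] by simp
      then have "1 / t n * L2.N lborel ?w \<le> C" using t(2)[of n] by (simp add: field_simps)
      then have "(1 / t n * L2.N lborel ?w)\<^sup>2 \<le> C\<^sup>2" using t(2)[of n] L2.N_nonneg[OF w] by (intro power_mono) auto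
      then show "(1 / t n)\<^sup>2 * (L2.N lborel ?w)\<^sup>2 \<le> C\<^sup>2" by (simp only: power_mult_distrib)
    qed
    finally show ?thesis .
  qed
  have "(\<integral>\<^sup>+\<xi>. ennreal ((\<bar>\<xi> \<bullet> b\<bar> * cmod (fourier1 u \<xi>))\<^sup>2) \<partial>lborel)
      = (\<integral>\<^sup>+\<xi>. liminf (\<lambda>n. ennreal ((?q n \<xi>)\<^sup>2)) \<partial>lborel)"
  proof (rule nn_integral_cong)
    fix \<xi> :: 'a
    have "(\<lambda>n. ennreal ((?q n \<xi>)\<^sup>2)) \<longlonglongrightarrow> ennreal ((\<bar>\<xi> \<bullet> b\<bar> * cmod (fourier1 u \<xi>))\<^sup>2)"
      by (intro tendsto_ennrealI tendsto_power tendsto_mult tendsto_const difference_quotient_cis t)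
    from lim_imp_Liminf[OF sequentially_bot this]
    show "ennreal ((\<bar>\<xi> \<bullet> b\<bar> * cmod (fourier1 u \<xi>))\<^sup>2) = liminf (\<lambda>n. ennreal ((?q n \<xi>)\<^sup>2))" by simp
  qed
  also have "\<dots> \<le> liminf (\<lambda>n. \<integral>\<^sup>+\<xi>. ennreal ((?q n \<xi>)\<^sup>2) \<partial>lborel)"
    by (rule nn_integral_liminf) measurable
  also have "\<dots> \<le> limsup (\<lambda>n. \<integral>\<^sup>+\<xi>. ennreal ((?q n \<xi>)\<^sup>2) \<partial>lborel)" by (rule Liminf_le_Limsup) simp
  also have "\<dots> \<le> ennreal (C\<^sup>2)" by (rule Limsup_bounded, rule always_eventually, rule allI, rule int)
  finally show ?thesis .
qed

text \<open>For \<open>s\<close> below 1 the squared weight is at most 1 plus the squared norm of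
  the frequency, and that is the sum over the coordinates treated in
  \<open>fourier_gradient_bound\<close>.\<close>

lemma fourier_weight_L2:
  fixes u :: "'a::euclidean_space \<Rightarrow> real"
  assumes u: "integrable lborel u" "u \<in> L2 lborel"
    and lip: "\<And>h. L2.N lborel (translate h u - u) \<le> C * norm h" and s: "0 < s" "s < 1"
  shows "(\<lambda>\<xi>. (norm \<xi> powr s) *\<^sub>R fourier1 u \<xi>) \<in> L2 lborel"
proof -
  have [measurable]: "u \<in> borel_measurable borel" by (rule L2_borel[OF u(2)])
  have m: "(\<lambda>\<xi>. (norm \<xi> powr s) *\<^sub>R fourier1 u \<xi>) \<in> borel_measurable lborel" by measurable
  have pw: "(norm ((norm \<xi> powr s) *\<^sub>R fourier1 u \<xi>))\<^sup>2 \<le> (norm (fourier1 u \<xi>))\<^sup>2 + (\<Sum>b\<in>Basis. (\<bar>\<xi> \<bullet> b\<bar> * cmod (fourier1 u \<xi>))\<^sup>2)" for \<xi>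
  proof -
    have "(norm \<xi> powr s)\<^sup>2 \<le> 1 + (norm \<xi>)\<^sup>2"
    proof (cases "norm \<xi> \<le> 1")
      case True
      then have "norm \<xi> powr s \<le> 1 powr s" using s by (intro powr_mono2) auto
      then have "(norm \<xi> powr s)\<^sup>2 \<le> 1\<^sup>2" by (intro power_mono) auto
      then show ?thesis by (simp add: add_increasing2)
    next
      case False
      then have "norm \<xi> powr s \<le> norm \<xi> powr 1" using s by (intro powr_mono) auto
      then have "(norm \<xi> powr s)\<^sup>2 \<le> (norm \<xi>)\<^sup>2" by (intro power_mono) auto
      then show ?thesis by linarith
    qed
    also have "(norm \<xi>)\<^sup>2 = (\<Sum>b\<in>Basis. (\<xi> \<bullet> b)\<^sup>2)"
      unfolding power2_norm_eq_inner by (subst euclidean_inner) (simp add: power2_eq_square)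
    finally have "(norm \<xi> powr s)\<^sup>2 * (cmod (fourier1 u \<xi>))\<^sup>2 \<le> (1 + (\<Sum>b\<in>Basis. (\<xi> \<bullet> b)\<^sup>2)) * (cmod (fourier1 u \<xi>))\<^sup>2"
      by (intro mult_right_mono) auto
    then show ?thesis by (simp add: power_mult_distrib distrib_right sum_distrib_right)
  qed
  have "(\<integral>\<^sup>+\<xi>. ennreal ((norm ((norm \<xi> powr s) *\<^sub>R fourier1 u \<xi>))\<^sup>2) \<partial>lborel)
     \<le> (\<integral>\<^sup>+\<xi>. ennreal ((norm (fourier1 u \<xi>))\<^sup>2) + (\<Sum>b\<in>Basis. ennreal ((\<bar>\<xi> \<bullet> b\<bar> * cmod (fourier1 u \<xi>))\<^sup>2)) \<partial>lborel)"
    by (rule nn_integral_mono) (use pw in \<open>simp add: ennreal_leI sum_nonneg flip: ennreal_plus\<close>)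
  also have "\<dots> = (\<integral>\<^sup>+\<xi>. ennreal ((norm (fourier1 u \<xi>))\<^sup>2) \<partial>lborel) + (\<Sum>b\<in>Basis. \<integral>\<^sup>+\<xi>. ennreal ((\<bar>\<xi> \<bullet> b\<bar> * cmod (fourier1 u \<xi>))\<^sup>2) \<partial>lborel)"
  proof -
    have m1: "(\<lambda>\<xi>. ennreal ((norm (fourier1 u \<xi>))\<^sup>2)) \<in> borel_measurable lborel" by measurable
    have m2: "(\<lambda>\<xi>. \<Sum>b\<in>Basis. ennreal ((\<bar>\<xi> \<bullet> b\<bar> * cmod (fourier1 u \<xi>))\<^sup>2)) \<in> borel_measurable lborel"
      by measurable
    have "(\<integral>\<^sup>+\<xi>. (\<Sum>b\<in>Basis. ennreal ((\<bar>\<xi> \<bullet> b\<bar> * cmod (fourier1 u \<xi>))\<^sup>2)) \<partial>lborel)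
       = (\<Sum>b\<in>Basis. \<integral>\<^sup>+\<xi>. ennreal ((\<bar>\<xi> \<bullet> b\<bar> * cmod (fourier1 u \<xi>))\<^sup>2) \<partial>lborel)"
      by (rule nn_integral_sum) measurable
    then show ?thesis by (simp only: nn_integral_add[OF m1 m2])
  qed
  also have "\<dots> < \<infinity>"
  proof -
    have "(\<Sum>b\<in>Basis. \<integral>\<^sup>+\<xi>. ennreal ((\<bar>\<xi> \<bullet> b\<bar> * cmod (fourier1 u \<xi>))\<^sup>2) \<partial>lborel) \<le> (\<Sum>b\<in>(Basis::'a set). ennreal (C\<^sup>2))"
      by (intro sum_mono fourier_gradient_bound[OF u lip])
    also have "\<dots> < \<infinity>" by (subst sum_ennreal) (auto simp del: sum_constant)
    finally show ?thesis using L2_nn[OF plancherel(1)[OF u]] by simp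
  qed
  finally show ?thesis using L2_iff_nn[OF m] by simp
qed

text \<open>Lipschitz with compact support, hence integrable and with Lipschitz translations in L^2.
  It shows that the energy space is not trivial and spans the ray that leads to the far
  point.\<close>

definition tent :: "'a::euclidean_space \<Rightarrow> real" where "tent x = max 0 (1 - norm x)"

lemma tent_measurable [measurable]: "tent \<in> borel_measurable borel"
  unfolding tent_def by measurable

lemma tent_pos: "norm x < 1 \<Longrightarrow> 0 < tent x" and tent_zero: "1 \<le> norm x \<Longrightarrow> tent x = 0"
  by (auto simp: tent_def)

lemma ball_finite: "emeasure lborel (ball (c::'a::euclidean_space) r) < \<infinity>"
  by (rule emeasure_bounded_finite) simp

lemma tent_L2: "(tent :: 'a::euclidean_space \<Rightarrow> real) \<in> L2 lborel"
proof (rule L2_bound[of "indicator (ball 0 1) :: 'a \<Rightarrow> real" _ _ 1])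
  show "(indicator (ball 0 1) :: 'a \<Rightarrow> real) \<in> L2 lborel" using ball_finite by (intro indicator_L2) auto
  show "AE x in lborel. norm (tent (x::'a)) \<le> 1 * norm (indicator (ball 0 1) x :: real)"
    by (intro AE_I2) (simp add: tent_def indicator_def)
qed simp

lemma tent_integrable: "integrable lborel (tent :: 'a::euclidean_space \<Rightarrow> real)"
proof (rule Bochner_Integration.integrable_bound)
  show "integrable lborel (indicator (ball 0 1) :: 'a \<Rightarrow> real)" 
    using ball_finite[of "0::'a" 1] by (intro integrable_real_indicator) auto
  show "AE x in lborel. norm (tent (x::'a)) \<le> norm (indicator (ball 0 1) x :: real)"
    by (intro AE_I2) (simp add: tent_def indicator_def)
qed simp

text \<open>The tent is 1-Lipschitz, and its difference with a translate lives on the union of two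
  unit balls, where the sum of the two indicators is at least 1.\<close>

lemma tent_translate: "\<exists>C. \<forall>h. L2.N lborel (translate h tent - (tent :: 'a::euclidean_space \<Rightarrow> real)) \<le> C * norm h"
proof -
  define I where "I = (indicator (ball 0 1) :: 'a \<Rightarrow> real)"
  have I: "I \<in> L2 lborel" unfolding I_def using ball_finite by (intro indicator_L2) auto
  have "L2.N lborel (translate h tent - (tent :: 'a \<Rightarrow> real)) \<le> (2 * L2.N lborel I) * norm h" for h :: 'a
  proof -
    have sI: "translate h I + I \<in> L2 lborel" using translate_L2(1)[OF I] I by simp
    have "L2.N lborel (translate h tent - (tent :: 'a \<Rightarrow> real)) \<le> norm h * L2.N lborel (translate h I + I)"
    proof (rule L2_N_mono[OF sI])
      show "translate h tent - (tent :: 'a \<Rightarrow> real) \<in> borel_measurable lborel"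
        by (intro L2_measurable[OF L2.E_diff] translate_L2(1) tent_L2)
      show "AE x in lborel. norm ((translate h tent - (tent :: 'a \<Rightarrow> real)) x) \<le> norm h * norm ((translate h I + I) x)"
      proof (rule AE_I2)
        fix x :: 'a
        show "norm ((translate h tent - (tent :: 'a \<Rightarrow> real)) x) \<le> norm h * norm ((translate h I + I) x)"
        proof (cases "norm x < 1 \<or> norm (x + h) < 1")
          case True
          have "\<bar>tent (x + h) - tent x\<bar> \<le> norm h"
            using norm_triangle_ineq[of x h] norm_triangle_ineq4[of "x + h" h] by (auto simp: tent_def)
          moreover have "1 \<le> norm ((translate h I + I) x)" using True by (auto simp: translate_def I_def indicator_def)
          ultimately show ?thesis using mult_left_mono[of 1 "norm ((translate h I + I) x)" "norm h"] by (simp add: translate_def)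
        next
          case False
          then show ?thesis by (simp add: translate_def tent_zero)
        qed
      qed
    qed simp
    also have "\<dots> \<le> norm h * (L2.N lborel I + L2.N lborel I)"
      using L2.N_triangle[OF translate_L2(1)[OF I, of h] I] translate_L2(2)[OF I, of h] by (intro mult_left_mono) auto
    finally show ?thesis by (simp add: algebra_simps)
  qed
  then show ?thesis by blast
qed

text \<open>Truncation at radius 1 or more does not change the tent, so the defining limit is
  attained.\<close>

lemma tent_fourier: "is_fourier_L2 tent (fourier1 (tent :: 'a::euclidean_space \<Rightarrow> real))"
proof -
  have "\<forall>\<^sub>F R in at_top. L2.N lborel (fourier1 tent - fourier1 (trunc R (tent :: 'a \<Rightarrow> real))) = 0"
    using eventually_ge_at_top[of 1]
  proof eventually_elim
    case (elim R)
    have "trunc R tent = (tent :: 'a \<Rightarrow> real)"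
      using elim by (auto simp: trunc_def fun_eq_iff indicator_def tent_zero not_less)
    then show ?case by simp
  qed
  then show ?thesis
    unfolding is_fourier_L2_iff[OF tent_L2]
    using plancherel(1)[OF tent_integrable tent_L2] by (auto intro: tendsto_eventually)
qed

lemma tent_not_AE_zero: "\<not> (AE x in lborel. tent (x::'a::euclidean_space) = 0)"
proof
  assume "AE x in lborel. tent (x::'a) = 0"
  then have "AE x in lborel. x \<notin> ball (0::'a) 1"
    by eventually_elim (use tent_pos in force)
  then have "emeasure lborel (ball (0::'a) 1) = 0"
    by (subst (asm) AE_iff_measurable[OF _ refl]) (auto simp: ball_def)
  then show False using emeasure_ball[of 1 "0::'a"] unit_ball_vol_pos[of "DIM('a)"] by simp
qed

context schroedinger
begin

text \<open>Continuity bounds \<open>V\<close> on the unit ball, which contains the support of the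
  tent; elsewhere the growth of \<open>V\<close> does no harm.\<close>

lemma tent_Es: assumes V: "continuous_on UNIV V" shows "tent \<in> Es"
proof -
  obtain C where "\<And>h. L2.N lborel (translate h tent - (tent :: 'a \<Rightarrow> real)) \<le> C * norm h" using tent_translate by blast
  note w = fourier_weight_L2[OF tent_integrable tent_L2 this s]
  have "freq tent \<in> L2 lborel"
  proof (rule L2_bound[OF w freq_measurable[OF tent_L2], of 1])
    show "AE x in lborel. norm (freq tent x) \<le> 1 * norm (norm x powr s *\<^sub>R fourier1 tent x)"
      using fhat_unique[OF tent_L2 tent_fourier] by eventually_elim (simp add: freq_def)
  qed
  moreover have "pot tent \<in> L2 lborel"
  proof -
    have "bounded (V ` cball 0 1)"
      by (intro compact_imp_bounded compact_continuous_image continuous_on_subset[OF V]) auto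
    then obtain M where M: "\<forall>x\<in>cball 0 1. \<bar>V x\<bar> \<le> M" by (auto simp: bounded_real)
    show ?thesis
    proof (rule L2_bound[OF tent_L2, of _ "sqrt M"])
      show "AE x in lborel. norm (pot tent x) \<le> sqrt M * norm (tent x)"
      proof (rule AE_I2)
        fix x :: 'a
        show "norm (pot tent x) \<le> sqrt M * norm (tent x)"
        proof (cases "norm x < 1")
          case True
          then have "V x \<le> M" using M by (force simp: abs_le_iff)
          then show ?thesis using V_nonneg[of x] by (auto simp: pot_def abs_mult intro!: mult_right_mono)
        qed (simp add: pot_def tent_zero)
      qed
    qed (simp add: pot_def)
  qed
  ultimately show ?thesis using tent_L2 by (simp add: Es_iff)
qed

text \<open>Along the ray through the tent the quadratic part grows like t^2 and \<Psi> at least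
  like t^\<mu>, with \<mu> above 2.\<close>

lemma mountain_far:
  assumes V: "continuous_on UNIV V" shows "\<exists>e\<in>Es. J e \<le> 0 \<and> r < E.N e"
proof -
  let ?u = "tent :: 'a \<Rightarrow> real"
  have u: "?u \<in> Es" by (rule tent_Es[OF V])
  have Nu: "E.N ?u > 0"
    using Es_zero_AE[OF u] tent_not_AE_zero E.N_nonneg[OF u] by fastforce
  \<comment> \<open>\<open>F\<close> is positive away from \<open>t = 0\<close>, so a vanishing
    integral would force the tent to vanish almost everywhere.\<close>
  have "\<Psi> ?u \<noteq> 0"
  proof
    assume "\<Psi> ?u = 0"
    then have "AE x in lborel. F x (?u x) = 0"
      using integral_nonneg_eq_0_iff_AE[OF F_integrable[OF u]] F_nonneg by (simp add: \<Psi>_def)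
    then have "AE x in lborel. ?u x = 0"
    proof eventually_elim
      case (elim x)
      then show ?case using F_pos[of "tent x" x] by (metis less_irrefl)
    qed
    then show False using tent_not_AE_zero by blast
  qed
  moreover have "\<Psi> ?u \<ge> 0" unfolding \<Psi>_def by (intro integral_nonneg_AE) (simp add: F_nonneg)
  ultimately have P: "\<Psi> ?u > 0" by simp
  define B where "B = BE ?u ?u"
  have B: "B \<ge> 0" unfolding B_def by (rule E.B_nonneg[OF u])
  define k where "k = B / (2 * \<Psi> ?u) + 1"
  have k: "k > 0" using B P by (simp add: k_def add_nonneg_pos)
  \<comment> \<open>Three demands: at least 1 for \<open>F_homogeneous\<close>, large enough for a
    norm above \<open>r\<close>, and \<open>k \<le> t powr (\<mu> - 2)\<close>, by which \<Psi>
    outweighs the quadratic part.\<close>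
  define t where "t = max (max 1 ((r + 1) / E.N ?u)) (k powr (1 / (\<mu> - 2)))"
  have t: "1 \<le> t" "(r + 1) / E.N ?u \<le> t" "k powr (1 / (\<mu> - 2)) \<le> t" by (auto simp: t_def)
  have tk: "k \<le> t powr (\<mu> - 2)"
  proof -
    have "(k powr (1 / (\<mu> - 2))) powr (\<mu> - 2) \<le> t powr (\<mu> - 2)" using t \<mu> by (intro powr_mono2) auto
    then show ?thesis using k \<mu> by (simp add: powr_powr)
  qed
  have tu: "t *\<^sub>R ?u \<in> Es" using u by simp
  have "t powr \<mu> * \<Psi> ?u \<le> \<Psi> (t *\<^sub>R ?u)"
  proof -
    have "(\<integral>x. t powr \<mu> * F x (?u x) \<partial>lborel) \<le> (\<integral>x. F x ((t *\<^sub>R ?u) x) \<partial>lborel)"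
      using F_integrable[OF u] F_integrable[OF tu] F_homogeneous[OF t(1)] by (intro integral_mono) auto
    then show ?thesis by (simp add: \<Psi>_def)
  qed
  moreover have "BE (t *\<^sub>R ?u) (t *\<^sub>R ?u) = t\<^sup>2 * B"
    using u by (simp add: B_def E.B_scale E.B_scale2 power2_eq_square)
  moreover have "t\<^sup>2 * B / 2 \<le> t powr \<mu> * \<Psi> ?u"
  proof -
    have "B / 2 \<le> k * \<Psi> ?u" using P by (simp add: k_def field_simps)
    also have "\<dots> \<le> t powr (\<mu> - 2) * \<Psi> ?u" using tk P by (intro mult_right_mono) auto
    finally have "t\<^sup>2 * (B / 2) \<le> t\<^sup>2 * (t powr (\<mu> - 2) * \<Psi> ?u)" by (intro mult_left_mono) auto
    moreover have "t\<^sup>2 * t powr (\<mu> - 2) = t powr \<mu>"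
      using powr_add[of t 2 "\<mu> - 2"] powr_realpow[of t 2] t(1) by simp
    ultimately show ?thesis by (simp add: mult.assoc[symmetric])
  qed
  ultimately have "J (t *\<^sub>R ?u) \<le> 0" by (simp add: J_def)
  moreover have "r < E.N (t *\<^sub>R ?u)"
  proof -
    have "r + 1 \<le> t * E.N ?u" using t(2) Nu by (simp add: pos_divide_le_eq)
    then show ?thesis using u t(1) by (simp add: E.N_scale)
  qed
  ultimately show ?thesis using tu by blast
qed

text \<open>The definition quantifies over arbitrary transforms of \<open>u\<close> and of the test
  function. They agree almost everywhere with \<open>fhat\<close>, so the left side of the equation
  is always \<open>BE\<close>.\<close>

lemma weak_solution_iff:
  assumes u: "u \<in> Es" shows "weak_solution s V f u \<longleftrightarrow> (\<forall>\<phi>\<in>Es. BE u \<phi> = l u \<phi>)"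
proof -
  have eq: "(\<integral>\<xi>. norm \<xi> powr (2 * s) * Re (g \<xi> * cnj (h \<xi>)) \<partial>lborel) + (\<integral>x. V x * u x * \<phi> x \<partial>lborel) = BE u \<phi>"
    if \<phi>: "\<phi> \<in> Es" and g: "is_fourier_L2 u g" and h: "is_fourier_L2 \<phi> h" for \<phi> g h
  proof -
    have [measurable]: "g \<in> borel_measurable borel" "h \<in> borel_measurable borel"
      using g h by (auto simp: is_fourier_L2_def)
    have [measurable]: "freq u \<in> borel_measurable borel" "freq \<phi> \<in> borel_measurable borel"
      using L2_borel[OF Es_freq[OF u]] L2_borel[OF Es_freq[OF \<phi>]] by auto
    have "(\<integral>\<xi>. norm \<xi> powr (2 * s) * Re (g \<xi> * cnj (h \<xi>)) \<partial>lborel) = (\<integral>\<xi>. freq u \<xi> \<bullet> freq \<phi> \<xi> \<partial>lborel)"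
    proof (rule integral_cong_AE)
      show "AE \<xi> in lborel. norm \<xi> powr (2 * s) * Re (g \<xi> * cnj (h \<xi>)) = freq u \<xi> \<bullet> freq \<phi> \<xi>"
        using fhat_unique[OF Es_L2[OF u] g] fhat_unique[OF Es_L2[OF \<phi>] h]
      proof eventually_elim
        case (elim \<xi>)
        have "norm \<xi> powr (2 * s) = norm \<xi> powr s * norm \<xi> powr s" by (simp add: powr_add[symmetric])
        then show ?case by (simp add: elim freq_def inner_complex_def algebra_simps)
      qed
      show "(\<lambda>\<xi>. norm \<xi> powr (2 * s) * Re (g \<xi> * cnj (h \<xi>))) \<in> borel_measurable lborel" by simp
      show "(\<lambda>\<xi>. freq u \<xi> \<bullet> freq \<phi> \<xi>) \<in> borel_measurable lborel"
        by (rule borel_measurable_integrable[OF L2_inner_integrable[OF Es_freq[OF u] Es_freq[OF \<phi>]]])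
    qed
    moreover have "(\<integral>x. V x * u x * \<phi> x \<partial>lborel) = (\<integral>x. pot u x \<bullet> pot \<phi> x \<partial>lborel)"
    proof (rule Bochner_Integration.integral_cong[OF refl])
      fix x
      have "sqrt (V x) * sqrt (V x) = V x" using V_nonneg by simp
      then have "V x * u x * \<phi> x = (sqrt (V x) * sqrt (V x)) * u x * \<phi> x" by simp
      then show "V x * u x * \<phi> x = pot u x \<bullet> pot \<phi> x" by (simp add: pot_def mult_ac)
    qed
    ultimately show ?thesis by (simp add: BE_def ip_def)
  qed
  have "in_Es V s u" using u by (simp add: Es_def)
  moreover have "in_Es V s \<phi> \<longleftrightarrow> \<phi> \<in> Es" for \<phi> by (simp add: Es_def)
  ultimately show ?thesis
    unfolding weak_solution_def l_def
    using eq fhat_fourier[OF Es_L2[OF u]] fhat_fourier[OF Es_L2] by (metis (no_types, lifting))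
qed

theorem nontrivial_solution:
  assumes V: "continuous_on UNIV V"
  shows "\<exists>u. weak_solution s V f u \<and> \<not> (AE x in lborel. u x = 0)"
proof -
  obtain r where r: "r > 0" "\<And>u. u \<in> Es \<Longrightarrow> E.N u = r \<Longrightarrow> r\<^sup>2 / 8 \<le> J u" using mountain_ring by blast
  obtain e where e: "e \<in> Es" "J e \<le> 0" "r < E.N e" using mountain_far[OF V] by blast
  have \<alpha>: "0 < r\<^sup>2 / 8" using r by simp
  obtain u where u: "u \<in> Es" "E.N (G u) = 0" "r\<^sup>2 / 8 \<le> J u"
    using E.mountain_pass[OF C1_lip_J J_zero e r(1) \<alpha> r(2) palais_smale] by blast
  have Gu: "G u \<in> Es" using u K(1) by (simp add: G_def)
  \<comment> \<open>A vector of seminorm zero is orthogonal to everything by Cauchy-Schwarz, so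
    \<open>N (G u) = 0\<close> is as good as a vanishing gradient.\<close>
  have crit: "BE u \<phi> = l u \<phi>" if \<phi>: "\<phi> \<in> Es" for \<phi>
  proof -
    have "BE (G u) \<phi> = 0" using E.cauchy_schwarz[OF Gu \<phi>] u(2) by simp
    moreover have "BE (G u) \<phi> = BE u \<phi> - l u \<phi>" using u(1) \<phi> K[OF u(1)] by (simp add: G_def E.B_diff)
    ultimately show ?thesis by simp
  qed
  \<comment> \<open>For \<open>u\<close> zero almost everywhere the criticality equation would give
    \<open>J u = 0\<close>, against the positive level of the mountain pass.\<close>
  have "\<not> (AE x in lborel. u x = 0)"
  proof
    assume z: "AE x in lborel. u x = 0"
    have "l u u = 0" unfolding l_def
      by (rule integral_eq_zero_AE) (use z in eventually_elim, simp)
    moreover have "\<Psi> u = 0" unfolding \<Psi>_def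
      by (rule integral_eq_zero_AE) (use z in eventually_elim, simp)
    ultimately have "J u = 0" using crit[OF u(1)] by (simp add: J_def)
    then show False using u(3) \<alpha> by simp
  qed
  then show ?thesis using crit weak_solution_iff[OF u(1)] by blast
qed

end

theorem theorem3p1:
  fixes s :: real and V :: "'a::euclidean_space \<Rightarrow> real" and f :: "'a \<Rightarrow> real \<Rightarrow> real"
  assumes s: "0 < s" "s < 1"
    and V1: "\<exists>V'. (\<forall>x. (V has_derivative blinfun_apply (V' x)) (at x)) \<and> continuous_on UNIV V'"
    and V1_inf: "bdd_below (range V)" "(INF x. V x) > 0"
    and f1: "\<exists>f'. (\<forall>z. ((\<lambda>(x, t). f x t) has_derivative blinfun_apply (f' z)) (at z))
                 \<and> continuous_on UNIV f'"
    and f2: "\<And>x. f x 0 = 0 \<and> deriv (f x) 0 = 0"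
    and f3: "\<exists>a1 a2 p. a1 > 0 \<and> a2 > 0 \<and> 1 < p \<and> real DIM('a) > 2 * s \<and>
               p < (real DIM('a) + 2 * s) / (real DIM('a) - 2 * s) \<and>
               (\<forall>x t. \<bar>deriv (f x) t\<bar> \<le> a1 + a2 * \<bar>t\<bar> powr (p - 1))"
    and f4: "\<exists>\<mu>>2. \<forall>x t. t \<noteq> 0 \<longrightarrow>
               0 < \<mu> * (LBINT \<tau>=0..t. f x \<tau>) \<and> \<mu> * (LBINT \<tau>=0..t. f x \<tau>) \<le> t * f x t"
    and Vinf: "filterlim V at_top at_infinity"
  shows "\<exists>u. weak_solution s V f u \<and> \<not> (AE x in lborel. u x = 0)"
proof -
  obtain V' where "\<And>x. (V has_derivative blinfun_apply (V' x)) (at x)" using V1 by blast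
  then have Vc: "continuous_on UNIV V"
    by (auto intro!: continuous_at_imp_continuous_on has_derivative_continuous)
  obtain f' where f': "\<And>z. ((\<lambda>(x, t). f x t) has_derivative blinfun_apply (f' z)) (at z)" "continuous_on UNIV f'"
    using f1 by blast
  \<comment> \<open>The joint derivative in direction (0, 1): joint continuity of the partial
    derivative is inherited from \<open>f'\<close>.\<close>
  define fd where "fd x t = blinfun_apply (f' (x, t)) (0, 1)" for x t
  have fd: "(f x has_real_derivative fd x t) (at t)" for x t
  proof -
    have "((\<lambda>r. (x, r)) has_derivative (\<lambda>r. (0, r))) (at t)" by (auto intro!: derivative_eq_intros)
    from has_derivative_compose[OF this f'(1)]
    have "(f x has_derivative (\<lambda>r. blinfun_apply (f' (x, t)) (0, r))) (at t)" by simp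
    moreover have "blinfun_apply (f' (x, t)) (0, r) = fd x t * r" for r
      using blinfun.scaleR_right[of "f' (x, t)" r "(0, 1)"] by (simp add: fd_def mult.commute)
    ultimately show ?thesis by (simp add: has_field_derivative_def)
  qed
  have dfd: "deriv (f x) t = fd x t" for x t by (rule DERIV_imp_deriv[OF fd])
  obtain a1 a2 p where a: "a1 > 0" "a2 > 0" "1 < p" "2 * s < real DIM('a)"
    "p < (real DIM('a) + 2 * s) / (real DIM('a) - 2 * s)" "\<And>x t. \<bar>fd x t\<bar> \<le> a1 + a2 * \<bar>t\<bar> powr (p - 1)"
    using f3 unfolding dfd by blast
  obtain \<mu> where \<mu>: "\<mu> > 2" "\<And>x t. t \<noteq> 0 \<Longrightarrow>
               0 < \<mu> * (LBINT \<tau>=0..t. f x \<tau>) \<and> \<mu> * (LBINT \<tau>=0..t. f x \<tau>) \<le> t * f x t"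
    using f4 by blast
  \<comment> \<open>The infimum itself is the constant \<open>V0\<close>; it is a lower bound
    because the range of \<open>V\<close> is bounded below.\<close>
  interpret schroedinger s V "INF x. V x" f fd a1 a2 p \<mu>
  proof
    show "V \<in> borel_measurable borel" by (rule borel_measurable_continuous_onI[OF Vc])
    show "(INF x. V x) \<le> V x" for x using V1_inf(1) by (intro cINF_lower) auto
    show "\<exists>R. \<forall>x. R \<le> norm x \<longrightarrow> c \<le> V x" for c
      using Vinf unfolding filterlim_at_top eventually_at_infinity by blast
    show "continuous_on UNIV (\<lambda>(x, t). f x t)"
      using f'(1) by (auto intro!: continuous_at_imp_continuous_on has_derivative_continuous)
    have "continuous_on UNIV (\<lambda>z. blinfun_apply (f' z) (0, 1))" by (intro continuous_intros f'(2))
    then show "continuous_on UNIV (\<lambda>(x, t). fd x t)" by (simp add: fd_def case_prod_beta')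
    show "fd x 0 = 0" for x using f2[of x] by (simp add: dfd)
  qed (use s V1_inf f2 fd a \<mu> in auto)
  show ?thesis by (rule nontrivial_solution[OF Vc])
qed

end
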